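(* Fix $\alpha>0$, $\beta>0$, and real numbers $\lambda,\phi$ with $\phi/\sqrt{\alpha} \ge \lambda > 0$. Let $\mathcal{Q}_{\mathrm{abs}}(\lambda,\phi;\alpha,\beta)$ be the set of all random variables $Q_{\boldsymbol{\lambda}} = \sum_{i=1}^n \lambda_i X_i$, where $n\ge1$ is arbitrary, $\boldsymbol{\lambda}=(\lambda_1,\ldots,\lambda_n)\in\mathbb{R}^n$ (entries of any sign), $X_1,\ldots,X_n$ are i.i.d. $\mathrm{Gamma}(\alpha,\beta)$, and $\max_i|\lambda_i|/\beta \le \lambda$ and $\mathrm{Var}[Q_{\boldsymbol{\lambda}}] = \phi^2$. Define $\hat{x}_{\mathrm{upper}}$ to be the supremum over all inflection points of the probability density functions of the random variables $$Q_{\boldsymbol{\lambda}} + \lambda_j\psi + \lambda_k\psi' - \mathbb{E}[Q_{\boldsymbol{\lambda}}], \qquad Q_{\boldsymbol{\lambda}}\in \mathcal{Q}_{\mathrm{abs}}(\lambda,\phi;\alpha,\beta),\ j\neq k,$$ where $\psi,\psi'$ are i.i.d. $\mathrm{Gamma}(1,\beta)$ (exponential) random variables independent of $Q_{\boldsymbol{\lambda}}$. If $Q_{\boldsymbol{\lambda}}, Q_{\boldsymbol{\mu}} \in \mathcal{Q}_{\mathrm{abs}}(\lambda,\phi;\alpha,\beta)$ satisfy $\boldsymbol{\mu}\preceq_F\boldsymbol{\lambda}$, then $$\Pr\big(Q_{\boldsymbol{\mu}} - \mathbb{E}[Q_{\boldsymbol{\mu}}] \le x\big) \ge \Pr\big(Q_{\boldsymbol{\lambda}}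 - \mathbb{E}[Q_{\boldsymbol{\lambda}}] \le x\big)\quad \text{for all real } x \text{ with } |x| > \hat{x}_{\mathrm{upper}}.$$
   Context: Here the scalar $\lambda$ is a bound, while bold $\boldsymbol{\lambda},\boldsymbol{\mu}$ denote weight vectors. $\mathrm{Gamma}(\alpha,\beta)$ denotes the Gamma distribution with shape $\alpha$ and rate $\beta$ (density $\frac{\beta^\alpha}{\Gamma(\alpha)}x^{\alpha-1}e^{-\beta x}$ on $x\ge0$). Vectors of different lengths are compared by padding with zeros. For a vector $\mathbf{v}$, $\mathbf{v}^- = \min(\mathbf{v},\mathbf{0})$ and $\mathbf{v}^+=\max(\mathbf{v},\mathbf{0})$ elementwise; squares are elementwise. For nonnegative $\mathbf{a},\mathbf{b}\in\mathbb{R}^n$ with decreasingly sorted entries $a_{[i]}, b_{[i]}$, $\mathbf{a}\preceq_w\mathbf{b}$ means $\sum_{i=1}^k a_{[i]}\le\sum_{i=1}^k b_{[i]}$ for all $k\le n$. For real vectors, $\boldsymbol{\mu}\preceq_F\boldsymbol{\lambda}$ means $(\boldsymbol{\mu}^+)^2\preceq_w(\boldsymbol{\lambda}^+)^2$, $(\boldsymbol{\lambda}^-)^2\preceq_w(\boldsymbol{\mu}^-)^2$, and $\sum_i\mu_i^2=\sum_i\lambda_i^2$. *)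

theory Defs
  imports "HOL-Probability.Probability"
begin

definition gamma_density :: "real \<Rightarrow> real \<Rightarrow> real \<Rightarrow> real" where
  "gamma_density a b x =
     (if 0 \<le> x then b powr a / Gamma a * x powr (a - 1) * exp (- b * x) else 0)"

definition gamma_M :: "real \<Rightarrow> real \<Rightarrow> real measure" where
  "gamma_M a b = density lborel (\<lambda>x. ennreal (gamma_density a b x))"

definition Q_dist :: "real \<Rightarrow> real \<Rightarrow> real list \<Rightarrow> real measure" where
  "Q_dist a b l = distr (PiM {..<length l} (\<lambda>_. gamma_M a b)) lborel
                        (\<lambda>x. \<Sum>i<length l. l ! i * x i)"

definition Q_mean :: "real \<Rightarrow> real \<Rightarrow> real list \<Rightarrow> real" where
  "Q_mean a b l = (\<integral>y. y \<partial>Q_dist a b l)"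

definition Q_var :: "real \<Rightarrow> real \<Rightarrow> real list \<Rightarrow> real" where
  "Q_var a b l = (\<integral>y. (y - Q_mean a b l)\<^sup>2 \<partial>Q_dist a b l)"

definition Q_abs :: "real \<Rightarrow> real \<Rightarrow> real \<Rightarrow> real \<Rightarrow> real list set" where
  "Q_abs lam phi a b =
     {l. l \<noteq> [] \<and> (\<forall>i<length l. \<bar>l ! i\<bar> / b \<le> lam) \<and> Q_var a b l = phi\<^sup>2}"

text \<open>Distribution of Q + l_j psi + l_k psi' - E[Q], psi, psi' i.i.d. Gamma(1,b),
  independent of X_1..X_n (coordinates n and n+1 of the product space).\<close>
definition Q_aug_dist :: "real \<Rightarrow> real \<Rightarrow> real list \<Rightarrow> nat \<Rightarrow> nat \<Rightarrow> real measure" where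
  "Q_aug_dist a b l j k =
     distr (PiM {..<length l + 2}
              (\<lambda>i. if i < length l then gamma_M a b else gamma_M 1 b)) lborel
       (\<lambda>x. (\<Sum>i<length l. l ! i * x i) + l ! j * x (length l) + l ! k * x (length l + 1)
             - Q_mean a b l)"

definition strictly_convex_on :: "real set \<Rightarrow> (real \<Rightarrow> real) \<Rightarrow> bool" where
  "strictly_convex_on S f \<longleftrightarrow>
     (\<forall>x\<in>S. \<forall>y\<in>S. x \<noteq> y \<longrightarrow> (\<forall>u. 0 < u \<and> u < 1 \<longrightarrow>
        f (u * x + (1 - u) * y) < u * f x + (1 - u) * f y))"

definition strictly_concave_on :: "real set \<Rightarrow> (real \<Rightarrow> real) \<Rightarrow> bool" where
  "strictly_concave_on S f \<longleftrightarrow> strictly_convex_on S (\<lambda>x. - f x)"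

definition inflection_point :: "(real \<Rightarrow> real) \<Rightarrow> real \<Rightarrow> bool" where
  "inflection_point f x \<longleftrightarrow> (\<exists>e>0.
     (strictly_convex_on {x - e..x} f \<and> strictly_concave_on {x..x + e} f) \<or>
     (strictly_concave_on {x - e..x} f \<and> strictly_convex_on {x..x + e} f))"

definition is_pdf :: "real measure \<Rightarrow> (real \<Rightarrow> real) \<Rightarrow> bool" where
  "is_pdf M f \<longleftrightarrow> (\<forall>y. 0 \<le> f y) \<and> M = density lborel (\<lambda>y. ennreal (f y))"

definition pdf_inflection_points :: "real measure \<Rightarrow> real set" where
  "pdf_inflection_points M =
     {x. \<exists>f. continuous_on UNIV f \<and> is_pdf M f \<and> inflection_point f x}"

definition x_upper :: "real \<Rightarrow> real \<Rightarrow> real \<Rightarrow> real \<Rightarrow> ereal" where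
  "x_upper lam phi a b =
     Sup (ereal ` (\<Union>l\<in>Q_abs lam phi a b. \<Union>j<length l. \<Union>k<length l.
            if j \<noteq> k then pdf_inflection_points (Q_aug_dist a b l j k) else {}))"

definition pad_to :: "nat \<Rightarrow> real list \<Rightarrow> real list" where
  "pad_to N v = v @ replicate (N - length v) 0"

definition sort_dec :: "real list \<Rightarrow> real list" where
  "sort_dec v = rev (sort v)"

definition weak_submaj :: "real list \<Rightarrow> real list \<Rightarrow> bool" where
  "weak_submaj a b \<longleftrightarrow> (let N = max (length a) (length b);
       a' = sort_dec (pad_to N a); b' = sort_dec (pad_to N b)
     in \<forall>k\<le>N. sum_list (take k a') \<le> sum_list (take k b'))"

definition pos_sq :: "real list \<Rightarrow> real list" where
  "pos_sq v = map (\<lambda>t. (max t 0)\<^sup>2) v"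

definition neg_sq :: "real list \<Rightarrow> real list" where
  "neg_sq v = map (\<lambda>t. (min t 0)\<^sup>2) v"

definition F_le :: "real list \<Rightarrow> real list \<Rightarrow> bool" where
  "F_le mu la \<longleftrightarrow> weak_submaj (pos_sq mu) (pos_sq la) \<and>
     weak_submaj (neg_sq la) (neg_sq mu) \<and>
     sum_list (map (\<lambda>t. t\<^sup>2) mu) = sum_list (map (\<lambda>t. t\<^sup>2) la)"

end

(* Centre the variables and join the two weight vectors, arranged in decreasing order, by the path along
   which each squared weight moves linearly; majorization passes to prefix sums along the path, and the
   path stays in the admissible class. With c_i the current weights and d_i the increments of their squares, the
   gamma size-bias and integration-by-parts identities give, for a test function Phi,
     d/dt E Phi(Q_t - E Q_t) = a / (2 b^2) * sum_i d_i h_i,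
     h_i - h_k = (c_i - c_k) / b * E Phi'''(augmented variable for i, k),
   so by Abel summation the derivative is nonpositive once every E Phi''' is.
   Taking for Phi a spline approximation of the indicator of (-oo, x], minus E Phi''' is a second difference
   of the augmented density near x. That density is C^1, tends to 0, and is real analytic off one point
   (a convolution of gamma densities of one sign extends holomorphically to a half plane), so without
   inflection points to the right it must be convex there; the left tail follows by reflection. *)

theory Submission
  imports Defs "HOL-Complex_Analysis.Complex_Analysis" "HOL-Real_Asymp.Real_Asymp"
begin

section \<open>Gamma densities\<close>

text \<open>The augmented density need not be twice differentiable at the centring point: for two
  positive weights and n = 2 it starts there like a power with exponent \<open>2 a + 1\<close>. So
  no second derivative of a density is integrated. The test function is a quartic spline because its
  third derivative is a finite difference, which a translation moves onto the density; monotonicity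
  of the first derivative then suffices. That derivative comes from the two exponentials, each of
  which makes a density a difference of distribution functions, provided its weight is nonzero.
  Inside the path a weight is zero only if both its end values are; its increment then vanishes and
  the Abel summation can skip it. Speeds of weights may be infinite at the ends of the path, so
  derivatives are taken for 0 < t < 1 and continuity closes the interval. Identities between laws
  are checked on characteristic functions, where a zero weight contributes the factor 1; hence
  positive and negative parts can be padded into separate blocks without changing the law.\<close>

lemma gamma_density_nonneg: "0 < a \<Longrightarrow> 0 \<le> gamma_density a b x"
  by (simp add: gamma_density_def Gamma_real_pos less_imp_le)

lemma measurable_gamma_density [measurable]: "gamma_density a b \<in> borel_measurable borel"
  unfolding gamma_density_def[abs_def] by measurable

lemma sets_gamma_M [simp, measurable_cong]: "sets (gamma_M a b) = sets borel"
  and space_gamma_M [simp]: "space (gamma_M a b) = UNIV"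
  by (simp_all add: gamma_M_def)

lemma prob_space_gamma_M:
  assumes "0 < a" "0 < b"
  shows "prob_space (gamma_M a b)"
proof
  define g where "g = (\<lambda>t::real. ennreal (indicator {0..} t * t powr (a - 1) / exp t))"
  have [measurable]: "g \<in> borel_measurable borel" unfolding g_def by measurable
  have "ennreal (Gamma a) = ennreal b * (\<integral>\<^sup>+x. g (b * x) \<partial>lborel)"
    using Gamma_conv_nn_integral_real[OF assms(1)]
      nn_integral_real_affine[of g b 0] assms by (simp add: g_def)
  moreover have "gamma_density a b x = b / Gamma a * (indicator {0..} (b * x) * (b * x) powr (a - 1) / exp (b * x))" for x
    using assms by (auto simp: gamma_density_def indicator_def zero_le_mult_iff powr_mult
        powr_diff exp_minus field_simps)
  hence "ennreal (gamma_density a b x) = ennreal (b / Gamma a) * g (b * x)" for x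
    unfolding g_def using assms Gamma_real_pos[of a] by (subst ennreal_mult[symmetric]) (auto simp: )
  ultimately have "emeasure (gamma_M a b) UNIV = ennreal (b / Gamma a) * (\<integral>\<^sup>+x. g (b * x) \<partial>lborel)"
    and *: "ennreal (Gamma a) = ennreal b * (\<integral>\<^sup>+x. g (b * x) \<partial>lborel)"
    by (auto simp: gamma_M_def emeasure_density nn_integral_cmult)
  moreover have "ennreal (b / Gamma a) = ennreal (1 / Gamma a) * ennreal b"
    using assms Gamma_real_pos[of a] by (subst ennreal_mult[symmetric]) auto
  ultimately have "emeasure (gamma_M a b) UNIV = ennreal (1 / Gamma a) * ennreal (Gamma a)"
    by (simp add: mult.assoc)
  also have "\<dots> = 1"
    using assms Gamma_real_pos[of a] by (subst ennreal_mult[symmetric]) (auto simp: less_imp_neq[THEN not_sym])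
  finally show "emeasure (gamma_M a b) (space (gamma_M a b)) = 1" by simp
qed

lemma integral_gamma_M:
  fixes h :: "real \<Rightarrow> 'a::{banach, second_countable_topology}"
  assumes "0 < a" and [measurable]: "h \<in> borel_measurable borel"
  shows "(\<integral>x. h x \<partial>gamma_M a b) = (\<integral>x. gamma_density a b x *\<^sub>R h x \<partial>lborel)"
  unfolding gamma_M_def by (subst integral_density) (auto simp: gamma_density_nonneg assms)

lemma integrable_gamma_M:
  fixes h :: "real \<Rightarrow> 'a::{banach, second_countable_topology}"
  assumes "0 < a" and [measurable]: "h \<in> borel_measurable borel"
  shows "integrable (gamma_M a b) h \<longleftrightarrow> integrable lborel (\<lambda>x. gamma_density a b x *\<^sub>R h x)"
  unfolding gamma_M_def by (subst integrable_density) (auto simp: gamma_density_nonneg assms)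

lemma AE_gamma_M_pos: "0 < a \<Longrightarrow> AE x in gamma_M a b. 0 < x"
  unfolding gamma_M_def
proof (subst AE_density)
  show "AE x in lborel. 0 < ennreal (gamma_density a b x) \<longrightarrow> 0 < x"
    using AE_lborel_singleton[of 0]
    by (rule eventually_mono) (auto simp: gamma_density_def split: if_splits)
qed simp

lemma Gamma_real_plus1: "0 < a \<Longrightarrow> Gamma (a + 1) = a * Gamma a" for a :: real
  by (rule Gamma_plus1) (auto elim!: nonpos_Ints_cases)

text \<open>Differentiating in a weight produces a factor \<open>x\<close>; it is absorbed by
  raising the shape by one, because \<open>Gamma (a + 1) = a * Gamma a\<close>.\<close>

lemma gamma_density_size_bias:
  assumes "0 < a" "0 < b"
  shows "x * gamma_density a b x = a / b * gamma_density (a + 1) b x"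
proof (cases "x > 0")
  case True
  have "b powr (a + 1) = b * b powr a" "x powr a = x * x powr (a - 1)"
    using assms True by (simp_all add: powr_add powr_diff)
  moreover have "Gamma (a + 1) = a * Gamma a" using assms by (rule_tac Gamma_real_plus1)
  ultimately show ?thesis using assms True Gamma_real_pos[of a]
    by (simp add: gamma_density_def field_simps)
next
  case False
  thus ?thesis by (cases "x = 0") (simp_all add: gamma_density_def)
qed

lemma integral_gamma_M_size_bias:
  fixes h :: "real \<Rightarrow> 'a::{banach, second_countable_topology}"
  assumes "0 < a" "0 < b" and [measurable]: "h \<in> borel_measurable borel"
  shows "(\<integral>x. x *\<^sub>R h x \<partial>gamma_M a b) = (a / b) *\<^sub>R (\<integral>x. h x \<partial>gamma_M (a + 1) b)"
    and "integrable (gamma_M (a + 1) b) h \<Longrightarrow> integrable (gamma_M a b) (\<lambda>x. x *\<^sub>R h x)"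
proof -
  have *: "gamma_density a b x *\<^sub>R x *\<^sub>R h x = (a / b) *\<^sub>R gamma_density (a + 1) b x *\<^sub>R h x" for x
    using gamma_density_size_bias[OF assms(1,2), of x] by (simp add: mult.commute)
  show "(\<integral>x. x *\<^sub>R h x \<partial>gamma_M a b) = (a / b) *\<^sub>R (\<integral>x. h x \<partial>gamma_M (a + 1) b)"
    using assms by (simp add: integral_gamma_M * del: scaleR_scaleR)
  show "integrable (gamma_M (a + 1) b) h \<Longrightarrow> integrable (gamma_M a b) (\<lambda>x. x *\<^sub>R h x)"
    using assms by (simp add: integrable_gamma_M * del: scaleR_scaleR)
qed

lemma integrable_gamma_M_bounded:
  fixes h :: "real \<Rightarrow> 'a::{banach, second_countable_topology}"
  assumes "0 < a" "0 < b" "h \<in> borel_measurable borel" "\<And>x. norm (h x) \<le> B"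
  shows "integrable (gamma_M a b) h"
proof -
  interpret prob_space "gamma_M a b" by (rule prob_space_gamma_M) fact+
  show ?thesis
    by (rule integrable_const_bound[of _ B]) (use assms in auto)
qed

lemma gamma_density_DERIV:
  assumes "0 < a" "0 < b" "0 < x"
  shows "(gamma_density (a + 1) b has_real_derivative
           b * (gamma_density a b x - gamma_density (a + 1) b x)) (at x)"
proof -
  have "((\<lambda>x. C * x powr a * exp (- b * x)) has_real_derivative
     C * (a * x powr (a - 1) * exp (- b * x) - b * x powr a * exp (- b * x))) (at x)" for C
    using assms by (auto intro!: derivative_eq_intros simp: algebra_simps)
  from this[of "b powr (a + 1) / Gamma (a + 1)"]
  have "((\<lambda>x. b powr (a + 1) / Gamma (a + 1) * x powr a * exp (- b * x)) has_real_derivative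
     b powr (a + 1) / Gamma (a + 1) * (a * x powr (a - 1) * exp (- b * x) - b * x powr a * exp (- b * x))) (at x)" .
  moreover have "b powr (a + 1) / Gamma (a + 1) * (a * x powr (a - 1) * exp (- b * x) - b * x powr a * exp (- b * x))
     = b * (gamma_density a b x - gamma_density (a + 1) b x)"
  proof -
    have "Gamma (a + 1) = a * Gamma a" using assms by (rule_tac Gamma_real_plus1)
    moreover have "b powr (a + 1) = b powr a * b" using assms by (simp add: powr_add)
    moreover have "Gamma a \<noteq> 0" using Gamma_real_pos[of a] assms(1) by (metis less_irrefl)
    ultimately show ?thesis
      using assms by (simp add: gamma_density_def divide_simps) (simp add: algebra_simps)
  qed
  moreover have ev: "eventually (\<lambda>y::real. b powr (a + 1) / Gamma (a + 1) * y powr a * exp (- b * y) = gamma_density (a + 1) b y) (nhds x)"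
    by (rule eventually_mono[OF eventually_nhds_in_open[of "{0<..}" x]])
      (use assms in \<open>simp_all add: gamma_density_def\<close>)
  ultimately show ?thesis
    using DERIV_cong_ev[OF refl ev refl] by simp
qed

text \<open>The raised shape has exponent \<open>a > 0\<close> at the origin, so the boundary term
  of the integration by parts vanishes there even when the density of shape \<open>a\<close> blows
  up.\<close>

lemma gamma_density_LIM_0:
  assumes "0 < a" "0 < b"
  shows "((gamma_density (a + 1) b) \<longlongrightarrow> 0) (at_right 0)"
proof -
  have "((\<lambda>x. b powr (a + 1) / Gamma (a + 1) * x powr a * exp (- b * x)) \<longlongrightarrow> 0) (at_right 0)"
    using assms by real_asymp
  thus ?thesis
    by (rule Lim_transform_eventually)
      (rule eventually_mono[OF eventually_at_right_less], simp add: gamma_density_def)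
qed

lemma gamma_density_LIM_top:
  assumes "0 < a" "0 < b"
  shows "((gamma_density (a + 1) b) \<longlongrightarrow> 0) at_top"
proof -
  have "((\<lambda>x. b powr (a + 1) / Gamma (a + 1) * x powr a * exp (- b * x)) \<longlongrightarrow> 0) at_top"
    using assms by real_asymp
  thus ?thesis
    by (rule Lim_transform_eventually)
      (rule eventually_mono[OF eventually_ge_at_top[of 0]], simp add: gamma_density_def)
qed

text \<open>Integration by parts, using \<open>g\<^sub>a\<^sub>+\<^sub>1' = b (g\<^sub>a - g\<^sub>a\<^sub>+\<^sub>1)\<close> for the gamma densities.\<close>

lemma gamma_M_shape_diff:
  fixes H H' :: "real \<Rightarrow> 'a::euclidean_space"
  assumes "0 < a" "0 < b"
    and H: "\<And>y. (H has_vector_derivative H' y) (at y)"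
    and cont: "continuous_on UNIV H'"
    and B: "\<And>y. norm (H y) \<le> B" and B': "\<And>y. norm (H' y) \<le> B'"
  shows "(\<integral>x. H (c * x) \<partial>gamma_M (a + 1) b) - (\<integral>x. H (c * x) \<partial>gamma_M a b)
    = (c / b) *\<^sub>R (\<integral>x. H' (c * x) \<partial>gamma_M (a + 1) b)"
proof -
  let ?g = "gamma_density (a + 1) b" and ?k = "gamma_density a b"
  have contH: "continuous_on UNIV H"
    using H by (meson continuous_at_imp_continuous_on has_vector_derivative_continuous)
  have [measurable]: "H \<in> borel_measurable borel" "H' \<in> borel_measurable borel"
    using contH cont by (auto intro: borel_measurable_continuous_onI)
  define f where "f x = c *\<^sub>R ?g x *\<^sub>R H' (c * x) + (b * (?k x - ?g x)) *\<^sub>R H (c * x)" for x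
  have i1: "integrable lborel (\<lambda>x. ?g x *\<^sub>R H' (c * x))" "integrable lborel (\<lambda>x. ?g x *\<^sub>R H (c * x))"
     "integrable lborel (\<lambda>x. ?k x *\<^sub>R H (c * x))"
    using assms by (auto simp flip: integrable_gamma_M intro!: integrable_gamma_M_bounded)
  have f_eq: "f x = c *\<^sub>R ?g x *\<^sub>R H' (c * x) + b *\<^sub>R (?k x *\<^sub>R H (c * x) - ?g x *\<^sub>R H (c * x))" for x
    by (simp add: f_def algebra_simps)
  have int_f: "integrable lborel f"
    unfolding f_eq[abs_def] using i1 by (intro Bochner_Integration.integrable_add integrable_scaleR_right Bochner_Integration.integrable_diff)
  \<comment> \<open>The improper form of the fundamental theorem on the open half line is used
    because \<open>?k\<close> is unbounded at 0 when \<open>a < 1\<close>. Both boundary values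
    vanish since \<open>H\<close> is bounded.\<close>
  have "(LBINT x=0..\<infinity>. f x) = 0 - 0"
  proof (rule interval_integral_FTC_integrable[where F = "\<lambda>x. ?g x *\<^sub>R H (c * x)"])
    fix x assume "0 < ereal x" hence x: "x > 0" by simp
    show "((\<lambda>x. ?g x *\<^sub>R H (c * x)) has_vector_derivative f x) (at x)"
    proof -
      have "((\<lambda>x. H (c * x)) has_vector_derivative c *\<^sub>R H' (c * x)) (at x)"
        using vector_diff_chain_at[of "\<lambda>x. c * x" c x H "H' (c * x)"] H
        by (auto simp: o_def intro!: derivative_eq_intros simp flip: has_real_derivative_iff_has_vector_derivative)
      from has_vector_derivative_scaleR[OF gamma_density_DERIV[OF assms(1,2) x] this]
      show ?thesis unfolding f_def by (simp add: algebra_simps)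
    qed
    have "isCont (\<lambda>x. b powr (a + 1) / Gamma (a + 1) * x powr a * exp (- b * x)) x"
         "isCont (\<lambda>x. b powr a / Gamma a * x powr (a - 1) * exp (- b * x)) x"
      using x Gamma_real_pos[of a] Gamma_real_pos[of "a + 1"] assms
      by (auto intro!: continuous_intros simp: less_imp_neq[THEN not_sym])
    moreover have "eventually (\<lambda>y. b powr (a + 1) / Gamma (a + 1) * y powr a * exp (- b * y) = ?g y) (nhds x)"
     "eventually (\<lambda>y. b powr a / Gamma a * y powr (a - 1) * exp (- b * y) = ?k y) (nhds x)"
      by (rule eventually_mono[OF eventually_nhds_in_open[of "{0<..}" x]];
          use x in \<open>simp add: gamma_density_def\<close>)+
    ultimately have g: "isCont ?g x" "isCont ?k x" by (auto simp: isCont_cong)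
    have Hc: "isCont (\<lambda>x. H (c * x)) x" "isCont (\<lambda>x. H' (c * x)) x"
      by (rule isCont_o2[where f="\<lambda>x. c * x"];
          use contH cont in \<open>simp add: continuous_on_eq_continuous_at\<close>)+
    show "isCont f x" unfolding f_def[abs_def] 
      by (intro continuous_add continuous_scaleR continuous_mult continuous_diff continuous_const g Hc)
  next
    show "set_integrable lborel (einterval 0 \<infinity>) f"
      unfolding set_integrable_def using int_f by (intro integrable_mult_indicator) auto
    show "(((\<lambda>x. ?g x *\<^sub>R H (c * x)) \<circ> real_of_ereal) \<longlongrightarrow> 0) (at_right 0)"
      unfolding zero_ereal_def ereal_tendsto_simps
      by (rule Lim_null_comparison[where g="\<lambda>x. \<bar>?g x\<bar> * B"])
        (use B tendsto_mult_right[OF tendsto_rabs[OF gamma_density_LIM_0[OF assms(1,2)]], of B]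
         in \<open>auto intro!: always_eventually mult_left_mono\<close>)
    show "(((\<lambda>x. ?g x *\<^sub>R H (c * x)) \<circ> real_of_ereal) \<longlongrightarrow> 0) (at_left \<infinity>)"
      unfolding ereal_tendsto_simps
      by (rule Lim_null_comparison[where g="\<lambda>x. \<bar>?g x\<bar> * B"])
        (use B tendsto_mult_right[OF tendsto_rabs[OF gamma_density_LIM_top[OF assms(1,2)]], of B]
         in \<open>auto intro!: always_eventually mult_left_mono\<close>)
  qed simp
  moreover have "(LBINT x=0..\<infinity>. f x) = (\<integral>x. f x \<partial>lborel)"
  proof -
    have *: "indicator (einterval 0 \<infinity>) x *\<^sub>R f x = f x" if "x \<noteq> 0" for x
      using that by (cases "x > 0") (simp_all add: einterval_def f_def gamma_density_def)
    have [measurable]: "f \<in> borel_measurable lborel" using int_f by simp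
    have "(\<integral>x. indicator (einterval 0 \<infinity>) x *\<^sub>R f x \<partial>lborel) = (\<integral>x. f x \<partial>lborel)"
    proof (rule integral_cong_AE)
      show "(\<lambda>x. indicator (einterval 0 \<infinity>) x *\<^sub>R f x) \<in> borel_measurable lborel"
        by (intro borel_measurable_scaleR borel_measurable_indicator) auto
      show "AE x in lborel. indicator (einterval 0 \<infinity>) x *\<^sub>R f x = f x"
        using AE_lborel_singleton[of 0] * by (rule eventually_mono)
    qed simp
    thus ?thesis by (simp add: interval_lebesgue_integral_def set_lebesgue_integral_def)
  qed
  moreover have "(\<integral>x. f x \<partial>lborel) = c *\<^sub>R (\<integral>x. H' (c * x) \<partial>gamma_M (a + 1) b) +
     b *\<^sub>R ((\<integral>x. H (c * x) \<partial>gamma_M a b) - (\<integral>x. H (c * x) \<partial>gamma_M (a + 1) b))"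
    unfolding f_eq using i1 assms
    by (simp add: integral_gamma_M Bochner_Integration.integral_add Bochner_Integration.integral_diff
        del: scaleR_scaleR)
  ultimately have "c *\<^sub>R (\<integral>x. H' (c * x) \<partial>gamma_M (a + 1) b) =
     - (b *\<^sub>R ((\<integral>x. H (c * x) \<partial>gamma_M a b) - (\<integral>x. H (c * x) \<partial>gamma_M (a + 1) b)))"
    by (subst eq_neg_iff_add_eq_0) simp
  hence "(1/b) *\<^sub>R (c *\<^sub>R (\<integral>x. H' (c * x) \<partial>gamma_M (a + 1) b)) =
     (1/b) *\<^sub>R (b *\<^sub>R ((\<integral>x. H (c * x) \<partial>gamma_M (a + 1) b) - (\<integral>x. H (c * x) \<partial>gamma_M a b)))"
    by (simp add: scaleR_diff_right)
  thus ?thesis using assms by simp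
qed

section \<open>Weighted sums of independent gamma variables\<close>

text \<open>The shape depends on the coordinate because size bias at one coordinate raises that
  shape alone.\<close>

definition gamma_prod :: "real \<Rightarrow> nat \<Rightarrow> (nat \<Rightarrow> real) \<Rightarrow> (nat \<Rightarrow> real) measure" where
  "gamma_prod b n sh = PiM {..<n} (\<lambda>i. gamma_M (sh i) b)"

definition gsum_law :: "real \<Rightarrow> nat \<Rightarrow> (nat \<Rightarrow> real) \<Rightarrow> (nat \<Rightarrow> real) \<Rightarrow> real measure" where
  "gsum_law b n sh c = distr (gamma_prod b n sh) borel (\<lambda>x. \<Sum>i<n. c i * x i)"

lemma finite_product_prob_space_gamma:
  assumes "0 < b" "\<And>i. 0 < sh i" "finite I"
  shows "finite_product_prob_space (\<lambda>i. gamma_M (sh i) b) I"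
proof -
  interpret prob_space "gamma_M (sh i) b" for i by (rule prob_space_gamma_M) (use assms in auto)
  show ?thesis
    by standard (use assms in \<open>auto intro: prob_space_gamma_M\<close>)
qed

lemma prob_space_gamma_prod:
  assumes "0 < b" "\<And>i. 0 < sh i"
  shows "prob_space (gamma_prod b n sh)"
  unfolding gamma_prod_def by (intro prob_space_PiM prob_space_gamma_M assms)

lemma measurable_gamma_prod_component:
  "i < n \<Longrightarrow> (\<lambda>x. x i) \<in> borel_measurable (gamma_prod b n sh)"
  unfolding gamma_prod_def
  by (subst measurable_cong_sets[OF refl sets_gamma_M[symmetric, of "sh i" b]])
    (rule measurable_component_singleton, simp)

lemma measurable_gamma_prod_sum [measurable]:
  "(\<lambda>x. \<Sum>i<n. c i * x i) \<in> borel_measurable (gamma_prod b n sh)"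
  by (intro borel_measurable_sum borel_measurable_times) (auto intro: measurable_gamma_prod_component)

lemma real_distribution_gsum_law:
  assumes "0 < b" "\<And>i. 0 < sh i"
  shows "real_distribution (gsum_law b n sh c)"
proof -
  interpret prob_space "gamma_prod b n sh" by (rule prob_space_gamma_prod) fact+
  show ?thesis unfolding gsum_law_def by (rule real_distribution_distr) simp
qed

lemma real_distribution_gamma_M: "0 < a \<Longrightarrow> 0 < b \<Longrightarrow> real_distribution (gamma_M a b)"
  by (simp add: real_distribution_def real_distribution_axioms_def prob_space_gamma_M)

lemma char_zero_gamma_M: "0 < a \<Longrightarrow> 0 < b \<Longrightarrow> char (gamma_M a b) 0 = 1"
  by (rule real_distribution.char_zero[OF real_distribution_gamma_M])

lemma char_gsum_law:
  assumes "0 < b" "\<And>i. 0 < sh i"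
  shows "char (gsum_law b n sh c) s = (\<Prod>i<n. char (gamma_M (sh i) b) (c i * s))"
proof -
  interpret finite_product_prob_space "\<lambda>i. gamma_M (sh i) b" "{..<n}"
    by (rule finite_product_prob_space_gamma) (use assms in auto)
  have "char (gsum_law b n sh c) s = (\<integral>x. iexp (s * (\<Sum>i<n. c i * x i)) \<partial>gamma_prod b n sh)"
    unfolding char_def gsum_law_def by (subst integral_distr) auto
  also have "\<dots> = (\<integral>x. (\<Prod>i<n. iexp ((c i * s) * x i)) \<partial>gamma_prod b n sh)"
    by (simp add: exp_sum sum_distrib_left mult_ac of_real_sum of_real_mult flip: exp_sum)
  also have "\<dots> = (\<Prod>i<n. \<integral>x. iexp ((c i * s) * x) \<partial>gamma_M (sh i) b)"
    unfolding gamma_prod_def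
    by (rule product_integral_prod) (auto intro!: integrable_gamma_M_bounded[where B=1] assms)
  finally show ?thesis by (simp add: char_def)
qed

text \<open>Reduces identities between laws of sums to identities of products of characteristic
  functions, where a coordinate of weight 0 contributes 1 whatever its shape.\<close>

lemma gsum_law_eqI:
  assumes "0 < b" "\<And>i. 0 < sh i" "real_distribution N"
    "\<And>s. (\<Prod>i<n. char (gamma_M (sh i) b) (c i * s)) = char N s"
  shows "gsum_law b n sh c = N"
  by (rule Levy_uniqueness)
    (use assms in \<open>auto intro!: real_distribution_gsum_law simp: char_gsum_law\<close>)

lemma real_distribution_convolution:
  assumes "real_distribution M" "real_distribution N"
  shows "real_distribution (M \<star> N)"
proof -
  interpret M: real_distribution M by fact
  interpret N: real_distribution N by fact
  interpret pair_prob_space M N ..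
  show ?thesis unfolding convolution_def
    by (rule real_distribution_distr) simp
qed

lemma integral_convolution:
  fixes f :: "real \<Rightarrow> 'a::{banach, second_countable_topology}"
  assumes "real_distribution M" "real_distribution N"
    and [measurable]: "f \<in> borel_measurable borel" and B: "\<And>x. norm (f x) \<le> B"
  shows "(\<integral>z. f z \<partial>(M \<star> N)) = (\<integral>x. \<integral>y. f (x + y) \<partial>N \<partial>M)"
proof -
  interpret M: real_distribution M by fact
  interpret N: real_distribution N by fact
  interpret pair_prob_space M N ..
  have "(\<integral>z. f z \<partial>(M \<star> N)) = (\<integral>z. f (fst z + snd z) \<partial>(M \<Otimes>\<^sub>M N))"
    unfolding convolution_def by (subst integral_distr) (auto simp: case_prod_beta)
  also have "\<dots> = (\<integral>x. \<integral>y. f (x + y) \<partial>N \<partial>M)"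
    using B by (subst integral_fst'[symmetric]) (auto intro!: integrable_const_bound[where B=B])
  finally show ?thesis .
qed

lemma char_convolution:
  assumes "real_distribution M" "real_distribution N"
  shows "char (M \<star> N) s = char M s * char N s"
  unfolding char_def
  by (subst integral_convolution[OF assms, where B=1]) (simp_all add: exp_add distrib_left)

lemma char_distr_affine:
  assumes "real_distribution M"
  shows "char (distr M borel (\<lambda>x. c * x + d)) s = iexp (s * d) * char M (c * s)"
proof -
  interpret real_distribution M by fact
  have "char (distr M borel (\<lambda>x. c * x + d)) s = (\<integral>x. iexp (s * d) * iexp (c * s * x) \<partial>M)"
    unfolding char_def by (subst integral_distr) (auto simp: exp_add[symmetric] algebra_simps)
  also have "\<dots> = iexp (s * d) * char M (c * s)" by (simp add: char_def)
  finally show ?thesis .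
qed

lemma gamma_prod_integral_split:
  fixes g :: "(nat \<Rightarrow> real) \<Rightarrow> 'a::{banach, second_countable_topology}"
  assumes "0 < b" "\<And>i. 0 < sh i" "i < n" "integrable (gamma_prod b n sh) g"
  shows "(\<integral>x. g x \<partial>gamma_prod b n sh) =
    (\<integral>x. (\<integral>y. g (x(i := y)) \<partial>gamma_M (sh i) b) \<partial>PiM ({..<n} - {i}) (\<lambda>i. gamma_M (sh i) b))"
proof -
  interpret finite_product_prob_space "\<lambda>i. gamma_M (sh i) b" "{..<n}"
    by (rule finite_product_prob_space_gamma) (use assms in auto)
  have *: "insert i ({..<n} - {i}) = {..<n}" using assms by auto
  show ?thesis
    using product_integral_insert[of "{..<n} - {i}" i g] assms(4)
    unfolding gamma_prod_def * by simp
qed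

lemma gamma_prod_integrable_bounded:
  fixes g :: "(nat \<Rightarrow> real) \<Rightarrow> 'a::{banach, second_countable_topology}"
  assumes "0 < b" "\<And>i. 0 < sh i" "g \<in> borel_measurable (gamma_prod b n sh)" "\<And>x. norm (g x) \<le> B"
  shows "integrable (gamma_prod b n sh) g"
proof -
  interpret prob_space "gamma_prod b n sh" by (rule prob_space_gamma_prod) fact+
  show ?thesis by (rule integrable_const_bound[of _ B]) (use assms in auto)
qed

lemma integrable_gamma_M_ident: "0 < a \<Longrightarrow> 0 < b \<Longrightarrow> integrable (gamma_M a b) (\<lambda>x. x)"
  and integral_gamma_M_ident: "0 < a \<Longrightarrow> 0 < b \<Longrightarrow> (\<integral>x. x \<partial>gamma_M a b) = a / b"
proof -
  assume ab: "0 < a" "0 < b"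
  interpret prob_space "gamma_M (a + 1) b" by (rule prob_space_gamma_M) (use ab in auto)
  show "integrable (gamma_M a b) (\<lambda>x. x)"
    using integral_gamma_M_size_bias(2)[OF ab, of "\<lambda>_. 1::real"] by simp
  show "(\<integral>x. x \<partial>gamma_M a b) = a / b"
    using integral_gamma_M_size_bias(1)[OF ab, of "\<lambda>_. 1::real"] prob_space by simp
qed

lemma integrable_gamma_M_square: "0 < a \<Longrightarrow> 0 < b \<Longrightarrow> integrable (gamma_M a b) (\<lambda>x. x\<^sup>2)"
  and integral_gamma_M_square: "0 < a \<Longrightarrow> 0 < b \<Longrightarrow> (\<integral>x. x\<^sup>2 \<partial>gamma_M a b) = a * (a + 1) / b\<^sup>2"
proof -
  assume ab: "0 < a" "0 < b"
  show "integrable (gamma_M a b) (\<lambda>x. x\<^sup>2)"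
  proof -
    have "integrable (gamma_M a b) (\<lambda>x. x *\<^sub>R x)"
      using ab by (intro integral_gamma_M_size_bias(2) integrable_gamma_M_ident) auto
    thus ?thesis by (simp add: power2_eq_square)
  qed
  have "(\<integral>x. x\<^sup>2 \<partial>gamma_M a b) = (\<integral>x. x *\<^sub>R x \<partial>gamma_M a b)"
    by (simp add: power2_eq_square)
  also have "\<dots> = (a / b) *\<^sub>R ((a + 1) / b)"
    using ab by (subst integral_gamma_M_size_bias(1)) (simp_all add: integral_gamma_M_ident)
  finally show "(\<integral>x. x\<^sup>2 \<partial>gamma_M a b) = a * (a + 1) / b\<^sup>2"
    by (simp add: power2_eq_square)
qed

lemma gamma_prod_integrable_component:
  assumes "0 < b" "\<And>i. 0 < sh i" "i < n"
  shows "integrable (gamma_prod b n sh) (\<lambda>x. x i)"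
proof -
  have d: "distr (gamma_prod b n sh) (gamma_M (sh i) b) (\<lambda>x. x i) = gamma_M (sh i) b"
    unfolding gamma_prod_def
    by (rule distr_PiM_component) (use assms in \<open>auto intro!: prob_space_gamma_M\<close>)
  have "(\<lambda>x. x i) \<in> measurable (gamma_prod b n sh) (gamma_M (sh i) b)"
    using measurable_gamma_prod_component[OF assms(3)]
    by (simp add: measurable_cong_sets[OF refl sets_gamma_M])
  from integrable_distr[OF this, of "\<lambda>x. x"] show ?thesis
    using integrable_gamma_M_ident[of "sh i" b] assms unfolding d by simp
qed

lemma sum_fun_upd_split:
  fixes c x :: "nat \<Rightarrow> real"
  assumes "i < n"
  shows "(\<Sum>j<n. c j * (x(i := y)) j) = c i * y + (\<Sum>j\<in>{..<n} - {i}. c j * x j)"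
  using assms by (subst sum.remove[of _ i]) (auto intro!: sum.cong)

lemma gamma_prod_size_bias:
  fixes H :: "real \<Rightarrow> real"
  assumes "0 < b" "\<And>i. 0 < sh i" "i < n"
    and [measurable]: "H \<in> borel_measurable borel" and "\<And>y. norm (H y) \<le> B"
  shows "(\<integral>x. x i * H (\<Sum>j<n. c j * x j) \<partial>gamma_prod b n sh) =
    sh i / b * (\<integral>x. H (\<Sum>j<n. c j * x j) \<partial>gamma_prod b n (sh(i := sh i + 1)))"
    and "integrable (gamma_prod b n sh) (\<lambda>x. x i * H (\<Sum>j<n. c j * x j))"
proof -
  let ?sh = "sh(i := sh i + 1)"
  have sh': "\<And>i. 0 < ?sh i" using assms by (auto simp: add_pos_pos)
  note [measurable] = measurable_gamma_prod_component[OF assms(3)]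
  show int: "integrable (gamma_prod b n sh) (\<lambda>x. x i * H (\<Sum>j<n. c j * x j))"
  proof (rule Bochner_Integration.integrable_bound)
    show "integrable (gamma_prod b n sh) (\<lambda>x. B * x i)"
      by (intro integrable_mult_right gamma_prod_integrable_component assms)
    have "norm (x i * H y) \<le> norm (B * x i)" for x :: "nat \<Rightarrow> real" and y
    proof -
      have "norm (x i * H y) \<le> \<bar>x i\<bar> * B"
        using assms(5)[of y] by (simp add: abs_mult mult_left_mono)
      also have "\<dots> \<le> norm (B * x i)" by (simp add: abs_mult mult.commute mult_right_mono)
      finally show ?thesis .
    qed
    thus "AE x in gamma_prod b n sh. norm (x i * H (\<Sum>j<n. c j * x j)) \<le> norm (B * x i)" by simp
  qed auto
  have eq: "PiM ({..<n} - {i}) (\<lambda>i. gamma_M (?sh i) b) = PiM ({..<n} - {i}) (\<lambda>i. gamma_M (sh i) b)"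
    by (rule PiM_cong) auto
  have "(\<integral>x. x i * H (\<Sum>j<n. c j * x j) \<partial>gamma_prod b n sh) =
    (\<integral>x. (\<integral>y. y * H (c i * y + (\<Sum>j\<in>{..<n} - {i}. c j * x j)) \<partial>gamma_M (sh i) b) \<partial>PiM ({..<n} - {i}) (\<lambda>i. gamma_M (sh i) b))"
    by (subst gamma_prod_integral_split[OF assms(1-3) int]) (simp add: sum_fun_upd_split[OF assms(3)] del: fun_upd_apply add: fun_upd_same)
  also have "\<dots> = (\<integral>x. sh i / b * (\<integral>y. H (c i * y + (\<Sum>j\<in>{..<n} - {i}. c j * x j)) \<partial>gamma_M (sh i + 1) b) \<partial>PiM ({..<n} - {i}) (\<lambda>i. gamma_M (sh i) b))"
    using integral_gamma_M_size_bias(1)[OF assms(2)[of i] assms(1), of "\<lambda>y. H (c i * y + r)" for r] by simp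
  also have "\<dots> = sh i / b * (\<integral>x. H (\<Sum>j<n. c j * x j) \<partial>gamma_prod b n ?sh)"
    by (subst gamma_prod_integral_split[OF assms(1) sh' assms(3)])
      (auto intro!: gamma_prod_integrable_bounded[where B=B] assms sh'
        simp: sum_fun_upd_split[OF assms(3)] eq simp del: fun_upd_apply simp: fun_upd_same)
  finally show "(\<integral>x. x i * H (\<Sum>j<n. c j * x j) \<partial>gamma_prod b n sh) =
    sh i / b * (\<integral>x. H (\<Sum>j<n. c j * x j) \<partial>gamma_prod b n ?sh)" .
qed

definition scaled_gamma :: "real \<Rightarrow> real \<Rightarrow> real \<Rightarrow> real measure" where
  "scaled_gamma a b q = distr (gamma_M a b) borel (\<lambda>x. q * x)"

lemma real_distribution_scaled_gamma: "0 < a \<Longrightarrow> 0 < b \<Longrightarrow> real_distribution (scaled_gamma a b q)"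
  unfolding scaled_gamma_def
  by (rule prob_space.real_distribution_distr[OF prob_space_gamma_M])
    (simp_all add: measurable_cong_sets[OF sets_gamma_M refl])

lemma char_scaled_gamma: "0 < a \<Longrightarrow> 0 < b \<Longrightarrow> char (scaled_gamma a b q) s = char (gamma_M a b) (q * s)"
  unfolding scaled_gamma_def
  using char_distr_affine[OF real_distribution_gamma_M, of a b q 0 s] by simp

text \<open>The weight of coordinate \<open>i\<close> is set to 0 instead of removing the
  coordinate, so the index set stays \<open>{..<n}\<close> and the remainder is again a
  \<open>gsum_law\<close>.\<close>

lemma gsum_law_split:
  assumes "0 < b" "\<And>i. 0 < sh i" "i < n"
  shows "gsum_law b n sh c = (gsum_law b n sh (c(i := 0)) \<star> scaled_gamma (sh i) b (c i))"
proof (rule gsum_law_eqI[OF assms(1,2)])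
  let ?R = "gsum_law b n sh (c(i := 0))" and ?X = "scaled_gamma (sh i) b (c i)"
  show "real_distribution (?R \<star> ?X)"
    by (intro real_distribution_convolution real_distribution_gsum_law real_distribution_scaled_gamma assms)
  fix s
  have "char (gamma_M (sh k) b) (c k * s) = char (gamma_M (sh k) b) ((c(i := 0)) k * s) *
      (if k = i then char ?X s else 1)" for k
    using assms by (simp add: char_scaled_gamma char_zero_gamma_M)
  thus "(\<Prod>k<n. char (gamma_M (sh k) b) (c k * s)) = char (?R \<star> ?X) s"
    using assms by (simp add: char_convolution char_gsum_law real_distribution_gsum_law
        real_distribution_scaled_gamma prod.distrib prod.delta)
qed

text \<open>Given the other summands, the one-variable identity applies to \<open>H\<close> shifted
  by their sum; integrating over the law \<open>?R\<close> of that sum finishes.\<close>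

lemma gamma_prod_shape_diff:
  fixes H H' :: "real \<Rightarrow> real"
  assumes "0 < b" "\<And>i. 0 < sh i" "i < n"
    and H: "\<And>y. (H has_real_derivative H' y) (at y)"
    and cont: "continuous_on UNIV H'"
    and B: "\<And>y. norm (H y) \<le> B" and B': "\<And>y. norm (H' y) \<le> B'"
  shows "(\<integral>x. H (\<Sum>j<n. c j * x j) \<partial>gamma_prod b n (sh(i := sh i + 1)))
     - (\<integral>x. H (\<Sum>j<n. c j * x j) \<partial>gamma_prod b n sh)
    = c i / b * (\<integral>x. H' (\<Sum>j<n. c j * x j) \<partial>gamma_prod b n (sh(i := sh i + 1)))"
proof -
  let ?sh = "sh(i := sh i + 1)" and ?R = "gsum_law b n sh (c(i := 0))"
  have sh': "\<And>i. 0 < ?sh i" using assms by (auto simp: add_pos_pos)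
  have [measurable]: "H \<in> borel_measurable borel" "H' \<in> borel_measurable borel"
    using H cont by (auto intro!: borel_measurable_continuous_onI continuous_at_imp_continuous_on DERIV_isCont)
  interpret R: real_distribution ?R by (rule real_distribution_gsum_law) fact+
  \<comment> \<open>With weight 0 the shape at \<open>i\<close> is invisible, so both products share
    one remainder law.\<close>
  have R: "gsum_law b n ?sh (c(i := 0)) = ?R"
    using sh' assms(1,2) by (intro gsum_law_eqI R.real_distribution_axioms)
      (auto simp: char_gsum_law char_zero_gamma_M add_pos_pos intro!: prod.cong)
  have split: "(\<integral>x. K (\<Sum>j<n. c j * x j) \<partial>gamma_prod b n s) = (\<integral>r. \<integral>y. K (r + c i * y) \<partial>gamma_M (s i) b \<partial>?R)"
    and int: "integrable ?R (\<lambda>r. \<integral>y. K (r + c i * y) \<partial>gamma_M (s i) b)"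
    if "s = sh \<or> s = ?sh" "K = H \<or> K = H'" for s K
  proof -
    have [measurable]: "K \<in> borel_measurable borel" using that by auto
    have KB: "norm (K y) \<le> max B B'" for y using that B[of y] B'[of y] by (auto simp: max_def)
    have s: "0 < s i" for i using that assms sh' by auto
    have Rs: "gsum_law b n s (c(i := 0)) = ?R" using that R by auto
    interpret G: prob_space "gamma_M (s i) b" by (rule prob_space_gamma_M[OF s assms(1)])
    have "(\<integral>x. K (\<Sum>j<n. c j * x j) \<partial>gamma_prod b n s) = (\<integral>z. K z \<partial>gsum_law b n s c)"
      unfolding gsum_law_def by (subst integral_distr) auto
    also have "\<dots> = (\<integral>r. \<integral>y. K (r + y) \<partial>scaled_gamma (s i) b (c i) \<partial>?R)"
      unfolding gsum_law_split[of b s i n c, OF assms(1) s assms(3)] Rs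
      by (rule integral_convolution[OF R.real_distribution_axioms real_distribution_scaled_gamma[OF s assms(1)] _ KB]) simp
    also have "\<dots> = (\<integral>r. \<integral>y. K (r + c i * y) \<partial>gamma_M (s i) b \<partial>?R)"
      unfolding scaled_gamma_def by (subst integral_distr) auto
    finally show "(\<integral>x. K (\<Sum>j<n. c j * x j) \<partial>gamma_prod b n s) = (\<integral>r. \<integral>y. K (r + c i * y) \<partial>gamma_M (s i) b \<partial>?R)" .
    have "norm (\<integral>y. K (r + c i * y) \<partial>gamma_M (s i) b) \<le> max B B'" for r
      by (rule order.trans[OF integral_norm_bound])
        (use KB in \<open>auto intro!: G.integral_le_const integrable_gamma_M_bounded[where B="max B B'"] s assms\<close>)
    thus "integrable ?R (\<lambda>r. \<integral>y. K (r + c i * y) \<partial>gamma_M (s i) b)"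
      by (intro R.integrable_const_bound[where B="max B B'"] AE_I2) (auto intro!: G.borel_measurable_lebesgue_integral)
  qed
  have 1: "(\<integral>y. H (r + c i * y) \<partial>gamma_M (?sh i) b) - (\<integral>y. H (r + c i * y) \<partial>gamma_M (sh i) b)
      = c i / b * (\<integral>y. H' (r + c i * y) \<partial>gamma_M (?sh i) b)" for r
  proof -
    have "((\<lambda>y. H (r + y)) has_vector_derivative H' (r + y)) (at y)" for y
      using DERIV_shift[THEN iffD1, OF H[of "y + r"]]
      by (simp add: add.commute flip: has_real_derivative_iff_has_vector_derivative)
    moreover have "continuous_on UNIV (\<lambda>y. H' (r + y))"
      by (intro continuous_on_compose2[OF cont] continuous_intros) auto
    ultimately show ?thesis
      using gamma_M_shape_diff[OF assms(2)[of i] assms(1), of "\<lambda>y. H (r + y)" "\<lambda>y. H' (r + y)" B B' "c i"] B B'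
      by simp
  qed
  have "(\<integral>x. H (\<Sum>j<n. c j * x j) \<partial>gamma_prod b n ?sh) - (\<integral>x. H (\<Sum>j<n. c j * x j) \<partial>gamma_prod b n sh)
    = (\<integral>r. (\<integral>y. H (r + c i * y) \<partial>gamma_M (?sh i) b) - (\<integral>y. H (r + c i * y) \<partial>gamma_M (sh i) b) \<partial>?R)"
    using split[of ?sh H] split[of sh H] int[of ?sh H] int[of sh H]
    by (simp only: simp_thms Bochner_Integration.integral_diff)
  also have "\<dots> = c i / b * (\<integral>x. H' (\<Sum>j<n. c j * x j) \<partial>gamma_prod b n ?sh)"
    unfolding 1 using split[of ?sh H'] by simp
  finally show ?thesis .
qed

section \<open>Laws, means and variances\<close>

lemma Q_dist_eq_gsum_law: "Q_dist a b l = gsum_law b (length l) (\<lambda>_. a) (nth l)"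
  unfolding Q_dist_def gsum_law_def gamma_prod_def by (rule distr_cong) simp_all

lemma real_distribution_Q_dist: "0 < a \<Longrightarrow> 0 < b \<Longrightarrow> real_distribution (Q_dist a b l)"
  unfolding Q_dist_eq_gsum_law by (rule real_distribution_gsum_law)

lemma Q_mean_eq:
  assumes "0 < a" "0 < b"
  shows "Q_mean a b l = a / b * (\<Sum>i<length l. l ! i)"
proof -
  have eq: "(\<integral>x. x i \<partial>gamma_prod b n (\<lambda>_. a)) = a / b" if "i < n" for i n
  proof -
    have *: "prob_space (gamma_prod b n ((\<lambda>_. a)(i := a + 1)))"
      by (rule prob_space_gamma_prod) (use assms in auto)
    show ?thesis
      using gamma_prod_size_bias(1)[of b "\<lambda>_. a" i n "\<lambda>_. 1" 1] assms that prob_space.prob_space[OF *]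
      by simp
  qed
  have "Q_mean a b l = (\<integral>x. (\<Sum>i<length l. l ! i * x i) \<partial>gamma_prod b (length l) (\<lambda>_. a))"
    unfolding Q_mean_def Q_dist_eq_gsum_law gsum_law_def by (subst integral_distr) auto
  also have "\<dots> = (\<Sum>i<length l. l ! i * (a / b))"
    by (subst Bochner_Integration.integral_sum)
      (auto intro!: integrable_mult_right gamma_prod_integrable_component assms simp: eq)
  finally show ?thesis by (simp add: sum_distrib_left mult.commute flip: sum_distrib_right)
qed

lemma Q_var_eq:
  assumes "0 < a" "0 < b"
  shows "Q_var a b l = a / b\<^sup>2 * (\<Sum>i<length l. (l ! i)\<^sup>2)"
proof -
  let ?n = "length l" and ?G = "gamma_M a b"
  interpret finite_product_prob_space "\<lambda>_. ?G" "{..<?n}"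
    by (rule finite_product_prob_space_gamma) (use assms in auto)
  have G1: "measure ?G UNIV = 1"
    using prob_space.prob_space[OF prob_space_gamma_M[OF assms]] by simp
  define m where "m = a / b"
  \<comment> \<open>Writes the product of two centred coordinates as one factor per coordinate, so
    that the product measure splits the expectation; for \<open>i = j\<close> both conditionals hit
    the same coordinate and give the square.\<close>
  define F where "F i j k x = (if k = i then x - m else 1) * (if k = j then x - m else 1)" for i j k :: nat and x
  have i1: "integrable ?G (\<lambda>x. x)" and i2: "integrable ?G (\<lambda>x. x\<^sup>2)"
    using integrable_gamma_M_ident integrable_gamma_M_square assms by auto
  have sq: "(x - m) * (x - m) = x\<^sup>2 - 2 * m * x + m * m" for x by (simp add: power2_eq_square algebra_simps)
  have i3: "integrable ?G (\<lambda>x. (x - m) * (x - m))" unfolding sq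
    using i1 i2 by auto
  have e1: "(\<integral>x. x - m \<partial>?G) = 0"
    using i1 integral_gamma_M_ident[OF assms] G1 by (simp add: m_def)
  have e2: "(\<integral>x. (x - m) * (x - m) \<partial>?G) = a / b\<^sup>2"
  proof -
    have "(\<integral>x. (x - m) * (x - m) \<partial>?G) = a * (a + 1) / b\<^sup>2 - 2 * m * (a / b) + m * m"
      unfolding sq using i1 i2 integral_gamma_M_ident[OF assms] integral_gamma_M_square[OF assms] G1
      by simp
    thus ?thesis using assms by (simp add: m_def field_simps power2_eq_square)
  qed
  have intF: "integrable ?G (F i j k)" for i j k
    unfolding F_def using i1 i3 by (cases "k = i"; cases "k = j") auto
  have prodF: "(\<Prod>k<?n. F i j k (x k)) = (x i - m) * (x j - m)" if "i < ?n" "j < ?n" for i j x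
    unfolding F_def prod.distrib using that by (simp add: prod.delta)
  have int: "integrable (gamma_prod b ?n (\<lambda>_. a)) (\<lambda>x. (x i - m) * (x j - m))"
    and exp: "(\<integral>x. (x i - m) * (x j - m) \<partial>gamma_prod b ?n (\<lambda>_. a)) = (if i = j then a / b\<^sup>2 else 0)"
    if "i < ?n" "j < ?n" for i j
  proof -
    show "integrable (gamma_prod b ?n (\<lambda>_. a)) (\<lambda>x. (x i - m) * (x j - m))"
      unfolding prodF[OF that, symmetric] gamma_prod_def
      by (rule product_integrable_prod) (use intF in auto)
    have "(\<integral>x. (x i - m) * (x j - m) \<partial>gamma_prod b ?n (\<lambda>_. a)) = (\<Prod>k<?n. \<integral>x. F i j k x \<partial>?G)"
      unfolding prodF[OF that, symmetric] gamma_prod_def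
      by (rule product_integral_prod) (use intF in auto)
    also have "\<dots> = (if i = j then a / b\<^sup>2 else 0)"
    proof (cases "i = j")
      case True
      have "(\<integral>x. F i j k x \<partial>?G) = (if k = i then a / b\<^sup>2 else 1)" for k
        using True e2 G1 by (simp add: F_def)
      thus ?thesis using True that by (simp add: prod.delta)
    next
      case False
      have "(\<integral>x. F i j i x \<partial>?G) = 0" using False e1 by (simp add: F_def)
      thus ?thesis using False that by (auto intro!: prod_zero)
    qed
    finally show "(\<integral>x. (x i - m) * (x j - m) \<partial>gamma_prod b ?n (\<lambda>_. a)) = (if i = j then a / b\<^sup>2 else 0)" .
  qed
  have "Q_var a b l = (\<integral>x. ((\<Sum>i<?n. l ! i * x i) - m * (\<Sum>i<?n. l ! i))\<^sup>2 \<partial>gamma_prod b ?n (\<lambda>_. a))"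
    unfolding Q_var_def Q_mean_eq[OF assms] m_def Q_dist_eq_gsum_law gsum_law_def
    by (subst integral_distr) auto
  also have "\<dots> = (\<integral>x. (\<Sum>i<?n. \<Sum>j<?n. l ! i * l ! j * ((x i - m) * (x j - m))) \<partial>gamma_prod b ?n (\<lambda>_. a))"
  proof -
    have "((\<Sum>i<?n. l ! i * x i) - m * (\<Sum>i<?n. l ! i)) = (\<Sum>i<?n. l ! i * (x i - m))" for x :: "nat \<Rightarrow> real"
      by (simp add: sum_subtractf right_diff_distrib sum_distrib_left mult_ac)
    thus ?thesis by (simp add: power2_eq_square sum_product mult_ac)
  qed
  also have "\<dots> = (\<Sum>i<?n. \<Sum>j<?n. l ! i * l ! j * (if i = j then a / b\<^sup>2 else 0))"
    by (subst Bochner_Integration.integral_sum, (intro Bochner_Integration.integrable_sum integrable_mult_right int; simp),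
        rule sum.cong[OF refl], subst Bochner_Integration.integral_sum, (intro integrable_mult_right int; simp))
      (simp add: exp)
  also have "\<dots> = a / b\<^sup>2 * (\<Sum>i<?n. (l ! i)\<^sup>2)"
    by (simp add: sum_distrib_left power2_eq_square mult_ac if_distrib cong: if_cong)
  finally show ?thesis .
qed

section \<open>Raised shapes as added exponential variables\<close>

lemma char_gamma_M_exponential:
  assumes "0 < b"
  shows "char (gamma_M 1 b) s = 1 / (1 - \<i> * s / b)"
proof -
  let ?w = "\<i> * s - b"
  define f where "f x = of_real b * exp (?w * of_real x)" for x :: real
  have w: "?w \<noteq> 0" using assms by (auto simp: complex_eq_iff)
  have nf: "norm (exp (?w * of_real x)) = exp (- b * x)" for x :: real
    by simp
  have e: "gamma_density 1 b x *\<^sub>R iexp (s * x) = indicator {0<..} x *\<^sub>R f x" for x :: real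
  proof -
    have "exp (?w * of_real x) = of_real (exp (- b * x)) * iexp (s * x)"
      by (simp add: exp_of_real[symmetric] exp_add[symmetric] algebra_simps)
    thus ?thesis using assms by (auto simp: gamma_density_def f_def indicator_def scaleR_conv_of_real)
  qed
  have "integrable (gamma_M 1 b) (\<lambda>x. iexp (s * x))"
    by (rule integrable_gamma_M_bounded[where B=1]) (use assms in auto)
  hence int: "integrable lborel (\<lambda>x. indicator {0<..} x *\<^sub>R f x)"
    unfolding e[symmetric] by (subst (asm) integrable_gamma_M) simp_all
  have Ioi: "einterval 0 \<infinity> = {0<..}" by (auto simp: einterval_def)
  have "(LBINT x=0..\<infinity>. f x) = 0 - (b / ?w)"
  proof (rule interval_integral_FTC_integrable[where F = "\<lambda>x. (b / ?w) * exp (?w * of_real x)"])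
    fix x :: real
    show "((\<lambda>x. (b / ?w) * exp (?w * of_real x)) has_vector_derivative f x) (at x)"
      unfolding f_def using w
      by (auto intro!: derivative_eq_intros has_vector_derivative_real_field)
    show "isCont f x" unfolding f_def by (intro continuous_intros)
  next
    show "set_integrable lborel (einterval 0 \<infinity>) f"
      unfolding set_integrable_def Ioi using int .
    have "isCont (\<lambda>x::real. (b / ?w) * exp (?w * of_real x)) 0" by (intro continuous_intros)
    thus "(((\<lambda>x. (b / ?w) * exp (?w * of_real x)) \<circ> real_of_ereal) \<longlongrightarrow> b / ?w) (at_right 0)"
      unfolding zero_ereal_def ereal_tendsto_simps isCont_def
      by (auto intro: tendsto_within_subset)
    show "(((\<lambda>x. (b / ?w) * exp (?w * of_real x)) \<circ> real_of_ereal) \<longlongrightarrow> 0) (at_left \<infinity>)"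
      unfolding ereal_tendsto_simps
    proof (rule tendsto_norm_zero_cancel)
      have "((\<lambda>x::real. norm (b / ?w) * exp (- b * x)) \<longlongrightarrow> 0) at_top"
        using assms by real_asymp
      thus "((\<lambda>x::real. norm ((b / ?w) * exp (?w * of_real x))) \<longlongrightarrow> 0) at_top"
        by (simp add: norm_mult nf norm_divide)
    qed
  qed simp
  moreover have "(LBINT x=0..\<infinity>. f x) = char (gamma_M 1 b) s"
    unfolding char_def interval_lebesgue_integral_def set_lebesgue_integral_def Ioi
    unfolding e[symmetric] by (subst integral_gamma_M) simp_all
  moreover have "0 - b / ?w = 1 / (1 - \<i> * s / b)"
  proof -
    have "1 - \<i> * s / b = - (?w / b)" using assms by (simp add: field_simps)
    thus ?thesis by simp
  qed
  ultimately show ?thesis by simp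
qed

text \<open>The shape difference applied to the complex exponential is a linear equation for the
  transform of shape \<open>a + 1\<close>. This avoids the complex power in the transform of a
  general gamma law.\<close>

lemma char_gamma_M_plus1:
  assumes "0 < a" "0 < b"
  shows "char (gamma_M (a + 1) b) s = char (gamma_M a b) s * char (gamma_M 1 b) s"
proof -
  have "char (gamma_M (a + 1) b) s - char (gamma_M a b) s = (s / b) *\<^sub>R (\<integral>x. \<i> * iexp (s * x) \<partial>gamma_M (a + 1) b)"
    unfolding char_def
    by (rule gamma_M_shape_diff[where B=1 and B'=1])
      (use assms in \<open>auto intro!: has_vector_derivative_iexp continuous_intros simp: norm_mult\<close>)
  also have "\<dots> = (\<i> * s / b) * char (gamma_M (a + 1) b) s"
    by (simp add: char_def scaleR_conv_of_real)
  finally have "char (gamma_M (a + 1) b) s * (1 - \<i> * s / b) = char (gamma_M a b) s"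
    by (simp add: algebra_simps)
  moreover have "1 - \<i> * s / b \<noteq> 0" by (auto simp: complex_eq_iff)
  ultimately show ?thesis
    using assms by (simp add: char_gamma_M_exponential field_simps)
qed

lemma real_distribution_affine:
  "real_distribution M \<Longrightarrow> real_distribution (distr M borel (\<lambda>x. c * x + d))"
  by (rule prob_space.real_distribution_distr)
    (auto simp: real_distribution_def real_distribution_axioms_def cong: measurable_cong_sets)

text \<open>Raising a shape by one amounts to adding an independent exponential with the same
  weight; two raised shapes thus give the augmented variable before centring.\<close>

lemma gsum_law_shape_eq_convolution:
  assumes "0 < a" "0 < b" "j < n" "k < n" "j \<noteq> k"
  shows "gsum_law b n ((\<lambda>_. a)(j := a + 1, k := a + 1)) c =
    ((gsum_law b n (\<lambda>_. a) c \<star> scaled_gamma 1 b (c j)) \<star> scaled_gamma 1 b (c k))"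
proof (rule gsum_law_eqI)
  let ?e = "\<lambda>i s. char (gamma_M a b) (c i * s)" and ?x = "\<lambda>q s. char (gamma_M 1 b) (q * s)"
  fix s
  have "char (gamma_M (((\<lambda>_. a)(j := a + 1, k := a + 1)) i) b) (c i * s) =
      ?e i s * ((if i = j then ?x (c j) s else 1) * (if i = k then ?x (c k) s else 1))" for i
    using assms by (simp add: char_gamma_M_plus1)
  hence "(\<Prod>i<n. char (gamma_M (((\<lambda>_. a)(j := a + 1, k := a + 1)) i) b) (c i * s)) =
      (\<Prod>i<n. ?e i s) * (?x (c j) s * ?x (c k) s)"
    using assms by (simp add: prod.distrib prod.delta)
  thus "(\<Prod>i<n. char (gamma_M (((\<lambda>_. a)(j := a + 1, k := a + 1)) i) b) (c i * s)) =
    char ((gsum_law b n (\<lambda>_. a) c \<star> scaled_gamma 1 b (c j)) \<star> scaled_gamma 1 b (c k)) s"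
    using assms by (simp add: char_gsum_law char_convolution real_distribution_convolution
        real_distribution_gsum_law real_distribution_scaled_gamma char_scaled_gamma mult.assoc)
qed (use assms in \<open>auto intro!: real_distribution_gsum_law real_distribution_convolution real_distribution_scaled_gamma\<close>)

text \<open>Bridges two pictures: the definition carries the exponentials as two extra coordinates
  of shape 1, while the calculus along the path produces raised shapes.\<close>

lemma Q_aug_dist_eq_shape:
  assumes "0 < a" "0 < b" "j < length l" "k < length l" "j \<noteq> k"
  shows "Q_aug_dist a b l j k =
    distr (gsum_law b (length l) ((\<lambda>_. a)(j := a + 1, k := a + 1)) (nth l)) borel (\<lambda>x. 1 * x + - Q_mean a b l)"
proof -
  let ?n = "length l"
  let ?sh = "\<lambda>i. if i < length l then a else 1"
  let ?c = "\<lambda>i. if i < ?n then l ! i else if i = ?n then l ! j else l ! k"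
  let ?P = "gamma_prod b (?n + 2) ?sh"
  have eq: "gamma_M (if i < n then a else 1) b = (if i < n then gamma_M a b else gamma_M 1 b)" for i n :: nat
    by simp
  have P: "PiM {..<?n + 2} (\<lambda>i. if i < ?n then gamma_M a b else gamma_M 1 b) = ?P"
    by (simp add: gamma_prod_def eq)
  have "distr (distr ?P borel f) borel (\<lambda>x. 1 * x + - m) = distr ?P lborel (\<lambda>x. f x - m)"
    if "f \<in> borel_measurable ?P" for f :: "(nat \<Rightarrow> real) \<Rightarrow> real" and m
    using that by (subst distr_distr) (auto simp: o_def intro!: distr_cong)
  note * = this[OF measurable_gamma_prod_sum]
  have "Q_aug_dist a b l j k = distr (gsum_law b (?n + 2) ?sh ?c) borel (\<lambda>x. 1 * x + - Q_mean a b l)"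
    unfolding Q_aug_dist_def gsum_law_def P *
    by (intro distr_cong) (simp_all add: numeral_2_eq_2)
  also have "gsum_law b (?n + 2) ?sh ?c =
      ((gsum_law b ?n (\<lambda>_. a) (nth l) \<star> scaled_gamma 1 b (l ! j)) \<star> scaled_gamma 1 b (l ! k))"
    using assms by (intro gsum_law_eqI)
      (auto intro!: real_distribution_convolution real_distribution_gsum_law real_distribution_scaled_gamma
        simp: numeral_2_eq_2 char_convolution real_distribution_convolution real_distribution_scaled_gamma
          char_scaled_gamma char_gsum_law real_distribution_gsum_law)
  finally show ?thesis unfolding gsum_law_shape_eq_convolution[OF assms] .
qed

section \<open>Smoothing by exponential variables\<close>

lemma measure_exponential_ge:
  assumes "0 < b" "0 \<le> t"
  shows "measure (gamma_M 1 b) {t..} = exp (- b * t)"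
proof -
  have "emeasure (gamma_M 1 b) {t..} = (\<integral>\<^sup>+x. ennreal (gamma_density 1 b x) * indicator {t..} x \<partial>lborel)"
    unfolding gamma_M_def by (subst emeasure_density) auto
  also have "\<dots> = (\<integral>\<^sup>+x. ennreal (b * exp (- b * x)) * indicator {t..} x \<partial>lborel)"
    by (intro nn_integral_cong_AE eventually_mono[OF AE_lborel_singleton[of 0]])
      (use assms in \<open>auto simp: gamma_density_def indicator_def\<close>)
  also have "\<dots> = ennreal (0 - (- exp (- b * t)))"
  proof (rule nn_integral_FTC_atLeast)
    show "((\<lambda>x. - exp (- b * x)) has_real_derivative b * exp (- b * x)) (at x)" for x
      by (auto intro!: derivative_eq_intros)
    show "((\<lambda>x. - exp (- b * x)) \<longlongrightarrow> 0) at_top" using assms by real_asymp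
  qed (use assms in auto)
  finally show ?thesis by (simp add: measure_def)
qed

lemma gamma_M_no_atoms: "measure (gamma_M a b) {y} = 0"
proof -
  have "AE x in lborel. ennreal (gamma_density a b x) * indicator {y} x = 0"
    using AE_lborel_singleton[of y] by (rule eventually_mono) simp
  hence "emeasure (gamma_M a b) {y} = 0"
    unfolding gamma_M_def by (subst emeasure_density) (auto simp: nn_integral_0_iff_AE)
  thus ?thesis by (simp add: measure_def)
qed

lemma scaled_gamma_no_atoms:
  assumes "q \<noteq> 0"
  shows "measure (scaled_gamma a b q) {y} = 0"
proof -
  have "(\<lambda>x. q * x) -` {y} = {y / q}" using assms by (auto simp: field_simps)
  thus ?thesis unfolding scaled_gamma_def
    by (subst measure_distr) (simp_all add: gamma_M_no_atoms measurable_cong_sets[OF sets_gamma_M refl])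
qed

lemma measure_exponential_ge':
  assumes "0 < b"
  shows "measure (gamma_M 1 b) {t..} = (if t \<le> 0 then 1 else exp (- b * t))"
proof (cases "t \<le> 0")
  case True
  interpret prob_space "gamma_M 1 b" by (rule prob_space_gamma_M) (use assms in auto)
  have "measure (gamma_M 1 b) {0..} \<le> measure (gamma_M 1 b) {t..}"
    using True by (intro finite_measure_mono) auto
  thus ?thesis using True measure_exponential_ge[of b 0] assms prob_le_1[of "{t..}"] by simp
qed (use measure_exponential_ge[of b t] assms in auto)

lemma measure_exponential_le:
  assumes "0 < b"
  shows "measure (gamma_M 1 b) {..t} = 1 - measure (gamma_M 1 b) {t..}"
proof -
  interpret prob_space "gamma_M 1 b" by (rule prob_space_gamma_M) (use assms in auto)
  have "prob {t..} = prob ({t} \<union> {t<..})" by (rule arg_cong[where f=prob]) auto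
  also have "\<dots> = prob {t} + prob {t<..}" by (rule finite_measure_Union) auto
  finally have "prob {t..} = prob {t} + prob {t<..}" .
  moreover have "prob {..t} = 1 - prob {t<..}"
    using prob_compl[of "{t<..}"] by (simp add: Compl_eq_Diff_UNIV[symmetric] not_less lessThan_def greaterThan_def atMost_def Collect_neg_eq[symmetric])
  ultimately show ?thesis by (simp add: gamma_M_no_atoms)
qed

text \<open>Tail and density of an exponential variable are proportional, for either sign of
  \<open>q\<close>. The point 0 is left out because \<open>0 powr 0 = 0\<close> makes
  \<open>gamma_density 1 b\<close> vanish there, which breaks the identity for positive
  \<open>q\<close>.\<close>

lemma scaled_exp_atMost:
  assumes "0 < b" "q \<noteq> 0" "z \<noteq> 0"
  shows "indicator {0..} z - measure (scaled_gamma 1 b q) {..z} = (q / b) * (gamma_density 1 b (z / q) / \<bar>q\<bar>)"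
proof -
  have "measure (scaled_gamma 1 b q) {..z} = measure (gamma_M 1 b) ((\<lambda>x. q * x) -` {..z})"
    unfolding scaled_gamma_def by (subst measure_distr) (simp_all add: measurable_cong_sets[OF sets_gamma_M refl])
  also have "(\<lambda>x. q * x) -` {..z} = (if q > 0 then {..z/q} else {z/q..})"
    using assms by (auto simp: field_simps)
  finally have "measure (scaled_gamma 1 b q) {..z} =
      (if q > 0 then 1 - (if z / q \<le> 0 then 1 else exp (- b * (z / q))) else if z / q \<le> 0 then 1 else exp (- b * (z / q)))"
    using assms by (simp add: measure_exponential_le measure_exponential_ge')
  thus ?thesis
    using assms by (auto simp: gamma_density_def indicator_def field_simps zero_le_divide_iff divide_le_0_iff
      not_le not_less split: if_splits)
qed

lemma emeasure_convolution_real: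
  assumes "real_distribution M" "real_distribution N" "A \<in> sets borel"
  shows "emeasure (M \<star> N) A = (\<integral>\<^sup>+x. emeasure N {a. a + x \<in> A} \<partial>M)"
proof -
  interpret M: real_distribution M by fact
  interpret N: real_distribution N by fact
  show ?thesis
    using assms(3) by (intro convolution_emeasure) (auto intro: M.finite_measure_axioms N.finite_measure_axioms)
qed

lemma convolution_no_atoms:
  assumes "real_distribution M" "real_distribution N" "\<And>y. measure M {y} = 0"
  shows "measure (N \<star> M) {y} = 0"
proof -
  interpret M: real_distribution M by fact
  have "{a. a + x \<in> {y}} = {y - x}" for x by auto
  hence "emeasure (N \<star> M) {y} = 0"
    using assms by (subst emeasure_convolution_real) (auto simp: M.emeasure_eq_measure)
  thus ?thesis by (simp add: measure_def)
qed

lemma cdf_convolution: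
  assumes "real_distribution M" "real_distribution N"
  shows "cdf (M \<star> N) u = (\<integral>x. cdf N (u - x) \<partial>M)" "integrable M (\<lambda>x. cdf N (u - x))"
proof -
  interpret M: real_distribution M by fact
  interpret N: real_distribution N by fact
  have [measurable]: "cdf N \<in> borel_measurable borel"
    by (rule borel_measurable_mono) (auto simp: mono_def N.cdf_nondecreasing)
  show int: "integrable M (\<lambda>x. cdf N (u - x))"
    by (rule M.integrable_const_bound[where B=1]) (auto simp: N.cdf_nonneg N.cdf_bounded_prob)
  have "{a. a + x \<in> {..u}} = {..u - x}" for x by auto
  hence "emeasure (M \<star> N) {..u} = (\<integral>\<^sup>+x. ennreal (cdf N (u - x)) \<partial>M)"
    using assms by (subst emeasure_convolution_real) (auto simp: N.emeasure_eq_measure cdf_def2)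
  also have "\<dots> = ennreal (\<integral>x. cdf N (u - x) \<partial>M)"
    by (rule nn_integral_eq_integral) (use int in \<open>auto simp: N.cdf_nonneg\<close>)
  finally show "cdf (M \<star> N) u = (\<integral>x. cdf N (u - x) \<partial>M)"
    by (simp add: cdf_def2 measure_def integral_nonneg_AE N.cdf_nonneg)
qed

lemma convolution_density_right:
  assumes "real_distribution Q" "real_distribution (density lborel g)"
    and [measurable]: "g \<in> borel_measurable borel"
  shows "(Q \<star> density lborel g) = density lborel (\<lambda>u. \<integral>\<^sup>+x. g (u - x) \<partial>Q)"
proof (rule measure_eqI)
  interpret Q: real_distribution Q by fact
  interpret pair_sigma_finite lborel Q ..
  fix A assume "A \<in> sets (Q \<star> density lborel g)"
  hence A [measurable]: "A \<in> sets borel" by simp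
  have "emeasure (density lborel g) {a. a + x \<in> A} = (\<integral>\<^sup>+u. g (u - x) * indicator A u \<partial>lborel)" for x
  proof -
    have "{a. a + x \<in> A} \<in> sets borel" by measurable
    hence "emeasure (density lborel g) {a. a + x \<in> A} = (\<integral>\<^sup>+u. g u * indicator A (u + x) \<partial>lborel)"
      by (subst emeasure_density) (auto intro!: nn_integral_cong simp: indicator_def)
    also have "\<dots> = (\<integral>\<^sup>+u. g (u - x) * indicator A u \<partial>lborel)"
      by (subst (2) nn_integral_real_affine[of _ 1 x]) (auto simp: add.commute)
    finally show ?thesis .
  qed
  hence "emeasure (Q \<star> density lborel g) A = (\<integral>\<^sup>+x. \<integral>\<^sup>+u. g (u - x) * indicator A u \<partial>lborel \<partial>Q)"
    using assms by (subst emeasure_convolution_real) auto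
  also have "\<dots> = (\<integral>\<^sup>+u. \<integral>\<^sup>+x. g (u - x) * indicator A u \<partial>Q \<partial>lborel)"
    by (rule Fubini') measurable
  also have "\<dots> = emeasure (density lborel (\<lambda>u. \<integral>\<^sup>+x. g (u - x) \<partial>Q)) A"
    by (subst emeasure_density) (auto simp: nn_integral_multc)
  finally show "emeasure (Q \<star> density lborel g) A = emeasure (density lborel (\<lambda>u. \<integral>\<^sup>+x. g (u - x) \<partial>Q)) A" .
qed auto

lemma distr_density_scale:
  assumes "q \<noteq> 0" and [measurable]: "g \<in> borel_measurable borel" and nn: "\<And>x. 0 \<le> g x"
  shows "distr (density lborel (\<lambda>x. ennreal (g x))) borel (\<lambda>x. q * x) =
    density lborel (\<lambda>x. ennreal (g (x / q) / \<bar>q\<bar>))"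
proof (rule measure_eqI)
  fix A assume "A \<in> sets (distr (density lborel (\<lambda>x. ennreal (g x))) borel (\<lambda>x. q * x))"
  hence [measurable]: "A \<in> sets borel" by simp
  have "emeasure (density lborel (\<lambda>x. ennreal (g (x / q) / \<bar>q\<bar>))) A =
      \<bar>q\<bar> * (\<integral>\<^sup>+x. ennreal (g x / \<bar>q\<bar>) * indicator A (q * x) \<partial>lborel)"
    using assms by (subst emeasure_density, simp_all) (subst nn_integral_real_affine[of _ q 0], simp_all)
  also have "\<dots> = (\<integral>\<^sup>+x. ennreal \<bar>q\<bar> * (ennreal (g x / \<bar>q\<bar>) * indicator A (q * x)) \<partial>lborel)"
    by (subst nn_integral_cmult) auto
  also have "\<dots> = (\<integral>\<^sup>+x. ennreal (g x) * indicator A (q * x) \<partial>lborel)"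
    using assms by (intro nn_integral_cong) (simp add: mult.assoc[symmetric] ennreal_mult[symmetric])
  also have "\<dots> = emeasure (distr (density lborel (\<lambda>x. ennreal (g x))) borel (\<lambda>x. q * x)) A"
  proof -
    have "(\<lambda>x. q * x) -` A \<in> sets borel" using measurable_sets[of "\<lambda>x. q * x" borel borel A] by simp
    thus ?thesis
      by (subst emeasure_distr) (auto simp: emeasure_density indicator_def intro!: nn_integral_cong)
  qed
  finally show "emeasure (distr (density lborel (\<lambda>x. ennreal (g x))) borel (\<lambda>x. q * x)) A =
      emeasure (density lborel (\<lambda>x. ennreal (g (x / q) / \<bar>q\<bar>))) A" by simp
qed auto

lemma scaled_gamma_density:
  "0 < a \<Longrightarrow> q \<noteq> 0 \<Longrightarrow> scaled_gamma a b q = density lborel (\<lambda>x. ennreal (gamma_density a b (x / q) / \<bar>q\<bar>))"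
  unfolding scaled_gamma_def gamma_M_def
  by (rule distr_density_scale) (simp_all add: gamma_density_nonneg)

text \<open>Adding an exponential variable \<open>q\<psi>\<close> turns a distribution function \<open>F\<close> into the solution
  \<open>G\<close> of \<open>G + (q/b) G' = F\<close>; the density is therefore a difference of distribution functions.\<close>

definition exp_pdf :: "real \<Rightarrow> real measure \<Rightarrow> real \<Rightarrow> real \<Rightarrow> real" where
  "exp_pdf b Q q y = b / q * (cdf Q y - cdf (Q \<star> scaled_gamma 1 b q) y)"

text \<open>Absence of atoms serves twice: the point excluded in \<open>scaled_exp_atMost\<close>
  becomes a null set, and \<open>cdf Q\<close> becomes continuous, which makes the new density
  continuous.\<close>

locale exp_smoothing = Q: real_distribution Q for Q +
  fixes b q :: real
  assumes b: "0 < b" and q: "q \<noteq> 0" and no_atoms: "measure Q {y} = 0"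
begin

abbreviation "R \<equiv> Q \<star> scaled_gamma 1 b q"

lemma R_distribution: "real_distribution R"
  by (intro real_distribution_convolution Q.real_distribution_axioms real_distribution_scaled_gamma zero_less_one b)

sublocale E: real_distribution "scaled_gamma 1 b q"
  by (rule real_distribution_scaled_gamma[OF zero_less_one b])

sublocale R: real_distribution R by (rule R_distribution)

lemma density_eq: "(\<integral>\<^sup>+x. ennreal (gamma_density 1 b ((u - x) / q) / \<bar>q\<bar>) \<partial>Q) = ennreal (exp_pdf b Q q u)"
  and exp_pdf_nonneg: "0 \<le> exp_pdf b Q q u"
proof -
  let ?g = "\<lambda>x. gamma_density 1 b ((u - x) / q) / \<bar>q\<bar>"
  let ?h = "\<lambda>x. b / q * (indicator {..u} x - cdf (scaled_gamma 1 b q) (u - x))"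
  have [measurable]: "cdf (scaled_gamma 1 b q) \<in> borel_measurable borel"
    by (rule borel_measurable_mono) (auto simp: mono_def E.cdf_nondecreasing)
  have "AE x in Q. x \<noteq> u"
    using no_atoms[of u] by (intro AE_I[of _ _ "{u}"]) (auto simp: Q.emeasure_eq_measure)
  hence ae: "AE x in Q. ?g x = ?h x"
  proof (rule eventually_mono)
    fix x assume "x \<noteq> u"
    hence "indicator {0..} (u - x) - cdf (scaled_gamma 1 b q) (u - x) = (q / b) * ?g x"
      using scaled_exp_atMost[OF b q, of "u - x"] by (simp add: cdf_def2)
    moreover have "indicator {0..} (u - x) = (indicator {..u} x :: real)" by (auto simp: indicator_def)
    ultimately show "?g x = ?h x" using b q by (simp add: field_simps)
  qed
  have ind: "integrable Q (indicator {..u} :: real \<Rightarrow> real)"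
    by (rule Q.integrable_const_bound[where B=1]) (auto simp: indicator_def)
  have inth: "integrable Q ?h"
    using cdf_convolution(2)[OF Q.real_distribution_axioms E.real_distribution_axioms, of u]
    by (intro integrable_mult_right Bochner_Integration.integrable_diff ind)
  have eqh: "(\<integral>x. ?h x \<partial>Q) = exp_pdf b Q q u"
    using cdf_convolution[OF Q.real_distribution_axioms E.real_distribution_axioms, of u]
    by (simp add: exp_pdf_def cdf_def2[of Q] Bochner_Integration.integral_diff[OF ind])
  have intg: "integrable Q ?g" using inth ae by (subst integrable_cong_AE) auto
  have eqg: "(\<integral>x. ?g x \<partial>Q) = exp_pdf b Q q u" unfolding eqh[symmetric] using ae by (intro integral_cong_AE) auto
  show "0 \<le> exp_pdf b Q q u" unfolding eqg[symmetric]
    by (rule integral_nonneg_AE) (auto simp: gamma_density_nonneg)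
  show "(\<integral>\<^sup>+x. ennreal (?g x) \<partial>Q) = ennreal (exp_pdf b Q q u)"
    unfolding eqg[symmetric] by (rule nn_integral_eq_integral[OF intg]) (auto simp: gamma_density_nonneg)
qed

lemma R_density: "R = density lborel (\<lambda>u. ennreal (exp_pdf b Q q u))"
proof -
  have "R = (Q \<star> density lborel (\<lambda>x. ennreal (gamma_density 1 b (x / q) / \<bar>q\<bar>)))"
    unfolding scaled_gamma_density[OF zero_less_one q] ..
  also have "\<dots> = density lborel (\<lambda>u. \<integral>\<^sup>+x. ennreal (gamma_density 1 b ((u - x) / q) / \<bar>q\<bar>) \<partial>Q)"
    by (rule convolution_density_right)
      (use E.real_distribution_axioms in \<open>auto simp: scaled_gamma_density[OF zero_less_one q] intro: Q.real_distribution_axioms\<close>)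
  finally show ?thesis unfolding density_eq .
qed

lemma R_no_atoms: "measure R {y} = 0"
  by (intro convolution_no_atoms Q.real_distribution_axioms E.real_distribution_axioms scaled_gamma_no_atoms q)

lemma exp_pdf_continuous: "isCont (exp_pdf b Q q) y"
proof -
  have "isCont (cdf Q) y" "isCont (cdf R) y"
    by (simp_all add: Q.isCont_cdf R.isCont_cdf no_atoms R_no_atoms)
  thus ?thesis unfolding exp_pdf_def[abs_def] by (intro continuous_intros)
qed

lemma exp_pdf_tendsto_0: "(exp_pdf b Q q \<longlongrightarrow> 0) at_top"
proof -
  have "((\<lambda>y. b / q * (cdf Q y - cdf R y)) \<longlongrightarrow> b / q * (1 - 1)) at_top"
    by (intro tendsto_intros Q.cdf_lim_at_top_prob R.cdf_lim_at_top_prob)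
  thus ?thesis by (simp add: exp_pdf_def[abs_def])
qed

text \<open>\<open>R\<close> is atomless with a continuous density, so its distribution function is
  an indefinite integral. The radius 1 only serves to put \<open>y\<close> in the interior of the
  interval.\<close>

lemma cdf_R_deriv: "(cdf R has_real_derivative exp_pdf b Q q y) (at y)"
proof -
  let ?r = "exp_pdf b Q q"
  define c d where "c = y - 1" and "d = y + 1"
  have cont: "continuous_on S ?r" for S
    using exp_pdf_continuous by (auto intro: continuous_at_imp_continuous_on)
  have eq: "cdf R t = cdf R c + integral {c..t} ?r" if "t \<in> {c..d}" for t
  proof -
    have int: "?r absolutely_integrable_on {c..t}"
      by (intro absolutely_integrable_continuous_real cont)
    have "cdf R t - cdf R c = measure R {c<..t}"
      using R.cdf_diff_eq[of c t] that by (cases "c = t") auto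
    also have "\<dots> = measure R {c..t}"
    proof -
      have "measure R {c..t} = measure R ({c} \<union> {c<..t})"
        using that by (intro arg_cong[where f="measure R"]) auto
      also have "\<dots> = measure R {c} + measure R {c<..t}" by (rule R.finite_measure_Union) auto
      finally show ?thesis by (simp add: R_no_atoms)
    qed
    also have "\<dots> = integral {c..t} ?r"
    proof -
      have [measurable]: "?r \<in> borel_measurable borel"
        using cont[of UNIV] by (rule borel_measurable_continuous_onI)
      have "emeasure R {c..t} = (\<integral>\<^sup>+u. ennreal (?r u * indicator {c..t} u) \<partial>lborel)"
        by (subst R_density, subst emeasure_density) (auto intro!: nn_integral_cong simp: indicator_def)
      also have "\<dots> = ennreal (\<integral>u. ?r u * indicator {c..t} u \<partial>lborel)"
        using borel_integrable_atLeastAtMost'[OF cont, of c t]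
        by (intro nn_integral_eq_integral) (auto simp: exp_pdf_nonneg set_integrable_def mult.commute)
      also have "(\<integral>u. ?r u * indicator {c..t} u \<partial>lborel) = integral {c..t} ?r"
        using set_borel_integral_eq_integral(2)[OF borel_integrable_atLeastAtMost'[OF cont, of c t]]
        by (simp add: set_lebesgue_integral_def mult.commute)
      finally show ?thesis
        by (simp add: measure_def integral_nonneg[OF integrable_continuous_real[OF cont]] exp_pdf_nonneg)
    qed
    finally show ?thesis by simp
  qed
  have "((\<lambda>t. cdf R c + integral {c..t} ?r) has_real_derivative 0 + ?r y) (at y within {c..d})"
    by (intro derivative_intros integral_has_real_derivative cont) (auto simp: c_def d_def)
  hence "((\<lambda>t. cdf R c + integral {c..t} ?r) has_real_derivative ?r y) (at y)"
    by (subst (asm) at_within_interior) (auto simp: c_def d_def)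
  moreover have ev: "eventually (\<lambda>t. cdf R c + integral {c..t} ?r = cdf R t) (nhds y)"
  proof (rule eventually_mono[OF eventually_nhds_in_open[of "{c<..<d}"]])
    show "cdf R c + integral {c..t} ?r = cdf R t" if "t \<in> {c<..<d}" for t
      using eq[of t] that by auto
  qed (auto simp: c_def d_def)
  ultimately show ?thesis using DERIV_cong_ev[OF refl ev refl] by simp
qed

end

text \<open>Each exponential gains one degree of smoothness: the first yields a continuous density,
  the second a continuously differentiable one, whose derivative is a multiple of the difference of
  two continuous densities.\<close>

locale two_exp_smoothing = exp_smoothing Q b q for Q b q +
  fixes p :: real
  assumes p: "p \<noteq> 0"
begin

sublocale second: exp_smoothing R b p
  by unfold_locales (use b p R_no_atoms in auto)

abbreviation "f \<equiv> exp_pdf b R p"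
abbreviation "f' \<equiv> \<lambda>y. b / p * (exp_pdf b Q q y - exp_pdf b R p y)"

lemma f_deriv: "(f has_real_derivative f' y) (at y)"
proof -
  have "((\<lambda>y. b / p * (cdf R y - cdf second.R y)) has_real_derivative f' y) (at y)"
    by (rule DERIV_cmult[OF DERIV_diff[OF cdf_R_deriv second.cdf_R_deriv]])
  moreover have "(\<lambda>y. b / p * (cdf R y - cdf second.R y)) = f"
    by (rule ext) (simp add: exp_pdf_def[of b R p])
  ultimately show ?thesis by simp
qed

lemma f'_continuous: "isCont f' y"
  by (intro continuous_intros exp_pdf_continuous second.exp_pdf_continuous)

end

section \<open>Analyticity of the densities\<close>

text \<open>Dominated convergence of difference quotients. The field is general because the extended
  densities have a complex parameter and the path of weights a real one.\<close>

lemma has_field_derivative_integral: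
  fixes F :: "'x \<Rightarrow> 'a::{real_normed_field,banach,second_countable_topology} \<Rightarrow> 'a"
  assumes S: "open S" "z \<in> S"
    and F': "\<And>x. x \<in> space M \<Longrightarrow> (F x has_field_derivative F' x) (at z)"
    and int: "\<And>y. y \<in> S \<Longrightarrow> integrable M (\<lambda>x. F x y)"
    and w: "integrable M w"
    and lip: "\<And>x y. x \<in> space M \<Longrightarrow> y \<in> S \<Longrightarrow> norm (F x y - F x z) \<le> w x * norm (y - z)"
  shows "((\<lambda>y. \<integral>x. F x y \<partial>M) has_field_derivative (\<integral>x. F' x \<partial>M)) (at z)"
proof -
  obtain e where e: "0 < e" "ball z e \<subseteq> S" using S open_contains_ball by blast
  let ?q = "\<lambda>x y. (F x y - F x z) / (y - z)"
  have q: "(?q x \<longlongrightarrow> F' x) (at z)" if "x \<in> space M" for x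
    using F'[OF that] by (simp add: has_field_derivative_iff)
  have seq: "(\<lambda>n. ?q x (Y n)) \<longlonglongrightarrow> F' x" if "x \<in> space M" "\<And>n. Y n \<noteq> z" "Y \<longlonglongrightarrow> z" for x Y
    using q[OF that(1)] that unfolding tendsto_at_iff_sequentially o_def by blast
  have meas: "(\<lambda>x. ?q x y) \<in> borel_measurable M" if "y \<in> S" for y
    using int[OF that] int[OF S(2)] by (intro borel_measurable_divide borel_measurable_diff) auto
  \<comment> \<open>\<open>F'\<close> is given only pointwise; it is measurable as a limit of
    difference quotients. The denominator \<open>2 + real n\<close> keeps the whole sequence inside
    the ball.\<close>
  have F'_meas: "F' \<in> borel_measurable M"
  proof (rule borel_measurable_LIMSEQ_metric)
    let ?Y = "\<lambda>n::nat. z + of_real (e / (2 + real n))"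
    have Y: "?Y n \<in> S" for n
    proof (rule subsetD[OF e(2)])
      have "dist z (?Y n) = norm (of_real (e / (2 + real n)) :: 'a)"
        by (subst dist_commute) (simp only: dist_norm add_diff_cancel_left')
      also have "\<dots> < e" using e by (simp add: field_simps add_pos_nonneg del: of_real_divide of_real_add)
      finally show "?Y n \<in> ball z e" by simp
    qed
    show "(\<lambda>x. ?q x (?Y n)) \<in> borel_measurable M" for n by (rule meas[OF Y])
    have "(\<lambda>n. e / (2 + real n)) \<longlonglongrightarrow> 0" by real_asymp
    hence "?Y \<longlonglongrightarrow> z + of_real 0" by (intro tendsto_intros)
    moreover have "?Y n \<noteq> z" for n
    proof -
      have "0 < e / (2 + real n)" using e by (intro divide_pos_pos) auto
      thus ?thesis by (simp only: add_cancel_left_right of_real_eq_0_iff)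
    qed
    ultimately show "(\<lambda>n. ?q x (?Y n)) \<longlonglongrightarrow> F' x" if "x \<in> space M" for x
      using that by (intro seq) (simp_all del: of_real_divide of_real_add)
  qed
  show ?thesis
    unfolding has_field_derivative_iff tendsto_at_iff_sequentially o_def
  proof (intro allI impI)
    fix Y assume Y: "\<forall>n. Y n \<in> UNIV - {z}" "Y \<longlonglongrightarrow> z"
    have ev: "eventually (\<lambda>n. Y n \<in> S) sequentially"
      using Y(2) S by (rule topological_tendstoD)
    then obtain N where N: "\<And>n. n \<ge> N \<Longrightarrow> Y n \<in> S" by (auto simp: eventually_sequentially)
    have "(\<lambda>n. \<integral>x. ?q x (Y (n + N)) \<partial>M) \<longlonglongrightarrow> (\<integral>x. F' x \<partial>M)"
    proof (rule integral_dominated_convergence[where w = w])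
      show "AE x in M. (\<lambda>n. ?q x (Y (n + N))) \<longlonglongrightarrow> F' x"
        using Y by (intro AE_I2 seq) (auto intro: LIMSEQ_ignore_initial_segment)
      show "AE x in M. norm (?q x (Y (n + N))) \<le> w x" for n
      proof (rule AE_I2)
        fix x assume "x \<in> space M"
        moreover have "Y (n + N) - z \<noteq> 0" using Y(1) by auto
        ultimately show "norm (?q x (Y (n + N))) \<le> w x"
          using lip[of x "Y (n + N)"] N[of "n + N"]
          by (simp add: norm_divide divide_le_eq)
      qed
    qed (use F'_meas meas N w in auto)
    hence "(\<lambda>n. \<integral>x. ?q x (Y n) \<partial>M) \<longlonglongrightarrow> (\<integral>x. F' x \<partial>M)" by (rule LIMSEQ_offset)
    moreover have "eventually (\<lambda>n. (\<integral>x. ?q x (Y n) \<partial>M) = ((\<integral>x. F x (Y n) \<partial>M) - (\<integral>x. F x z \<partial>M)) / (Y n - z)) sequentially"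
      using ev
    proof (rule eventually_mono)
      fix n assume n: "Y n \<in> S"
      show "(\<integral>x. ?q x (Y n) \<partial>M) = ((\<integral>x. F x (Y n) \<partial>M) - (\<integral>x. F x z \<partial>M)) / (Y n - z)"
        using int[OF n] int[OF S(2)] by simp
    qed
    ultimately show "(\<lambda>n. ((\<integral>x. F x (Y n) \<partial>M) - (\<integral>x. F x z \<partial>M)) / (Y n - z)) \<longlonglongrightarrow> (\<integral>x. F' x \<partial>M)"
      by (rule Lim_transform_eventually)
  qed
qed

text \<open>A local integrable bound on the functions themselves is enough: Cauchy's inequality on
  circles of half the radius turns it into a bound on the derivatives, which is the Lipschitz bound
  needed under the integral.\<close>

lemma holomorphic_on_integral:
  assumes "open S"
    and hol: "\<And>x. x \<in> space M \<Longrightarrow> F x holomorphic_on S"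
    and meas: "\<And>z. z \<in> S \<Longrightarrow> (\<lambda>x. F x z) \<in> borel_measurable M"
    and bound: "\<And>z. z \<in> S \<Longrightarrow> \<exists>r w. 0 < r \<and> cball z r \<subseteq> S \<and> integrable M w \<and>
      (\<forall>x\<in>space M. \<forall>y\<in>cball z r. norm (F x y) \<le> w x)"
  shows "(\<lambda>z. \<integral>x. F x z \<partial>M) holomorphic_on S"
  unfolding holomorphic_on_open[OF assms(1)]
proof
  fix z assume z: "z \<in> S"
  obtain r w where r: "0 < r" "cball z r \<subseteq> S" and w: "integrable M w"
    and le: "\<And>x y. x \<in> space M \<Longrightarrow> y \<in> cball z r \<Longrightarrow> norm (F x y) \<le> w x"
    using bound[OF z] by blast
  let ?r = "r / 2"
  have der: "(F x has_field_derivative deriv (F x) y) (at y)" if "x \<in> space M" "y \<in> S" for x y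
    using holomorphic_derivI[OF hol[OF that(1)] assms(1) that(2)] .
  have dle: "norm (deriv (F x) y) \<le> w x / ?r" if x: "x \<in> space M" and y: "y \<in> cball z ?r" for x y
  proof -
    have sub: "cball y ?r \<subseteq> cball z r"
    proof
      fix u assume "u \<in> cball y ?r"
      thus "u \<in> cball z r" using y dist_triangle[of z u y] by simp
    qed
    have subS: "ball y ?r \<subseteq> S" "cball y ?r \<subseteq> S"
      using sub r(2) ball_subset_cball by blast+
    have "norm ((deriv ^^ 1) (F x) y) \<le> fact 1 * w x / ?r ^ 1"
    proof (rule Cauchy_inequality)
      show "F x holomorphic_on ball y ?r" "continuous_on (cball y ?r) (F x)"
        by (rule holomorphic_on_subset[OF hol[OF x] subS(1)],
            rule holomorphic_on_imp_continuous_on[OF holomorphic_on_subset[OF hol[OF x] subS(2)]])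
      show "norm (F x u) \<le> w x" if "norm (y - u) = ?r" for u
        by (rule le[OF x subsetD[OF sub]]) (simp add: dist_norm that)
    qed (use r in simp)
    thus ?thesis by simp
  qed
  have "((\<lambda>y. \<integral>x. F x y \<partial>M) has_field_derivative (\<integral>x. deriv (F x) z \<partial>M)) (at z)"
  proof (rule has_field_derivative_integral[where S = "ball z ?r" and w = "\<lambda>x. w x / ?r"])
    show "(F x has_field_derivative deriv (F x) z) (at z)" if "x \<in> space M" for x
      by (rule der[OF that z])
    show "integrable M (\<lambda>x. F x y)" if y: "y \<in> ball z ?r" for y
    proof (rule Bochner_Integration.integrable_bound[OF w])
      have "y \<in> cball z r" using y r by auto
      thus "AE x in M. norm (F x y) \<le> norm (w x)"
        using le by (intro AE_I2) (smt (verit) real_norm_def norm_ge_zero)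
      show "(\<lambda>x. F x y) \<in> borel_measurable M" using y r by (intro meas subsetD[OF r(2)]) auto
    qed
    show "norm (F x y - F x z) \<le> w x / ?r * norm (y - z)" if xy: "x \<in> space M" "y \<in> ball z ?r" for x y
    proof (rule field_differentiable_bound[of "cball z ?r" "F x" "deriv (F x)"])
      show "(F x has_field_derivative deriv (F x) u) (at u within cball z ?r)" if "u \<in> cball z ?r" for u
      proof (rule has_field_derivative_at_within[OF der[OF xy(1)]])
        have "u \<in> cball z r" using that r(1) by simp
        thus "u \<in> S" using r(2) by blast
      qed
      show "norm (deriv (F x) u) \<le> w x / ?r" if "u \<in> cball z ?r" for u
        by (rule dle[OF xy(1) that])
    qed (use xy(2) r(1) in simp_all)
  qed (use r w in auto)
  thus "\<exists>f'. ((\<lambda>z. \<integral>x. F x z \<partial>M) has_field_derivative f') (at z)" ..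
qed

abbreviation half_line :: "(complex \<Rightarrow> complex) \<Rightarrow> real \<Rightarrow> ennreal" where
  "half_line G y \<equiv> ennreal (if 0 < y then Re (G (of_real y)) else 0)"

abbreviation right_half_plane :: "complex set" where
  "right_half_plane \<equiv> {z. 0 < Re z}"

lemma open_right_half_plane: "open right_half_plane"
  by (rule open_halfspace_Re_gt)

lemma cball_right_half_plane:
  assumes "0 < Re z"
  shows "cball z (Re z / 2) \<subseteq> right_half_plane"
proof
  fix y assume "y \<in> cball z (Re z / 2)"
  hence "Re z - Re y \<le> Re z / 2" using complex_Re_le_cmod[of "z - y"] by (simp add: dist_norm)
  thus "y \<in> right_half_plane" using assms by (simp add: field_simps)
qed

text \<open>The class is closed under convolution because a convolution on \<open>(0, y)\<close> can be written as
  \<open>y \<integral>\<^sub>0\<^sup>1 G\<^sub>1 (y (1 - v)) G\<^sub>2 (y v) dv\<close>, which still makes sense for complex \<open>y\<close>.\<close>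

definition analytic_density :: "real \<Rightarrow> (complex \<Rightarrow> complex) \<Rightarrow> real measure \<Rightarrow> bool" where
  "analytic_density A G M \<longleftrightarrow> real_distribution M \<and> G holomorphic_on right_half_plane \<and>
     (\<exists>C m. 0 \<le> C \<and> 0 < m \<and> (\<forall>z. 0 < Re z \<longrightarrow> norm (G z) \<le> C * norm z powr (A - 1) * exp (- m * Re z))) \<and>
     (\<forall>y>0. Im (G (of_real y)) = 0 \<and> 0 \<le> Re (G (of_real y))) \<and>
     M = density lborel (half_line G)"

lemma measurable_half_line_density:
  assumes "P holomorphic_on right_half_plane"
  shows "(half_line P) \<in> borel_measurable borel"
proof -
  have "continuous_on {0<..} (\<lambda>y. Re (P (of_real y)))"
    by (intro continuous_intros continuous_on_compose2[OF holomorphic_on_imp_continuous_on[OF assms]]) auto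
  hence "(\<lambda>y. indicator {0<..} y *\<^sub>R Re (P (of_real y))) \<in> borel_measurable borel"
    by (intro borel_measurable_continuous_on_indicator) auto
  also have "(\<lambda>y. indicator {0<..} y *\<^sub>R Re (P (of_real y))) = (\<lambda>y. if 0 < y then Re (P (of_real y)) else 0)"
    by (auto simp: indicator_def)
  finally show ?thesis by measurable
qed

lemma analytic_density_gamma:
  assumes "0 < a" "0 < b" "0 < c"
  shows "\<exists>G. analytic_density a G (scaled_gamma a b c)"
proof -
  define K where "K = b powr a / Gamma a / c powr a"
  define G where "G z = of_real K * (z powr of_real (a - 1) * exp (- of_real (b / c) * z))" for z :: complex
  have K: "0 \<le> K" using assms Gamma_real_pos[of a] by (simp add: K_def)
  have nonpos: "z \<notin> \<real>\<^sub>\<le>\<^sub>0" if "0 < Re z" for z using that by (auto simp: complex_nonpos_Reals_iff)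
  have Gr: "G (of_real y) = of_real (K * (y powr (a - 1) * exp (- (b / c) * y)))" if "0 < y" for y
    using that by (simp add: G_def powr_of_real[symmetric] exp_of_real[symmetric])
  have "real_distribution (scaled_gamma a b c)"
    by (rule real_distribution_scaled_gamma[OF assms(1,2)])
  moreover have "G holomorphic_on right_half_plane"
    unfolding G_def using nonpos by (auto intro!: holomorphic_intros)
  moreover have "norm (G z) \<le> K * norm z powr (a - 1) * exp (- (b / c) * Re z)" if "0 < Re z" for z
  proof -
    have "norm (z powr of_real (a - 1)) = norm z powr (a - 1)"
      using norm_powr_real_powr'[of "of_real (a - 1)" z] by simp
    thus ?thesis using K by (simp add: G_def norm_mult)
  qed
  moreover have "scaled_gamma a b c =
      density lborel (half_line G)"
  proof -
    have "gamma_density a b (y / c) / \<bar>c\<bar> = (if 0 < y then Re (G (of_real y)) else 0)" for y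
    proof (cases "0 < y")
      case True
      have "(y / c) powr (a - 1) / c = y powr (a - 1) / c powr a"
        using assms True by (simp add: powr_divide powr_diff)
      moreover have "gamma_density a b (y / c) / \<bar>c\<bar> = b powr a / Gamma a * ((y / c) powr (a - 1) / c) * exp (- (b / c) * y)"
        using assms True by (simp add: gamma_density_def)
      ultimately show ?thesis using True by (simp add: Gr K_def)
    next
      case False
      thus ?thesis using assms by (cases "y = 0") (auto simp: gamma_density_def zero_le_divide_iff)
    qed
    thus ?thesis using scaled_gamma_density[of a c b] assms by simp
  qed
  ultimately have "analytic_density a G (scaled_gamma a b c)"
    unfolding analytic_density_def using K assms
    by (intro conjI exI[of _ K] exI[of _ "b / c"]) (auto simp: Gr)
  thus ?thesis by blast
qed

text \<open>Growth bounds multiply well: powers of the modulus add up, the exponentials recombine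
  since \<open>(1 - v) + v = 1\<close>, and what remains in \<open>v\<close> is the Beta kernel
  \<open>bt\<close>, integrable as \<open>A\<close> and \<open>B\<close> are positive. The factor
  \<open>z\<close> in \<open>K\<close> restores the exponent \<open>A + B - 1\<close>.\<close>

lemma analytic_density_convolution:
  assumes M: "analytic_density A G M" and N: "analytic_density B H N" and AB: "0 < A" "0 < B"
  shows "\<exists>K. analytic_density (A + B) K (M \<star> N)"
proof -
  obtain C1 m1 where C1: "0 \<le> C1" "0 < m1"
    "\<And>z. 0 < Re z \<Longrightarrow> norm (G z) \<le> C1 * norm z powr (A - 1) * exp (- m1 * Re z)"
    using M unfolding analytic_density_def by blast
  obtain C2 m2 where C2: "0 \<le> C2" "0 < m2"
    "\<And>z. 0 < Re z \<Longrightarrow> norm (H z) \<le> C2 * norm z powr (B - 1) * exp (- m2 * Re z)"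
    using N unfolding analytic_density_def by blast
  have hol: "G holomorphic_on right_half_plane" "H holomorphic_on right_half_plane"
    and re: "\<And>y. 0 < y \<Longrightarrow> Im (G (of_real y)) = 0 \<and> 0 \<le> Re (G (of_real y))"
       "\<And>y. 0 < y \<Longrightarrow> Im (H (of_real y)) = 0 \<and> 0 \<le> Re (H (of_real y))"
    and Md: "M = density lborel (half_line G)"
    and Nd: "N = density lborel (half_line H)"
    and rd: "real_distribution M" "real_distribution N"
    using M N unfolding analytic_density_def by auto
  define m where "m = min m1 m2"
  define bt where "bt v = indicator {0..1} v * (v powr (B - 1) * (1 - v) powr (A - 1))" for v :: real
  \<comment> \<open>The open interval keeps both arguments in the right half plane, the only region
    where \<open>G\<close> and \<open>H\<close> are controlled.\<close>
  define F where "F v z = indicator {0<..<1} v *\<^sub>R (G (z * of_real (1 - v)) * H (z * of_real v))" for v :: real and z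
  define K where "K z = z * (\<integral>v. F v z \<partial>lborel)" for z
  have m: "0 < m" using C1 C2 by (simp add: m_def)
  have bt: "integrable lborel bt"
    using integrable_Beta[of B A] AB unfolding set_integrable_def bt_def by simp
  have bt_nn: "0 \<le> bt v" for v by (simp add: bt_def)
  have Fle: "norm (F v z) \<le> (C1 * C2 * norm z powr (A + B - 2) * exp (- m * Re z)) * bt v"
    if z: "0 < Re z" for v z
  proof (cases "v \<in> {0<..<1}")
    case True
    hence v: "0 < v" "v < 1" by auto
    have z0: "0 < norm z" using z by auto
    have "norm (G (z * of_real (1 - v))) \<le> C1 * (norm z * (1 - v)) powr (A - 1) * exp (- m1 * (Re z * (1 - v)))"
      using C1(3)[of "z * of_real (1 - v)"] z v by (simp add: norm_mult del: of_real_diff)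
    also have "\<dots> \<le> C1 * (norm z * (1 - v)) powr (A - 1) * exp (- m * (Re z * (1 - v)))"
      using C1 z v by (intro mult_left_mono) (auto simp: m_def)
    finally have 1: "norm (G (z * of_real (1 - v))) \<le> C1 * (norm z * (1 - v)) powr (A - 1) * exp (- m * (Re z * (1 - v)))" .
    have "norm (H (z * of_real v)) \<le> C2 * (norm z * v) powr (B - 1) * exp (- m2 * (Re z * v))"
      using C2(3)[of "z * of_real v"] z v by (simp add: norm_mult)
    also have "\<dots> \<le> C2 * (norm z * v) powr (B - 1) * exp (- m * (Re z * v))"
      using C2 z v by (intro mult_left_mono) (auto simp: m_def)
    finally have 2: "norm (H (z * of_real v)) \<le> C2 * (norm z * v) powr (B - 1) * exp (- m * (Re z * v))" .
    have "norm (F v z) \<le> (C1 * (norm z * (1 - v)) powr (A - 1) * exp (- m * (Re z * (1 - v)))) *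
       (C2 * (norm z * v) powr (B - 1) * exp (- m * (Re z * v)))"
      unfolding F_def norm_scaleR norm_mult using True C1
      by (simp only: indicator_simps abs_one mult_1_left) (intro mult_mono 1 2 mult_nonneg_nonneg; simp)
    also have "\<dots> = C1 * C2 * (norm z powr (A - 1) * norm z powr (B - 1)) *
        (exp (- m * (Re z * (1 - v))) * exp (- m * (Re z * v))) * bt v"
      using v z0 by (simp add: bt_def powr_mult mult_ac)
    also have "norm z powr (A - 1) * norm z powr (B - 1) = norm z powr (A + B - 2)"
      by (simp add: powr_add[symmetric])
    also have "exp (- m * (Re z * (1 - v))) * exp (- m * (Re z * v)) = exp (- m * Re z)"
      by (simp add: exp_add[symmetric] algebra_simps)
    finally show ?thesis .
  next
    case False
    have "F v z = 0" using False by (simp add: F_def)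
    thus ?thesis using C1 C2 bt_nn[of v] by simp
  qed
  have Fmeas: "(\<lambda>v. F v z) \<in> borel_measurable lborel" if "0 < Re z" for z
  proof -
    have "continuous_on {0<..<1} (\<lambda>v. G (z * of_real (1 - v)) * H (z * of_real v))"
      by (intro continuous_on_mult continuous_on_compose2[OF holomorphic_on_imp_continuous_on[OF hol(1)]]
          continuous_on_compose2[OF holomorphic_on_imp_continuous_on[OF hol(2)]] continuous_intros)
        (use that in \<open>auto simp: mult_pos_pos simp del: of_real_diff\<close>)
    thus ?thesis unfolding F_def by (simp add: borel_measurable_continuous_on_indicator)
  qed
  have Fint: "integrable lborel (\<lambda>v. F v z)" if "0 < Re z" for z
  proof (rule Bochner_Integration.integrable_bound[OF _ Fmeas[OF that]])
    let ?c = "C1 * C2 * norm z powr (A + B - 2) * exp (- m * Re z)"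
    show "integrable lborel (\<lambda>v. ?c * bt v)" by (intro integrable_mult_right bt)
    show "AE v in lborel. norm (F v z) \<le> norm (?c * bt v)"
      using Fle[OF that] by (intro AE_I2) (simp only: real_norm_def, meson abs_ge_self order.trans)
  qed
  have K_hol: "K holomorphic_on right_half_plane"
    unfolding K_def
  proof (intro holomorphic_on_mult holomorphic_on_ident holomorphic_on_integral open_right_half_plane)
    fix v :: real
    show "F v holomorphic_on right_half_plane"
    proof (cases "v \<in> {0<..<1}")
      case True
      have "(\<lambda>z. G (z * of_real (1 - v))) holomorphic_on right_half_plane"
        "(\<lambda>z. H (z * of_real v)) holomorphic_on right_half_plane"
        using True
        by (auto intro!: holomorphic_on_compose_gen[OF _ hol(1), unfolded o_def]
            holomorphic_on_compose_gen[OF _ hol(2), unfolded o_def] holomorphic_intros simp del: of_real_diff)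
      thus ?thesis unfolding F_def using True by (auto intro!: holomorphic_intros)
    next
      case False
      hence "F v = (\<lambda>z. 0)" by (auto simp: F_def)
      thus ?thesis by simp
    qed
  next
    fix z assume z: "z \<in> right_half_plane"
    show "(\<lambda>v. F v z) \<in> borel_measurable lborel" using z by (intro Fmeas) simp
    define r where "r = Re z / 2"
    have r: "0 < r" "cball z r \<subseteq> right_half_plane"
      using z cball_right_half_plane[of z] by (auto simp: r_def)
    have "compact ((\<lambda>y. C1 * C2 * norm y powr (A + B - 2) * exp (- m * Re y)) ` cball z r)"
      using r by (intro compact_continuous_image continuous_intros) auto
    hence "bdd_above ((\<lambda>y. C1 * C2 * norm y powr (A + B - 2) * exp (- m * Re y)) ` cball z r)"
      by (intro bounded_imp_bdd_above compact_imp_bounded)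
    then obtain L where L: "\<And>y. y \<in> cball z r \<Longrightarrow> C1 * C2 * norm y powr (A + B - 2) * exp (- m * Re y) \<le> L"
      unfolding bdd_above_def by blast
    have "norm (F v y) \<le> L * bt v" if "y \<in> cball z r" for v y
      using r(2) that by (intro order.trans[OF Fle mult_right_mono[OF L bt_nn]]) auto
    thus "\<exists>r w. 0 < r \<and> cball z r \<subseteq> right_half_plane \<and> integrable lborel w \<and>
        (\<forall>v\<in>space lborel. \<forall>y\<in>cball z r. norm (F v y) \<le> w v)"
      using r bt by (intro exI[of _ r] exI[of _ "\<lambda>v. L * bt v"]) auto
  qed
  have K_bound: "norm (K z) \<le> (C1 * C2 * (\<integral>v. bt v \<partial>lborel)) * norm z powr (A + B - 1) * exp (- m * Re z)"
    if z: "0 < Re z" for z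
  proof -
    have z0: "0 < norm z" using z by auto
    have "norm (\<integral>v. F v z \<partial>lborel) \<le> (\<integral>v. (C1 * C2 * norm z powr (A + B - 2) * exp (- m * Re z)) * bt v \<partial>lborel)"
      by (rule Bochner_Integration.integral_norm_bound_integral[OF Fint[OF z] integrable_mult_right[OF bt] Fle[OF z]])
    also have "\<dots> = (C1 * C2 * norm z powr (A + B - 2) * exp (- m * Re z)) * (\<integral>v. bt v \<partial>lborel)" by simp
    finally have "norm (K z) \<le> norm z * ((C1 * C2 * norm z powr (A + B - 2) * exp (- m * Re z)) * (\<integral>v. bt v \<partial>lborel))"
      unfolding K_def norm_mult by (rule mult_left_mono) simp
    also have "\<dots> = (C1 * C2 * (\<integral>v. bt v \<partial>lborel)) * (norm z * norm z powr (A + B - 2)) * exp (- m * Re z)"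
      by (simp add: mult_ac)
    also have "norm z * norm z powr (A + B - 2) = norm z powr (A + B - 1)"
      using z0 powr_add[of "norm z" 1 "A + B - 2"] by simp
    finally show ?thesis .
  qed
  have F_real: "F v (of_real x) = of_real (indicator {0<..<1} v * (Re (G (of_real (x * (1 - v)))) * Re (H (of_real (x * v)))))"
    if x: "0 < x" for x v
  proof (cases "v \<in> {0<..<1}")
    case True
    have G: "G (of_real (x * (1 - v))) = of_real (Re (G (of_real (x * (1 - v)))))"
      and H: "H (of_real (x * v)) = of_real (Re (H (of_real (x * v))))"
      using re(1)[of "x * (1 - v)"] re(2)[of "x * v"] x True by (auto simp: complex_eq_iff)
    have "F v (of_real x) = G (of_real (x * (1 - v))) * H (of_real (x * v))"
      using True by (simp add: F_def)
    also have "\<dots> = of_real (Re (G (of_real (x * (1 - v)))) * Re (H (of_real (x * v))))"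
      unfolding of_real_mult[of "Re _"] by (rule arg_cong2[where f="(*)", OF G H])
    finally show ?thesis using True by simp
  qed (simp add: F_def)
  have F_nn: "0 \<le> Re (F v (of_real x))" if x: "0 < x" for x v
    using re(1)[of "x * (1 - v)"] re(2)[of "x * v"] x unfolding F_real[OF x]
    by (cases "v \<in> {0<..<1}") auto
  have K_real: "K (of_real x) = of_real (x * (\<integral>v. Re (F v (of_real x)) \<partial>lborel))" if x: "0 < x" for x
  proof -
    have "(\<integral>v. F v (of_real x) \<partial>lborel) = (\<integral>v. of_real (Re (F v (of_real x))) \<partial>lborel)"
      unfolding F_real[OF x] by simp
    thus ?thesis unfolding K_def by simp
  qed
  have dens: "(\<integral>\<^sup>+y. half_line G (x - y) *
        half_line H y \<partial>lborel) =
     half_line K x" for x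
  proof (cases "0 < x")
    case False
    have "(\<integral>\<^sup>+y. half_line G (x - y) *
        half_line H y \<partial>lborel) = (\<integral>\<^sup>+y. 0 \<partial>(lborel :: real measure))"
      using False by (intro nn_integral_cong) auto
    thus ?thesis using False by simp
  next
    case x: True
    let ?h = "\<lambda>y. half_line G (x - y) *
        half_line H y"
    have h: "?h (0 + x * v) = ennreal (Re (F v (of_real x)))" for v
    proof (cases "v \<in> {0<..<1}")
      case True
      hence "0 < x * (1 - v)" "0 < x * v" using x by auto
      moreover have "x - x * v = x * (1 - v)" by (simp add: algebra_simps)
      ultimately show ?thesis using True re(1)[of "x * (1 - v)"] re(2)[of "x * v"]
        unfolding F_real[OF x] by (simp add: ennreal_mult)
    next
      case False
      have "\<not> 0 < x * v \<or> \<not> 0 < x - x * v" using False x by (auto simp: zero_less_mult_iff not_less)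
      thus ?thesis using False unfolding F_real[OF x] by auto
    qed
    have "(\<lambda>y. x - y) \<in> borel_measurable borel" by measurable
    hence hm: "?h \<in> borel_measurable borel"
      by (intro borel_measurable_times_ennreal measurable_compose[OF _ measurable_half_line_density[OF hol(1)]]
          measurable_half_line_density[OF hol(2)])
    have "(\<integral>\<^sup>+y. ?h y \<partial>lborel) = ennreal x * (\<integral>\<^sup>+v. ennreal (Re (F v (of_real x))) \<partial>lborel)"
      using x nn_integral_real_affine[OF hm, of x 0] unfolding h by simp
    also have "(\<integral>\<^sup>+v. ennreal (Re (F v (of_real x))) \<partial>lborel) = ennreal (\<integral>v. Re (F v (of_real x)) \<partial>lborel)"
      using Fint[of "of_real x"] x F_nn[OF x] by (intro nn_integral_eq_integral) auto
    also have "ennreal x * \<dots> = ennreal (Re (K (of_real x)))"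
      using x unfolding K_real[OF x] by (simp add: ennreal_mult' )
    finally show ?thesis using x by simp
  qed
  have "M \<star> N = density lborel (half_line K)"
  proof -
    have fin: "finite_measure M" "finite_measure N"
      using rd by (auto simp: real_distribution_def prob_space_def)
    show ?thesis
      using convolution_density[OF measurable_half_line_density[OF hol(1)] measurable_half_line_density[OF hol(2)]] fin
      unfolding Md[symmetric] Nd[symmetric] dens by blast
  qed
  moreover have "0 \<le> Re (K (of_real y))" "Im (K (of_real y)) = 0" if "0 < y" for y
    using that unfolding K_real[OF that] by (auto intro!: mult_nonneg_nonneg integral_nonneg_AE F_nn)
  moreover have "0 \<le> C1 * C2 * (\<integral>v. bt v \<partial>lborel)"
    using C1 C2 bt_nn by (auto intro!: mult_nonneg_nonneg integral_nonneg_AE)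
  ultimately have "analytic_density (A + B) K (M \<star> N)"
    unfolding analytic_density_def using K_hol K_bound m real_distribution_convolution[OF rd] by blast
  thus ?thesis by blast
qed

lemma gsum_law_Suc:
  assumes "0 < b" "\<And>i. 0 < sh i"
  shows "gsum_law b (Suc n) sh c = (scaled_gamma (sh n) b (c n) \<star> gsum_law b n sh c)"
  using assms by (intro gsum_law_eqI)
    (auto intro!: real_distribution_convolution real_distribution_gsum_law real_distribution_scaled_gamma
      simp: char_convolution real_distribution_gsum_law real_distribution_scaled_gamma char_gsum_law char_scaled_gamma)

text \<open>A summand of weight 0 is a point mass without density, so the induction drops it; at
  least one nonzero weight must remain.\<close>

lemma analytic_density_gsum_law:
  assumes "0 < b" "\<And>i. 0 < sh i" "\<And>i. 0 \<le> c i" "\<exists>i<n. c i \<noteq> 0"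
  shows "\<exists>A G. 0 < A \<and> analytic_density A G (gsum_law b n sh c)"
  using assms(4)
proof (induction n)
  case (Suc n)
  let ?D = "scaled_gamma (sh n) b (c n)"
  have D: "\<exists>G. analytic_density (sh n) G ?D" if "c n \<noteq> 0"
    using assms that by (intro analytic_density_gamma) (auto simp: less_le)
  show ?case
  proof (cases "\<exists>i<n. c i \<noteq> 0")
    case True
    then obtain A G where AG: "0 < A" "analytic_density A G (gsum_law b n sh c)" using Suc.IH by blast
    show ?thesis
    proof (cases "c n = 0")
      case True
      hence "gsum_law b (Suc n) sh c = gsum_law b n sh c"
        using assms by (intro gsum_law_eqI real_distribution_gsum_law)
          (auto simp: char_gsum_law char_zero_gamma_M)
      thus ?thesis using AG by auto
    next
      case False
      then obtain H where "analytic_density (sh n) H ?D" using D by blast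
      from analytic_density_convolution[OF this AG(2) assms(2) AG(1)] show ?thesis
        unfolding gsum_law_Suc[of b sh, OF assms(1,2)] using AG(1) assms(2) by (blast intro: add_pos_pos)
    qed
  next
    case False
    hence cn: "c n \<noteq> 0" using Suc.prems less_Suc_eq by blast
    have "gsum_law b (Suc n) sh c = ?D"
      using assms False by (intro gsum_law_eqI real_distribution_scaled_gamma)
        (auto simp: char_scaled_gamma char_zero_gamma_M)
    thus ?thesis using D[OF cn] assms(2) by auto
  qed
qed simp

lemma powr_times_exp_bounded:
  fixes L m p :: real
  assumes "0 < m" "0 \<le> L" "0 \<le> p"
  shows "\<exists>K. \<forall>t\<ge>0. (t + L) powr p * exp (- m * t) \<le> K"
proof -
  have "((\<lambda>t. (t + L) powr p * exp (- m * t)) \<longlongrightarrow> 0) at_top"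
    using assms by real_asymp
  hence "eventually (\<lambda>t. (t + L) powr p * exp (- m * t) < 1) at_top"
    by (rule order_tendstoD) simp
  then obtain T where T: "\<And>t. t \<ge> T \<Longrightarrow> (t + L) powr p * exp (- m * t) < 1"
    by (auto simp: eventually_at_top_linorder)
  have "(t + L) powr p * exp (- m * t) \<le> max 1 ((\<bar>T\<bar> + L) powr p)" if "t \<ge> 0" for t
  proof (cases "t \<ge> T")
    case True
    thus ?thesis using T[OF True] by simp
  next
    case False
    have "(t + L) powr p * exp (- m * t) \<le> (\<bar>T\<bar> + L) powr p * 1"
      using False that assms by (intro mult_mono powr_mono2) auto
    thus ?thesis by simp
  qed
  thus ?thesis by blast
qed

text \<open>A law fixes its density only almost everywhere; continuity removes the exceptional null
  set.\<close>

lemma AE_zero_continuous: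
  fixes d :: "real \<Rightarrow> real"
  assumes "AE y in lborel. 0 < y \<longrightarrow> d y = 0" "\<And>y. 0 < y \<Longrightarrow> isCont d y" "0 < y"
  shows "d y = 0"
proof (rule ccontr)
  assume "d y \<noteq> 0"
  hence "eventually (\<lambda>u. d u \<noteq> 0 \<and> 0 < u) (nhds y)"
    using assms(2,3) by (intro eventually_conj) (auto simp: isCont_def tendsto_at_iff_tendsto_nhds
      intro!: tendsto_imp_eventually_ne eventually_nhds_in_open[of "{0<..}", simplified])
  then obtain e where e: "0 < e" "\<And>u. dist u y < e \<Longrightarrow> d u \<noteq> 0 \<and> 0 < u"
    unfolding eventually_nhds_metric by blast
  have "AE u in lborel. u \<notin> {y - e<..<y + e}"
    using assms(1)
  proof (rule eventually_mono, intro notI)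
    fix u assume u: "0 < u \<longrightarrow> d u = 0" "u \<in> {y - e<..<y + e}"
    have "dist u y < e" using u(2) by (simp add: dist_real_def abs_less_iff)
    from e(2)[OF this] u(1) show False by simp
  qed
  hence "emeasure lborel {y - e<..<y + e} = 0"
    by (subst (asm) AE_iff_measurable[OF _ refl]) (auto simp: greaterThanLessThan_def greaterThan_def lessThan_def Int_def)
  thus False using e by simp
qed

text \<open>The density at \<open>y\<close> is the average of \<open>G (y - x)\<close> over
  \<open>N\<close>. Since \<open>x \<le> 0\<close>, replacing \<open>y\<close> by a point of the
  right half plane keeps the argument in that half plane, so the average itself is the
  extension.\<close>

lemma holomorphic_extension_density:
  assumes M: "analytic_density A G M" and N: "real_distribution N" "AE x in N. x \<le> 0"
    and eq: "(N \<star> M) = density lborel (\<lambda>y. ennreal (f y))" and f: "\<And>y. 0 \<le> f y" "\<And>y. isCont f y"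
  shows "\<exists>F. F holomorphic_on right_half_plane \<and> (\<forall>y>0. F (of_real y) = of_real (f y))"
proof -
  interpret N: real_distribution N by fact
  obtain C m where C: "0 \<le> C" "0 < m"
    "\<And>z. 0 < Re z \<Longrightarrow> norm (G z) \<le> C * norm z powr (A - 1) * exp (- m * Re z)"
    using M unfolding analytic_density_def by blast
  have hol: "G holomorphic_on right_half_plane"
    and re: "\<And>y. 0 < y \<Longrightarrow> Im (G (of_real y)) = 0 \<and> 0 \<le> Re (G (of_real y))"
    and Md: "M = density lborel (half_line G)"
    and rd: "real_distribution M"
    using M unfolding analytic_density_def by auto
  define H where "H x z = indicator {..0} x *\<^sub>R G (z - of_real x)" for x :: real and z
  define F where "F z = (\<integral>x. H x z \<partial>N)" for z
  have bound: "\<exists>K. \<forall>x. \<forall>y\<in>cball z r. norm (H x y) \<le> K" if r: "0 < r" "r < Re z" for z r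
  proof -
    \<comment> \<open>The shift by \<open>x \<le> 0\<close> only moves points to the right: real
      parts stay above \<open>?d\<close> and imaginary parts within \<open>?L\<close>, uniformly in
      \<open>x\<close>. For \<open>1 \<le> A\<close> exponential decay beats the power; for
      \<open>A < 1\<close> the margin \<open>?d\<close> bounds it.\<close>
    let ?d = "Re z - r" and ?L = "norm z + r"
    obtain K where K: "\<And>t. 0 \<le> t \<Longrightarrow> (t + ?L) powr max 0 (A - 1) * exp (- m * t) \<le> K"
      using powr_times_exp_bounded[OF C(2), of ?L "max 0 (A - 1)"] r by auto
    have "norm (H x y) \<le> C * (max K (?d powr (A - 1)))" if y: "y \<in> cball z r" for x y
    proof (cases "x \<le> 0")
      case True
      let ?w = "y - of_real x"
      have "Re z - Re y \<le> r" "norm y \<le> ?L"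
        using y complex_Re_le_cmod[of "z - y"] norm_triangle_ineq2[of y z] by (simp_all add: dist_norm norm_minus_commute)
      hence w: "?d \<le> Re ?w" "\<bar>Im ?w\<bar> \<le> ?L" using True abs_Im_le_cmod[of y] by auto
      have w0: "0 < Re ?w" using w r by simp
      have nw: "norm ?w \<le> Re ?w + ?L" "Re ?w \<le> norm ?w"
        using cmod_le[of ?w] w w0 complex_Re_le_cmod[of ?w] by auto
      have "norm ?w powr (A - 1) * exp (- m * Re ?w) \<le> max K (?d powr (A - 1))"
      proof (cases "1 \<le> A")
        case True
        have "norm ?w powr (A - 1) * exp (- m * Re ?w) \<le> (Re ?w + ?L) powr (A - 1) * exp (- m * Re ?w)"
          using nw w0 True by (intro mult_right_mono powr_mono2) auto
        also have "\<dots> \<le> K" using K[of "Re ?w"] w0 True by (simp add: max_def)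
        finally show ?thesis by simp
      next
        case False
        have "norm ?w powr (A - 1) \<le> ?d powr (A - 1)"
          using False nw w r by (intro powr_mono2') auto
        moreover have "exp (- m * Re ?w) \<le> 1" using w0 C(2) by simp
        ultimately have "norm ?w powr (A - 1) * exp (- m * Re ?w) \<le> ?d powr (A - 1) * 1"
          by (intro mult_mono) auto
        thus ?thesis by simp
      qed
      thus ?thesis using C(3)[OF w0] mult_left_mono[OF _ C(1)] True
        by (simp add: H_def mult.assoc) (meson order.trans)
    next
      case False
      have "0 \<le> max K (?d powr (A - 1))" by (simp add: le_max_iff_disj)
      thus ?thesis using False C(1) by (simp add: H_def)
    qed
    thus ?thesis by blast
  qed
  have Hmeas: "(\<lambda>x. H x z) \<in> borel_measurable N" if "0 < Re z" for z
  proof -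
    have "continuous_on {..0} (\<lambda>x. G (z - of_real x))"
      by (intro continuous_on_compose2[OF holomorphic_on_imp_continuous_on[OF hol]] continuous_intros)
        (use that in auto)
    hence "(\<lambda>x. H x z) \<in> borel_measurable borel" unfolding H_def
      by (intro borel_measurable_continuous_on_indicator) auto
    thus ?thesis by (simp add: N.measurable_finite_borel)
  qed
  have half: "0 < Re z / 2" "Re z / 2 < Re z" "cball z (Re z / 2) \<subseteq> right_half_plane" if "0 < Re z" for z
    using that cball_right_half_plane by auto
  have Fhol: "F holomorphic_on right_half_plane"
    unfolding F_def
  proof (rule holomorphic_on_integral[OF open_right_half_plane])
    show "H x holomorphic_on right_half_plane" for x
    proof (cases "x \<le> 0")
      case True
      have "(\<lambda>z. G (z - of_real x)) holomorphic_on right_half_plane"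
        using True by (intro holomorphic_on_compose_gen[OF _ hol, unfolded o_def] holomorphic_intros) auto
      moreover have "H x = (\<lambda>z. G (z - of_real x))" using True by (auto simp: H_def)
      ultimately show ?thesis by simp
    next
      case False
      hence "H x = (\<lambda>z. 0)" by (auto simp: H_def)
      thus ?thesis by simp
    qed
    show "(\<lambda>x. H x z) \<in> borel_measurable N" if "z \<in> right_half_plane" for z
      using that by (intro Hmeas) simp
    fix z assume "z \<in> right_half_plane"
    hence z: "0 < Re z" by simp
    obtain K where "\<forall>x. \<forall>y\<in>cball z (Re z / 2). norm (H x y) \<le> K"
      using bound[OF half(1,2)[OF z]] by blast
    thus "\<exists>r w. 0 < r \<and> cball z r \<subseteq> right_half_plane \<and> integrable N w \<and>
        (\<forall>x\<in>space N. \<forall>y\<in>cball z r. norm (H x y) \<le> w x)"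
      using half[OF z] by (intro exI[of _ "Re z / 2"] exI[of _ "\<lambda>_. K"]) auto
  qed
  have H_real: "H x (of_real u) = of_real (indicator {..0} x * Re (G (of_real (u - x))))" if "0 < u" for x u
  proof (cases "x \<le> 0")
    case True
    hence "G (of_real (u - x)) = of_real (Re (G (of_real (u - x))))"
      using re[of "u - x"] that by (simp add: complex_eq_iff)
    thus ?thesis using True by (simp add: H_def)
  qed (simp add: H_def)
  have H_int: "integrable N (\<lambda>x. Re (H x (of_real u)))" if u: "0 < u" for u
  proof -
    obtain K where K: "\<forall>x. \<forall>y\<in>cball (of_real u) (u / 2). norm (H x y) \<le> K"
      using bound[of "u / 2" "of_real u"] u by auto
    have "\<bar>Re (H x (of_real u))\<bar> \<le> K" for x
      using K abs_Re_le_cmod[of "H x (of_real u)"] u by (metis centre_in_cball half_gt_zero less_imp_le order.trans)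
    thus ?thesis using Hmeas[of "of_real u"] u
      by (intro N.integrable_const_bound[where B=K]) auto
  qed
  have F_real: "F (of_real u) = of_real (\<integral>x. Re (H x (of_real u)) \<partial>N)" if u: "0 < u" for u
    unfolding F_def H_real[OF u] by (simp only: integral_complex_of_real Re_complex_of_real)
  have H_nn: "0 \<le> Re (H x (of_real u))" if u: "0 < u" for x u
    unfolding H_real[OF u] using re[of "u - x"] u by (cases "x \<le> 0") auto
  have dens: "(\<integral>\<^sup>+x. half_line G (u - x) \<partial>N) = ennreal (Re (F (of_real u)))"
    if u: "0 < u" for u
  proof -
    have "(\<integral>\<^sup>+x. half_line G (u - x) \<partial>N) = (\<integral>\<^sup>+x. ennreal (Re (H x (of_real u))) \<partial>N)"
      by (intro nn_integral_cong_AE eventually_mono[OF N(2)]) (use u in \<open>auto simp: H_real[OF u]\<close>)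
    also have "\<dots> = ennreal (Re (F (of_real u)))"
      unfolding F_real[OF u] using H_int[OF u] H_nn[OF u] by (simp add: nn_integral_eq_integral)
    finally show ?thesis .
  qed
  have [measurable]: "f \<in> borel_measurable borel"
    using f(2) by (intro borel_measurable_continuous_onI continuous_at_imp_continuous_on) auto
  have gm: "(half_line G) \<in> borel_measurable borel"
    by (rule measurable_half_line_density[OF hol])
  have "(N \<star> M) = density lborel (\<lambda>u. \<integral>\<^sup>+x. half_line G (u - x) \<partial>N)"
    using convolution_density_right[OF N(1) _ gm] rd unfolding Md[symmetric] by blast
  hence "density lborel (\<lambda>y. ennreal (f y)) = density lborel (\<lambda>u. \<integral>\<^sup>+x. half_line G (u - x) \<partial>N)"
    using eq by simp
  moreover have "(\<lambda>u. \<integral>\<^sup>+x. half_line G (u - x) \<partial>N) \<in> borel_measurable borel"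
  proof (rule N.borel_measurable_nn_integral)
    have "(\<lambda>p. fst p - snd p) \<in> borel_measurable (borel \<Otimes>\<^sub>M N)" by measurable
    from measurable_compose[OF this gm]
    show "(\<lambda>(u, x). half_line G (u - x)) \<in> borel_measurable (borel \<Otimes>\<^sub>M N)"
      by (simp only: case_prod_beta')
  qed
  ultimately have "AE u in lborel. ennreal (f u) = (\<integral>\<^sup>+x. half_line G (u - x) \<partial>N)"
    by (subst (asm) sigma_finite_measure.density_unique_iff[OF sigma_finite_lborel]) auto
  hence ae: "AE u in lborel. 0 < u \<longrightarrow> f u - Re (F (of_real u)) = 0"
  proof (rule eventually_mono, intro impI)
    fix u assume u: "ennreal (f u) = (\<integral>\<^sup>+x. half_line G (u - x) \<partial>N)" "0 < (u::real)"
    have "ennreal (f u) = ennreal (Re (F (of_real u)))"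
      using u(1) dens[OF u(2)] by (rule trans)
    moreover have "0 \<le> Re (F (of_real u))"
      unfolding F_real[OF u(2)] by (auto intro!: integral_nonneg_AE H_nn u)
    ultimately show "f u - Re (F (of_real u)) = 0" using f(1) by (simp add: ennreal_inj)
  qed
  have "f u = Re (F (of_real u))" if u: "0 < u" for u
  proof -
    have "isCont (\<lambda>u. f u - Re (F (of_real u))) u" if "0 < u" for u
    proof -
      have "isCont F (of_real u)"
        using holomorphic_on_imp_continuous_on[OF Fhol] open_right_half_plane that
        by (simp add: continuous_on_eq_continuous_at)
      hence "isCont (\<lambda>u. F (of_real u)) u" by (intro isCont_o2[where g=F and f=of_real]) auto
      thus ?thesis using f(2) by (intro continuous_diff continuous_Re) auto
    qed
    from AE_zero_continuous[OF ae this u] show ?thesis by simp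
  qed
  thus ?thesis using Fhol F_real by (intro exI[of _ F]) simp
qed

lemma gsum_law_nonpos:
  assumes "0 < b" "\<And>i. 0 < sh i" "\<And>i. c i \<le> 0"
  shows "AE x in gsum_law b n sh c. x \<le> 0"
proof -
  have "AE x in gamma_prod b n sh. \<forall>i\<in>{..<n}. 0 < x i"
    unfolding gamma_prod_def
    by (intro AE_finite_allI finite_lessThan AE_PiM_component prob_space_gamma_M assms AE_gamma_M_pos)
  hence "AE x in gamma_prod b n sh. (\<Sum>i<n. c i * x i) \<le> 0"
    by (rule eventually_mono) (intro sum_nonpos mult_nonpos_nonneg, auto simp: assms intro: less_imp_le)
  thus ?thesis unfolding gsum_law_def by (subst AE_distr_iff) auto
qed

text \<open>The weights are split into positive and negative parts, the latter playing the
  nonpositive variable. Without positive weights the law lives on the nonpositive axis, so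
  \<open>f\<close> is 0 on the positive one and so is the extension.\<close>

theorem gsum_law_holomorphic_extension:
  assumes b: "0 < b" "\<And>i. 0 < sh i"
    and eq: "gsum_law b n sh c = density lborel (\<lambda>y. ennreal (f y))"
    and f: "\<And>y. 0 \<le> f y" "\<And>y. isCont f y"
  shows "\<exists>F. F holomorphic_on right_half_plane \<and> (\<forall>y>0. F (of_real y) = of_real (f y))"
proof (cases "\<exists>i<n. max 0 (c i) \<noteq> 0")
  case True
  let ?N = "gsum_law b n sh (\<lambda>i. min 0 (c i))" and ?P = "gsum_law b n sh (\<lambda>i. max 0 (c i))"
  have "gsum_law b n sh c = (?N \<star> ?P)"
  proof (rule gsum_law_eqI[OF b])
    show "real_distribution (?N \<star> ?P)" by (intro real_distribution_convolution real_distribution_gsum_law b)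
    fix s
    have "char (gamma_M (sh i) b) (c i * s) =
        char (gamma_M (sh i) b) (min 0 (c i) * s) * char (gamma_M (sh i) b) (max 0 (c i) * s)" for i
      by (cases "c i \<le> 0") (simp_all add: char_zero_gamma_M b)
    thus "(\<Prod>i<n. char (gamma_M (sh i) b) (c i * s)) = char (?N \<star> ?P) s"
      by (simp add: char_convolution real_distribution_gsum_law b char_gsum_law prod.distrib)
  qed
  moreover obtain A G where "analytic_density A G ?P"
    using analytic_density_gsum_law[of b sh "\<lambda>i. max 0 (c i)" n] b True by auto
  moreover have "AE x in ?N. x \<le> 0" by (intro gsum_law_nonpos b) auto
  ultimately show ?thesis
    using holomorphic_extension_density[of A G ?P ?N f] real_distribution_gsum_law[OF b] eq f by simp
next
  case False
  have eq': "gsum_law b n sh c = gsum_law b n sh (\<lambda>i. min 0 (c i))"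
    using False b by (intro gsum_law_eqI real_distribution_gsum_law)
      (auto simp: char_gsum_law intro!: prod.cong arg_cong[where f="char _"] simp: max_def min_def split: if_splits)
  hence "AE x in density lborel (\<lambda>y. ennreal (f y)). x \<le> 0"
    unfolding eq[symmetric] eq' by (intro gsum_law_nonpos b) simp
  moreover have [measurable]: "f \<in> borel_measurable borel"
    using f(2) by (intro borel_measurable_continuous_onI continuous_at_imp_continuous_on) auto
  ultimately have "AE y in lborel. 0 < ennreal (f y) \<longrightarrow> y \<le> 0"
    by (subst (asm) AE_density) auto
  hence "AE y in lborel. 0 < y \<longrightarrow> f y = 0"
    by (rule eventually_mono) (use f(1) in \<open>force simp: less_le\<close>)
  hence "f y = 0" if "0 < y" for y
    using AE_zero_continuous[of f y] f(2) that by blast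
  thus ?thesis by (intro exI[of _ "\<lambda>_. 0"]) auto
qed

section \<open>Convexity beyond the inflection points\<close>

text \<open>Inflection points are defined with closed intervals sharing an endpoint, whereas
  monotonicity is known only inside. The mean value theorem bridges this, as its intermediate points
  are interior.\<close>

lemma strictly_convex_onI:
  assumes d: "\<And>y. (f has_real_derivative f' y) (at y)"
    and mono: "\<And>x y. a < x \<Longrightarrow> x < y \<Longrightarrow> y < b \<Longrightarrow> f' x < f' y"
  shows "strictly_convex_on {a..b} f"
  unfolding strictly_convex_on_def
proof (intro ballI impI allI)
  have main: "f (u * x + (1 - u) * y) < u * f x + (1 - u) * f y"
    if "x \<in> {a..b}" "y \<in> {a..b}" "x < y" "0 < u \<and> u < 1" for x y u
  proof -
    define z where "z = u * x + (1 - u) * y"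
    have zx: "z - x = (1 - u) * (y - x)" and yz: "y - z = u * (y - x)" by (simp_all add: z_def algebra_simps)
    have z: "x < z" "z < y" using zx yz that by (smt (verit) mult_pos_pos)+
    obtain p where p: "x < p" "p < z" "f z - f x = (z - x) * f' p"
      using MVT2[OF z(1), of f f'] d by blast
    obtain q where q: "z < q" "q < y" "f y - f z = (y - z) * f' q"
      using MVT2[OF z(2), of f f'] d by blast
    have "f' p < f' q" using p q that by (intro mono) auto
    have "u * f x + (1 - u) * f y - f z = (1 - u) * (f y - f z) - u * (f z - f x)" by (simp add: algebra_simps)
    also have "\<dots> = u * (1 - u) * (y - x) * (f' q - f' p)"
      unfolding p(3) q(3) zx yz by (simp add: algebra_simps)
    also have "\<dots> > 0" using that \<open>f' p < f' q\<close> by simp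
    finally show ?thesis by (simp add: z_def)
  qed
  fix x y u assume *: "x \<in> {a..b}" "y \<in> {a..b}" "x \<noteq> y" "0 < u \<and> u < (1::real)"
  show "f (u * x + (1 - u) * y) < u * f x + (1 - u) * f y"
  proof (cases "x < y")
    case False
    thus ?thesis using main[of y x "1 - u"] * by (simp add: add.commute)
  qed (use main * in blast)
qed

lemma strictly_concave_onI:
  assumes d: "\<And>y. (f has_real_derivative f' y) (at y)"
    and mono: "\<And>x y. a < x \<Longrightarrow> x < y \<Longrightarrow> y < b \<Longrightarrow> f' y < f' x"
  shows "strictly_concave_on {a..b} f"
  unfolding strictly_concave_on_def
  by (rule strictly_convex_onI[where f' = "\<lambda>y. - f' y"]) (use mono in \<open>auto intro!: derivative_intros d\<close>)

text \<open>\<open>\<sigma>\<close> selects the orientation, 1 being convex before concave. Only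
  monotonicity of \<open>f'\<close> on either side enters, so this also applies at a point without
  second derivative.\<close>

lemma inflection_pointI:
  fixes \<sigma> :: real
  assumes d: "\<And>y. (f has_real_derivative f' y) (at y)" and \<sigma>: "\<sigma> = 1 \<or> \<sigma> = - 1" and e: "0 < e"
    and left: "\<And>s t. y - e < s \<Longrightarrow> s < t \<Longrightarrow> t < y \<Longrightarrow> \<sigma> * f' s < \<sigma> * f' t"
    and right: "\<And>s t. y < s \<Longrightarrow> s < t \<Longrightarrow> t < y + e \<Longrightarrow> \<sigma> * f' t < \<sigma> * f' s"
  shows "inflection_point f y"
  using \<sigma>
proof
  assume "\<sigma> = 1"
  hence "strictly_convex_on {y - e..y} f \<and> strictly_concave_on {y..y + e} f"
    using left right by (intro conjI strictly_convex_onI[OF d] strictly_concave_onI[OF d]) auto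
  thus ?thesis using e by (auto simp: inflection_point_def)
next
  assume "\<sigma> = - 1"
  hence "strictly_concave_on {y - e..y} f \<and> strictly_convex_on {y..y + e} f"
    using left right by (intro conjI strictly_convex_onI[OF d] strictly_concave_onI[OF d]) auto
  thus ?thesis using e by (auto simp: inflection_point_def)
qed

lemma has_real_derivative_of_holomorphic:
  assumes "F holomorphic_on S" "open S" "open I" "of_real ` I \<subseteq> S"
    and eq: "\<And>y. y \<in> I \<Longrightarrow> F (of_real y) = of_real (f y)" and y: "y \<in> I"
  shows "(f has_real_derivative Re (deriv F (of_real y))) (at y)"
    and "deriv F (of_real y) = of_real (Re (deriv F (of_real y)))"
proof -
  let ?D = "deriv F (of_real y)"
  have "(F has_field_derivative ?D) (at (of_real y))"
    using assms by (intro holomorphic_derivI[of F S]) auto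
  hence "((\<lambda>x. F (of_real x)) has_vector_derivative ?D) (at y)"
    by (rule has_vector_derivative_real_field)
  hence "((\<lambda>x. of_real (f x) :: complex) has_vector_derivative ?D) (at y)"
    by (rule has_vector_derivative_transform_within_open[OF _ assms(3) y]) (simp add: eq)
  hence *: "(f has_real_derivative Re ?D) (at y)" "((\<lambda>x. 0) has_real_derivative Im ?D) (at y)"
    unfolding has_vector_derivative_complex_iff by simp_all
  show "(f has_real_derivative Re ?D) (at y)" by fact
  have "Im ?D = 0" using DERIV_unique[OF *(2) DERIV_const] .
  thus "?D = of_real (Re ?D)" by (simp add: complex_eq_iff)
qed

lemma constant_sign_on_connected:
  fixes g :: "real \<Rightarrow> real"
  assumes "continuous_on S g" "connected S" "\<And>y. y \<in> S \<Longrightarrow> g y \<noteq> 0"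
  shows "(\<forall>y\<in>S. 0 < g y) \<or> (\<forall>y\<in>S. g y < 0)"
proof (rule ccontr)
  assume "\<not> ?thesis"
  then obtain x y where "x \<in> S" "y \<in> S" "g x < 0" "0 < g y" using assms(3) by (meson linorder_neqE)
  moreover have "connected (g ` S)" by (rule connected_continuous_image) fact+
  ultimately have "0 \<in> g ` S" using connectedD_interval[of "g ` S" "g x" "g y" 0] by simp
  thus False using assms(3) by auto
qed

text \<open>Real analyticity makes the zeros of \<open>f''\<close> isolated, so without inflection points the sign of
  \<open>f''\<close> is locally constant away from them.\<close>

lemma deriv_trichotomy:
  assumes F: "F holomorphic_on S" and S: "S = {z. Re z \<in> I}"
    and I: "open I" "connected I"
    and eq: "\<And>y. y \<in> I \<Longrightarrow> F (of_real y) = of_real (f y)"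
    and d: "\<And>y. (f has_real_derivative f' y) (at y)"
    and ni: "\<And>y. y \<in> I \<Longrightarrow> \<not> inflection_point f y"
  shows "(\<forall>x\<in>I. \<forall>y\<in>I. x < y \<longrightarrow> f' x < f' y) \<or> (\<forall>x\<in>I. \<forall>y\<in>I. x < y \<longrightarrow> f' y < f' x)
     \<or> (\<forall>x\<in>I. \<forall>y\<in>I. f' x = f' y)"
proof -
  have convI: "convex I" using I(2) is_interval_connected_1 is_interval_convex by blast
  have openS: "open S"
  proof -
    have "S = Re -` I" by (auto simp: S)
    thus ?thesis using open_vimage[OF I(1), of Re] by (simp add: continuous_on_Re continuous_on_id)
  qed
  have "convex S"
  proof -
    have "S = Re -` I" by (auto simp: S)
    moreover have "convex (Re -` I)" by (rule convex_linear_vimage[OF _ convI]) (simp add: bounded_linear.linear bounded_linear_Re)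
    ultimately show ?thesis by simp
  qed
  hence connS: "connected S" by (rule convex_connected)
  have IS: "of_real ` I \<subseteq> S" by (auto simp: S)
  define h where "h = deriv (deriv F)"
  define f2 where "f2 y = Re (h (of_real y))" for y :: real
  have h_hol: "h holomorphic_on S" unfolding h_def by (intro holomorphic_deriv F openS)
  have f'_eq: "f' y = Re (deriv F (of_real y))" if "y \<in> I" for y
    using DERIV_unique[OF d has_real_derivative_of_holomorphic(1)[OF F openS I(1) IS eq that]] by simp
  have dF: "deriv F (of_real y) = of_real (f' y)" if "y \<in> I" for y
    using has_real_derivative_of_holomorphic(2)[OF F openS I(1) IS eq that] f'_eq[OF that] by simp
  have d2: "(f' has_real_derivative f2 y) (at y)" and h_real: "h (of_real y) = of_real (f2 y)" if "y \<in> I" for y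
    using has_real_derivative_of_holomorphic[OF holomorphic_deriv[OF F openS] openS I(1) IS dF that]
    by (simp_all add: h_def f2_def)
  have f2_cont: "continuous_on I f2"
    unfolding f2_def
    by (intro continuous_on_Re continuous_on_compose2[OF holomorphic_on_imp_continuous_on[OF h_hol]] continuous_intros IS)
  show ?thesis
  proof (cases "\<forall>y\<in>I. f2 y = 0")
    case True
    have "f' x = f' y" if "x \<in> I" "y \<in> I" for x y
      using has_field_derivative_zero_constant[OF convI, of f'] d2 True that
      by (metis has_field_derivative_at_within)
    thus ?thesis by blast
  next
    case False
    then obtain y0 where y0: "y0 \<in> I" "f2 y0 \<noteq> 0" by blast
    \<comment> \<open>Identity theorem: zeros of \<open>h\<close> accumulating at \<open>y\<close>
      would force \<open>h\<close> to vanish on the connected set \<open>S\<close>, against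
      \<open>y0\<close>.\<close>
    have nolim: "\<not> of_real y islimpt Z" if "y \<in> I" "Z \<subseteq> S" "\<And>z. z \<in> Z \<Longrightarrow> h z = 0" for y Z
      using analytic_continuation[OF h_hol openS connS that(2) _ _ that(3), of "of_real y" "of_real y0"] that(1) y0 IS h_real[OF y0(1)]
      by auto
    have isolated: "\<exists>e>0. {y - e<..<y + e} \<subseteq> I \<and> (\<forall>t. 0 < \<bar>t - y\<bar> \<and> \<bar>t - y\<bar> < e \<longrightarrow> f2 t \<noteq> 0)" if y: "y \<in> I" for y
    proof -
      obtain e1 where e1: "0 < e1" "ball y e1 \<subseteq> I" using I(1) y open_contains_ball by blast
      have "\<not> of_real y islimpt {z\<in>S. h z = 0}" using y by (intro nolim) auto
      then obtain e2 where e2: "0 < e2" "\<And>z. z \<in> S \<Longrightarrow> h z = 0 \<Longrightarrow> z \<noteq> of_real y \<Longrightarrow> e2 \<le> dist z (of_real y)"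
        unfolding islimpt_approachable by force
      show ?thesis
      proof (intro exI[of _ "min e1 e2"] conjI allI impI)
        show "{y - min e1 e2<..<y + min e1 e2} \<subseteq> I"
        proof
          fix t assume "t \<in> {y - min e1 e2<..<y + min e1 e2}"
          hence "t \<in> ball y e1" by (auto simp: dist_real_def abs_less_iff min_def split: if_splits)
          thus "t \<in> I" using e1(2) by blast
        qed
        fix t assume t: "0 < \<bar>t - y\<bar> \<and> \<bar>t - y\<bar> < min e1 e2"
        hence "t \<in> ball y e1" by (simp add: dist_real_def abs_minus_commute)
        hence "t \<in> I" using e1(2) by blast
        hence "of_real t \<in> S" "h (of_real t) = of_real (f2 t)" using IS h_real by auto
        moreover have "dist (of_real t :: complex) (of_real y) = \<bar>t - y\<bar>"
          by (simp add: dist_norm of_real_diff[symmetric] del: of_real_diff)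
        ultimately show "f2 t \<noteq> 0" using t e2(2)[of "of_real t"] by auto
      qed (use e1 e2 in auto)
    qed
    \<comment> \<open>The sign of \<open>f2\<close> on a punctured neighbourhood; \<open>y\<close>
      itself may be a zero at which the sign does not change.\<close>
    define one where "one \<sigma> y \<longleftrightarrow> (\<exists>e>0. {y - e<..<y + e} \<subseteq> I \<and>
        (\<forall>t. 0 < \<bar>t - y\<bar> \<and> \<bar>t - y\<bar> < e \<longrightarrow> 0 < \<sigma> * f2 t))" for \<sigma> y
    have ex: "one 1 y \<or> one (- 1) y" if y: "y \<in> I" for y
    proof -
      obtain e where e: "0 < e" "{y - e<..<y + e} \<subseteq> I" "\<And>t. 0 < \<bar>t - y\<bar> \<Longrightarrow> \<bar>t - y\<bar> < e \<Longrightarrow> f2 t \<noteq> 0"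
        using isolated[OF y] by blast
      have sub: "{y - e<..<y} \<subseteq> I" "{y<..<y + e} \<subseteq> I" using e(1,2) by (auto simp: subset_iff)
      have L: "(\<forall>t\<in>{y - e<..<y}. 0 < f2 t) \<or> (\<forall>t\<in>{y - e<..<y}. f2 t < 0)"
        by (rule constant_sign_on_connected) (use e(3) sub in \<open>auto intro!: continuous_on_subset[OF f2_cont]\<close>)
      have R: "(\<forall>t\<in>{y<..<y + e}. 0 < f2 t) \<or> (\<forall>t\<in>{y<..<y + e}. f2 t < 0)"
        by (rule constant_sign_on_connected) (use e(3) sub in \<open>auto intro!: continuous_on_subset[OF f2_cont]\<close>)
      have inc: "\<sigma> * f' s < \<sigma> * f' t" if "p < s" "s < t" "t < q" "{p<..<q} \<subseteq> I" "\<forall>t\<in>{p<..<q}. 0 < \<sigma> * f2 t"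
        for p q s t \<sigma>
      proof (rule DERIV_pos_imp_increasing[OF that(2)])
        fix x assume "s \<le> x" "x \<le> t"
        hence "x \<in> {p<..<q}" using that by auto
        thus "\<exists>y. ((\<lambda>y. \<sigma> * f' y) has_real_derivative y) (at x) \<and> 0 < y"
          using DERIV_cmult[OF d2[of x], of \<sigma>] that(4,5) by blast
      qed
      \<comment> \<open>Opposite signs on the two sides would make \<open>y\<close> an inflection
        point.\<close>
      have False if \<sigma>: "\<sigma> = 1 \<or> \<sigma> = - 1" and l: "\<forall>t\<in>{y - e<..<y}. 0 < \<sigma> * f2 t" and r: "\<forall>t\<in>{y<..<y + e}. 0 < - \<sigma> * f2 t"
        for \<sigma> :: real
        using ni[OF y] inflection_pointI[OF d \<sigma> e(1)] inc[OF _ _ _ sub(1) l] inc[OF _ _ _ sub(2) r] by force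
      from this[of 1] this[of "- 1"] L R
      have "(\<forall>t\<in>{y - e<..<y} \<union> {y<..<y + e}. 0 < f2 t) \<or> (\<forall>t\<in>{y - e<..<y} \<union> {y<..<y + e}. f2 t < 0)"
        by auto
      moreover have "t \<in> {y - e<..<y} \<union> {y<..<y + e}" if "0 < \<bar>t - y\<bar>" "\<bar>t - y\<bar> < e" for t
        using that by auto
      ultimately show ?thesis unfolding one_def using e(1,2) by fastforce
    qed
    have open_one: "open {y. one \<sigma> y}" for \<sigma>
      unfolding open_dist
    proof
      fix y assume "y \<in> {y. one \<sigma> y}"
      then obtain e where e: "0 < e" "{y - e<..<y + e} \<subseteq> I" "\<And>t. 0 < \<bar>t - y\<bar> \<Longrightarrow> \<bar>t - y\<bar> < e \<Longrightarrow> 0 < \<sigma> * f2 t"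
        and y: "one \<sigma> y" unfolding one_def by blast
      have "one \<sigma> u" if u: "\<bar>u - y\<bar> < e" for u
      proof (cases "u = y")
        case False
        \<comment> \<open>This radius keeps the neighbourhood of \<open>u\<close> inside that of
          \<open>y\<close> and away from \<open>y\<close>, where \<open>f2\<close> might
          vanish.\<close>
        define r where "r = min \<bar>u - y\<bar> (e - \<bar>u - y\<bar>)"
        have "0 < r" using False u by (simp add: r_def)
        moreover have "{u - r<..<u + r} \<subseteq> I"
          using e(2) by (rule order.trans[rotated]) (auto simp: r_def abs_if split: if_splits)
        moreover have "0 < \<sigma> * f2 t" if "\<bar>t - u\<bar> < r" for t
          using that False by (intro e(3)) (auto simp: r_def abs_if split: if_splits)
        ultimately show ?thesis unfolding one_def by blast
      qed (use y in simp)
      thus "\<exists>e>0. \<forall>u. dist u y < e \<longrightarrow> u \<in> {y. one \<sigma> y}" using e(1) by (auto simp: dist_real_def)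
    qed
    have disj: "\<not> (one 1 y \<and> one (- 1) y)" for y
    proof
      assume "one 1 y \<and> one (- 1) y"
      then obtain e1 e2 where e: "0 < e1" "\<And>t. 0 < \<bar>t - y\<bar> \<and> \<bar>t - y\<bar> < e1 \<Longrightarrow> 0 < f2 t"
         "0 < e2" "\<And>t. 0 < \<bar>t - y\<bar> \<and> \<bar>t - y\<bar> < e2 \<Longrightarrow> f2 t < 0" unfolding one_def by force
      define t where "t = y + min e1 e2 / 2"
      have "0 < \<bar>t - y\<bar>" "\<bar>t - y\<bar> < e1" "\<bar>t - y\<bar> < e2" using e(1,3) by (auto simp: t_def min_def)
      thus False using e(2)[of t] e(4)[of t] by simp
    qed
    \<comment> \<open>The two sign classes are open, disjoint and cover the connected set
      \<open>I\<close>, so one of them is empty.\<close>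
    have "{y. one 1 y} \<inter> I = {} \<or> {y. one (- 1) y} \<inter> I = {}"
      using ex disj by (intro connectedD[OF I(2) open_one open_one]) auto
    hence "(\<forall>y\<in>I. one 1 y) \<or> (\<forall>y\<in>I. one (- 1) y)" using ex by blast
    then obtain \<sigma> :: real where \<sigma>: "\<sigma> = 1 \<or> \<sigma> = - 1" and all: "\<And>y. y \<in> I \<Longrightarrow> one \<sigma> y" by blast
    have seg: "x \<le> t \<Longrightarrow> t \<le> y \<Longrightarrow> t \<in> I" if "x \<in> I" "y \<in> I" for x y t
      using connectedD_interval[OF I(2) that] by blast
    have nn: "0 \<le> \<sigma> * f2 y" if y: "y \<in> I" for y
    proof (rule ccontr)
      assume neg: "\<not> 0 \<le> \<sigma> * f2 y"
      have "isCont (\<lambda>y. \<sigma> * f2 y) y"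
        using f2_cont I(1) y by (intro continuous_intros) (simp add: continuous_on_eq_continuous_at)
      then obtain s where s: "0 < s" "\<And>t. \<bar>t - y\<bar> < s \<Longrightarrow> \<bar>\<sigma> * f2 t - \<sigma> * f2 y\<bar> < - (\<sigma> * f2 y)"
        using neg unfolding continuous_at_eps_delta dist_real_def by (metis neg_0_less_iff_less not_le)
      obtain e where e: "0 < e" "\<And>t. 0 < \<bar>t - y\<bar> \<and> \<bar>t - y\<bar> < e \<Longrightarrow> 0 < \<sigma> * f2 t"
        using all[OF y] unfolding one_def by blast
      define t where "t = y + min e s / 2"
      have "0 < \<bar>t - y\<bar>" "\<bar>t - y\<bar> < e" "\<bar>t - y\<bar> < s" using e(1) s(1) by (auto simp: t_def min_def)
      thus False using e(2)[of t] s(2)[of t] by (simp add: abs_less_iff)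
    qed
    have mono: "\<sigma> * f' x \<le> \<sigma> * f' y" if "x \<in> I" "y \<in> I" "x \<le> y" for x y
      using DERIV_nonneg_imp_nondecreasing[OF that(3), of "\<lambda>y. \<sigma> * f' y"] DERIV_cmult[OF d2, of _ \<sigma>] nn seg[OF that(1,2)]
      by blast
    \<comment> \<open>Strictness: equality at two points makes \<open>f'\<close> constant between
      them, so \<open>f2\<close> vanishes on an interval, against isolated zeros.\<close>
    have "\<sigma> * f' x < \<sigma> * f' y" if xy: "x \<in> I" "y \<in> I" "x < y" for x y
    proof (rule ccontr)
      assume "\<not> \<sigma> * f' x < \<sigma> * f' y"
      hence le: "\<sigma> * f' y \<le> \<sigma> * f' x" by simp
      have c: "f' t = f' x" if "x \<le> t" "t \<le> y" for t
      proof -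
        have "\<sigma> * f' t = \<sigma> * f' x"
          using mono[of x t] mono[of t y] seg[OF xy(1,2) that] that xy le by linarith
        moreover have "\<sigma> \<noteq> 0" using \<sigma> by auto
        ultimately show ?thesis by simp
      qed
      have zero: "\<sigma> * f2 t = 0" if t: "t \<in> {x<..<y}" for t
      proof -
        have tI: "t \<in> I" using t by (intro seg[OF xy(1,2)]) auto
        have "((\<lambda>_. \<sigma> * f' x) has_real_derivative \<sigma> * f2 t) (at t)"
          by (rule DERIV_cong_ev[OF refl _ refl, THEN iffD1, OF _ DERIV_cmult[OF d2[OF tI]]])
            (use t in \<open>auto intro!: c eventually_mono[OF eventually_nhds_in_open[of "{x<..<y}"]]\<close>)
        thus ?thesis using DERIV_unique[OF _ DERIV_const] by blast
      qed
      let ?m = "(x + y) / 2"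
      have m: "?m \<in> I" "?m \<in> {x<..<y}" using seg[OF xy(1,2), of ?m] xy(3) by auto
      obtain e where e: "0 < e" "\<And>t. 0 < \<bar>t - ?m\<bar> \<Longrightarrow> \<bar>t - ?m\<bar> < e \<Longrightarrow> f2 t \<noteq> 0"
        using isolated[OF m(1)] by blast
      have "\<sigma> * f2 (?m + min e (y - x) / 4) = 0" using m e(1) by (intro zero) (auto simp: min_def field_simps)
      moreover have "f2 (?m + min e (y - x) / 4) \<noteq> 0" using e(1) xy(3) by (intro e(2)) (auto simp: min_def)
      ultimately show False using \<sigma> by auto
    qed
    thus ?thesis using \<sigma> by auto
  qed
qed

text \<open>A nonnegative function concave on a half line cannot have a negative slope there, since
  its tangent would force it below 0; so it is nondecreasing, and the limit 0 leaves only the value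
  0.\<close>

lemma zero_of_deriv_antimono:
  fixes f f' :: "real \<Rightarrow> real"
  assumes d: "\<And>y. (f has_real_derivative f' y) (at y)" and nn: "\<And>y. 0 \<le> f y"
    and lim: "(f \<longlongrightarrow> 0) at_top"
    and dec: "\<And>x y. u < x \<Longrightarrow> x < y \<Longrightarrow> f' y \<le> f' x" and y: "u < y"
  shows "f y = 0"
proof -
  have f'nn: "0 \<le> f' x" if x: "u < x" for x
  proof (rule ccontr)
    assume neg: "\<not> 0 \<le> f' x"
    \<comment> \<open>At this \<open>t\<close> the tangent line at \<open>x\<close> has reached the
      value -1.\<close>
    define t where "t = x + (f x + 1) / (- f' x)"
    have "0 < (f x + 1) / (- f' x)" using neg nn[of x] by (intro divide_pos_pos) auto
    hence t: "x < t" by (simp add: t_def)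
    obtain z where z: "x < z" "f t - f x = (t - x) * f' z" using MVT2[OF t, of f f'] d by blast
    have "(t - x) * f' z \<le> (t - x) * f' x" using dec[OF x z(1)] t by simp
    also have "\<dots> = - (f x + 1)" using neg by (simp add: t_def)
    finally show False using z(2) nn[of t] by simp
  qed
  have mono: "f y \<le> f t" if "y \<le> t" for t
    using DERIV_nonneg_imp_nondecreasing[OF that, of f] d f'nn y by (meson less_le_trans)
  have "f y \<le> 0"
    by (rule tendsto_lowerbound[OF lim]) (auto simp: eventually_at_top_linorder intro!: exI[of _ y] mono)
  thus ?thesis using nn[of y] by simp
qed

text \<open>\<open>s\<close> is the point where analyticity may be lost. The trichotomy is applied
  on each side of it; to the right a decreasing or constant \<open>f'\<close> leaves only
  \<open>f = 0\<close>. Continuity of \<open>f'\<close> glues the two sides.\<close>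

theorem deriv_mono_beyond_inflection_points:
  fixes f f' :: "real \<Rightarrow> real"
  assumes d: "\<And>y. (f has_real_derivative f' y) (at y)" and f'c: "\<And>y. isCont f' y"
    and nn: "\<And>y. 0 \<le> f y" and lim: "(f \<longlongrightarrow> 0) at_top"
    and F: "F holomorphic_on {z. s < Re z}" "\<And>y. s < y \<Longrightarrow> F (of_real y) = of_real (f y)"
    and G: "G holomorphic_on {z. Re z < s}" "\<And>y. y < s \<Longrightarrow> G (of_real y) = of_real (f y)"
    and ni: "\<And>y. M < y \<Longrightarrow> \<not> inflection_point f y"
    and xy: "M < x" "x \<le> y"
  shows "f' x \<le> f' y"
proof -
  let ?u = "max M s"
  have "(\<forall>x\<in>{?u<..}. \<forall>y\<in>{?u<..}. x < y \<longrightarrow> f' x < f' y) \<or> (\<forall>x\<in>{?u<..}. \<forall>y\<in>{?u<..}. x < y \<longrightarrow> f' y < f' x)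
     \<or> (\<forall>x\<in>{?u<..}. \<forall>y\<in>{?u<..}. f' x = f' y)"
    by (rule deriv_trichotomy[OF holomorphic_on_subset[OF F(1)] refl]) (use F d ni in auto)
  hence R: "(\<forall>x>?u. \<forall>y>x. f' x < f' y) \<or> (\<forall>x>?u. f x = 0)"
  proof (elim disjE)
    assume *: "\<forall>x\<in>{?u<..}. \<forall>y\<in>{?u<..}. x < y \<longrightarrow> f' y < f' x"
    have "f x = 0" if "?u < x" for x
    proof (rule zero_of_deriv_antimono[OF d nn lim _ that])
      fix x y assume "?u < x" "x < y"
      hence "f' y < f' x" using * by (meson greaterThan_iff less_trans)
      thus "f' y \<le> f' x" by simp
    qed
    thus ?thesis by blast
  next
    assume *: "\<forall>x\<in>{?u<..}. \<forall>y\<in>{?u<..}. f' x = f' y"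
    have "f x = 0" if "?u < x" for x
    proof (rule zero_of_deriv_antimono[OF d nn lim _ that])
      fix x y assume "?u < x" "x < y"
      hence "f' x = f' y" using * by (meson greaterThan_iff less_trans)
      thus "f' y \<le> f' x" by simp
    qed
    thus ?thesis by blast
  next
    assume *: "\<forall>x\<in>{?u<..}. \<forall>y\<in>{?u<..}. x < y \<longrightarrow> f' x < f' y"
    have "\<forall>x>?u. \<forall>y>x. f' x < f' y" using * by (meson greaterThan_iff less_trans)
    thus ?thesis ..
  qed
  have zero': "f' x = 0" if z: "\<forall>x>?u. f x = 0" and x: "?u < x" for x
  proof -
    have "((\<lambda>_. 0) has_real_derivative f' x) (at x)"
      by (rule DERIV_cong_ev[OF refl _ refl, THEN iffD1, OF _ d])
        (rule eventually_mono[OF eventually_nhds_in_open[of "{?u<..}" x]], use z x in auto)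
    thus ?thesis using DERIV_unique[OF _ DERIV_const] by blast
  qed
  have monoR: "f' x \<le> f' y" if "?u < x" "x \<le> y" for x y
    using R
  proof
    assume "\<forall>x>?u. \<forall>y>x. f' x < f' y"
    thus ?thesis using that by (cases "x = y") (auto intro!: less_imp_le)
  next
    assume "\<forall>x>?u. f x = 0"
    thus ?thesis using zero' that by (metis less_le_trans order_refl)
  qed
  show ?thesis
  proof (cases "s \<le> M")
    case True
    thus ?thesis using monoR[of x y] xy by (simp add: max_def split: if_splits)
  next
    case False
    hence u: "?u = s" and Ms: "M < s" by auto
    have fc: "isCont f y" for y using d DERIV_isCont by blast
    have right: "f' s \<le> f' y" if "s \<le> y" for y
    proof (cases "s = y")
      case False
      hence sy: "s < y" using that by simp
      have "(f' \<longlongrightarrow> f' s) (at_right s)" using f'c[of s] by (simp add: isCont_def filterlim_at_split)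
      thus ?thesis
        by (rule tendsto_upperbound)
          (use sy monoR[unfolded u] in \<open>auto intro!: eventually_at_rightI[of s y]\<close>)
    qed simp
    have "(\<forall>x\<in>{M<..<s}. \<forall>y\<in>{M<..<s}. x < y \<longrightarrow> f' x < f' y) \<or> (\<forall>x\<in>{M<..<s}. \<forall>y\<in>{M<..<s}. x < y \<longrightarrow> f' y < f' x)
      \<or> (\<forall>x\<in>{M<..<s}. \<forall>y\<in>{M<..<s}. f' x = f' y)"
      by (rule deriv_trichotomy[OF holomorphic_on_subset[OF G(1)] refl]) (use G d ni in auto)
    \<comment> \<open>If \<open>f'\<close> increases to the right of \<open>s\<close>, then
      \<open>s\<close> would be an inflection point. If instead \<open>f\<close> vanishes there,
      then \<open>f s = f' s = 0\<close>, so a decreasing \<open>f'\<close> is positive before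
      \<open>s\<close> and \<open>f\<close> would have to rise to 0 from negative values.\<close>
    moreover have "\<not> (\<forall>x\<in>{M<..<s}. \<forall>y\<in>{M<..<s}. x < y \<longrightarrow> f' y < f' x)"
    proof
      assume dec: "\<forall>x\<in>{M<..<s}. \<forall>y\<in>{M<..<s}. x < y \<longrightarrow> f' y < f' x"
      from R show False unfolding u
      proof
        assume "\<forall>x>s. \<forall>y>x. f' x < f' y"
        hence "inflection_point f s"
          using dec Ms by (intro inflection_pointI[OF d, of "- 1" "s - M"]) auto
        thus False using ni[OF Ms] by simp
      next
        assume z: "\<forall>x>s. f x = 0"
        have "(f' \<longlongrightarrow> f' s) (at_right s)" "(f \<longlongrightarrow> f s) (at_right s)"
          using f'c[of s] fc[of s] by (simp_all add: isCont_def filterlim_at_split)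
        moreover have "(f' \<longlongrightarrow> 0) (at_right s)" "(f \<longlongrightarrow> 0) (at_right s)"
          by (rule tendsto_eventually, rule eventually_at_rightI[of s "s + 1"], use z zero' u in auto)+
        ultimately have s0: "f' s = 0" "f s = 0"
          using tendsto_unique[OF trivial_limit_at_right_real] by blast+
        define t where "t = (M + s) / 2"
        have t: "M < t" "t < s" using Ms by (auto simp: t_def)
        have f't: "0 < f' v" if "v \<in> {M<..<s}" for v
        proof -
          define w where "w = (v + s) / 2"
          have w: "v < w" "w < s" using that by (auto simp: w_def)
          have "(f' \<longlongrightarrow> f' s) (at_left s)" using f'c[of s] by (simp add: isCont_def filterlim_at_split)
          hence "f' s \<le> f' w"
            by (rule tendsto_upperbound)
              (use w that dec in \<open>auto intro!: eventually_at_leftI[of w s] less_imp_le\<close>)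
          thus ?thesis using dec w that s0 by force
        qed
        obtain v where "t < v" "v < s" "f s - f t = (s - t) * f' v" using MVT2[OF t(2), of f f'] d by blast
        moreover have "0 < (s - t) * f' v" using f't[of v] calculation t by simp
        ultimately show False using s0 nn[of t] by simp
      qed
    qed
    ultimately have L: "(\<forall>x\<in>{M<..<s}. \<forall>y\<in>{M<..<s}. x < y \<longrightarrow> f' x < f' y) \<or> (\<forall>x\<in>{M<..<s}. \<forall>y\<in>{M<..<s}. f' x = f' y)"
      by blast
    have monoL: "f' x \<le> f' y" if "M < x" "x \<le> y" "y < s" for x y
    proof (cases "x = y")
      case False
      hence *: "x \<in> {M<..<s}" "y \<in> {M<..<s}" "x < y" using that by auto
      from L * have "f' x < f' y \<or> f' x = f' y" by blast
      thus ?thesis by auto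
    qed simp
    have left: "f' x \<le> f' s" if "M < x" "x \<le> s" for x
    proof (cases "s = x")
      case False
      hence xs: "x < s" using that by simp
      have "(f' \<longlongrightarrow> f' s) (at_left s)" using f'c[of s] by (simp add: isCont_def filterlim_at_split)
      thus ?thesis
        by (rule tendsto_lowerbound)
          (use xs that monoL in \<open>auto intro!: eventually_at_leftI[of x s]\<close>)
    qed simp
    consider "y < s" | "s \<le> x" | "x < s" "s \<le> y" by linarith
    thus ?thesis
    proof cases
      case 1
      thus ?thesis using monoL xy by simp
    next
      case 2
      thus ?thesis using right[of y] monoR[of x y] xy u by (cases "x = s") auto
    next
      case 3
      thus ?thesis using left[of x] right[of y] xy by simp
    qed
  qed
qed

lemma second_difference_nonneg:
  fixes f f' :: "real \<Rightarrow> real"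
  assumes d: "\<And>y. (f has_real_derivative f' y) (at y)"
    and mono: "\<And>x y. M < x \<Longrightarrow> x \<le> y \<Longrightarrow> f' x \<le> f' y" and y: "M < y" "0 < h"
  shows "0 \<le> f y - 2 * f (y + h) + f (y + 2 * h)"
proof -
  have *: "y < y + h" "y + h < y + 2 * h" using y by auto
  obtain p where p: "y < p" "p < y + h" "f (y + h) - f y = (y + h - y) * f' p"
    using MVT2[OF *(1), of f f'] d by blast
  obtain q where q: "y + h < q" "f (y + 2 * h) - f (y + h) = (y + 2 * h - (y + h)) * f' q"
    using MVT2[OF *(2), of f f'] d by blast
  have "h * f' p \<le> h * f' q" using mono[of p q] p q y by simp
  thus ?thesis using p(3) q(2) by simp
qed

section \<open>Pairing the augmented densities with second differences\<close>

lemma gsum_law_no_atoms: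
  assumes "0 < b" "\<And>i. 0 < sh i" "j < n" "c j \<noteq> 0"
  shows "measure (gsum_law b n sh c) {y} = 0"
proof -
  note X = real_distribution_scaled_gamma[OF assms(2,1)]
  show ?thesis
    unfolding gsum_law_split[of b sh j n c, OF assms(1-3)]
    by (rule convolution_no_atoms[OF X real_distribution_gsum_law[of b sh, OF assms(1,2)] scaled_gamma_no_atoms[OF assms(4)]])
qed

lemma gsum_law_uminus:
  assumes "0 < b" "\<And>i. 0 < sh i"
  shows "gsum_law b n sh (\<lambda>i. - c i) = distr (gsum_law b n sh c) borel (\<lambda>x. (- 1) * x + 0)"
proof (rule gsum_law_eqI[OF assms])
  have rd: "real_distribution (gsum_law b n sh c)" by (rule real_distribution_gsum_law[OF assms])
  thus "real_distribution (distr (gsum_law b n sh c) borel (\<lambda>x. (- 1) * x + 0))"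
    by (rule real_distribution_affine)
  show "(\<Prod>i<n. char (gamma_M (sh i) b) (- c i * s)) = char (distr (gsum_law b n sh c) borel (\<lambda>x. (- 1) * x + 0)) s" for s
    unfolding char_distr_affine[OF rd] char_gsum_law[OF assms] by simp
qed

lemma distr_density_shift:
  assumes [measurable]: "g \<in> borel_measurable borel"
  shows "distr (density lborel g) borel (\<lambda>x. 1 * x + - d) = density lborel (\<lambda>x :: real. g (x + d))"
proof (rule measure_eqI)
  fix A assume "A \<in> sets (distr (density lborel g) borel (\<lambda>x. 1 * x + - d))"
  hence [measurable]: "A \<in> sets borel" by simp
  have "emeasure (density lborel (\<lambda>x. g (x + d))) A = (\<integral>\<^sup>+x. g (x + d) * indicator A x \<partial>lborel)"
    by (subst emeasure_density) auto
  also have "\<dots> = (\<integral>\<^sup>+x. g x * indicator A (x - d) \<partial>lborel)"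
    by (subst nn_integral_real_affine[of _ 1 "- d"]) auto
  also have "\<dots> = emeasure (distr (density lborel g) borel (\<lambda>x. 1 * x + - d)) A"
  proof -
    have "(\<lambda>x. 1 * x + - d) -` A \<in> sets borel"
      using measurable_sets[of "\<lambda>x. 1 * x + - d" borel borel A] by simp
    thus ?thesis
      by (subst emeasure_distr) (auto simp: emeasure_density indicator_def intro!: nn_integral_cong)
  qed
  finally show "emeasure (distr (density lborel g) borel (\<lambda>x. 1 * x + - d)) A =
      emeasure (density lborel (\<lambda>x. g (x + d))) A" by simp
qed auto

text \<open>The uncentred density is analytic off 0, so after centring the exceptional point is
  \<open>- Q_mean a b l\<close>. Both weights must be nonzero for each exponential to
  smooth.\<close>

lemma Q_aug_dist_convex_pdf:
  assumes ab: "0 < a" "0 < b" and jk: "j < length l" "k < length l" "j \<noteq> k" "l ! j \<noteq> 0" "l ! k \<noteq> 0"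
    and ni: "\<And>y. M < y \<Longrightarrow> y \<notin> pdf_inflection_points (Q_aug_dist a b l j k)"
  shows "\<exists>f f'. is_pdf (Q_aug_dist a b l j k) f \<and> (\<forall>y. (f has_real_derivative f' y) (at y)) \<and>
    (\<forall>x y. M < x \<longrightarrow> x \<le> y \<longrightarrow> f' x \<le> f' y)"
proof -
  let ?n = "length l" and ?m = "Q_mean a b l"
  let ?Q = "gsum_law b ?n (\<lambda>_. a) (nth l)" and ?sh = "(\<lambda>_. a)(j := a + 1, k := a + 1)"
  have sh: "0 < ?sh i" for i using ab by simp
  interpret real_distribution ?Q by (rule real_distribution_gsum_law) (use ab in auto)
  interpret two_exp_smoothing ?Q b "l ! j" "l ! k"
    by unfold_locales (use ab jk gsum_law_no_atoms[of b "\<lambda>_. a" j ?n "nth l"] in auto)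
  define g where "g = f"
  have gnn: "0 \<le> g y" and gcont: "isCont g y" for y
    unfolding g_def using second.exp_pdf_nonneg second.exp_pdf_continuous by auto
  have gmeas [measurable]: "g \<in> borel_measurable borel"
    using gcont by (intro borel_measurable_continuous_onI continuous_at_imp_continuous_on) auto
  have Y: "gsum_law b ?n ?sh (nth l) = density lborel (\<lambda>y. ennreal (g y))"
    using gsum_law_shape_eq_convolution[of a b j ?n k "nth l"] ab jk second.R_density by (simp add: g_def)
  define f0 where "f0 y = g (y + ?m)" for y
  define f0' where "f0' y = f' (y + ?m)" for y
  have Q_aug: "Q_aug_dist a b l j k = density lborel (\<lambda>y. ennreal (f0 y))"
    unfolding Q_aug_dist_eq_shape[OF ab jk(1-3)] Y f0_def
    by (rule distr_density_shift) measurable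
  have pdf: "is_pdf (Q_aug_dist a b l j k) f0"
    unfolding is_pdf_def using Q_aug gnn by (simp add: f0_def)
  have d: "(f0 has_real_derivative f0' y) (at y)" for y
    using DERIV_shift[THEN iffD1, OF f_deriv[of "y + ?m"]] unfolding f0_def f0'_def g_def .
  have f0'c: "isCont f0' y" for y
    unfolding f0'_def by (rule isCont_o2[of y "\<lambda>y. y + ?m", OF _ f'_continuous]) (intro continuous_intros)
  have lim: "(f0 \<longlongrightarrow> 0) at_top"
    unfolding f0_def g_def
    by (rule filterlim_compose[OF second.exp_pdf_tendsto_0]) real_asymp
  have f0_cont: "continuous_on UNIV f0"
    using d by (meson DERIV_isCont continuous_at_imp_continuous_on)
  obtain F1 where F1: "F1 holomorphic_on right_half_plane" "\<And>y. 0 < y \<Longrightarrow> F1 (of_real y) = of_real (g y)"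
    using gsum_law_holomorphic_extension[OF ab(2) sh Y gnn gcont] by blast
  \<comment> \<open>The extension to the left of the exceptional point comes from the law with all
    weights negated, whose positive axis is the negative axis of the original.\<close>
  have Yneg: "gsum_law b ?n ?sh (\<lambda>i. - (l ! i)) = density lborel (\<lambda>y. ennreal (g (- y)))"
    unfolding gsum_law_uminus[OF ab(2) sh] Y
    using distr_density_scale[of "- 1" g] gnn by simp
  have "isCont (\<lambda>y. g (- y)) y" for y
    by (rule isCont_o2[of y uminus, OF _ gcont]) (intro continuous_intros)
  then obtain F2 where F2: "F2 holomorphic_on right_half_plane" "\<And>y. 0 < y \<Longrightarrow> F2 (of_real y) = of_real (g (- y))"
    using gsum_law_holomorphic_extension[OF ab(2) sh Yneg] gnn by blast
  have "f0' x \<le> f0' y" if "M < x" "x \<le> y" for x y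
  proof (rule deriv_mono_beyond_inflection_points[OF d f0'c _ lim, where s = "- ?m" and F = "\<lambda>z. F1 (z + of_real ?m)"
        and G = "\<lambda>z. F2 (- z - of_real ?m)", OF _ _ _ _ _ _ that])
    show "0 \<le> f0 y" for y using gnn by (simp add: f0_def)
    show "(\<lambda>z. F1 (z + of_real ?m)) holomorphic_on {z. - ?m < Re z}"
      by (intro holomorphic_on_compose_gen[OF _ F1(1), unfolded o_def] holomorphic_intros) auto
    show "F1 (of_real y + of_real ?m) = of_real (f0 y)" if "- ?m < y" for y
      using F1(2)[of "y + ?m"] that by (simp add: f0_def)
    show "(\<lambda>z. F2 (- z - of_real ?m)) holomorphic_on {z. Re z < - ?m}"
      by (intro holomorphic_on_compose_gen[OF _ F2(1), unfolded o_def] holomorphic_intros) auto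
    show "F2 (- of_real y - of_real ?m) = of_real (f0 y)" if "y < - ?m" for y
      using F2(2)[of "- y - ?m"] that by (simp add: f0_def add.commute)
    show "\<not> inflection_point f0 y" if "M < y" for y
      using ni[OF that] pdf f0_cont unfolding pdf_inflection_points_def by blast
  qed
  thus ?thesis using pdf d by blast
qed

text \<open>Translation invariance of Lebesgue measure moves the backward second difference from
  \<open>B\<close> to a forward one on the density, and \<open>B\<close> is supported where the
  density is convex.\<close>

lemma integral_Q_aug_second_difference_nonneg:
  fixes B :: "real \<Rightarrow> real"
  assumes ab: "0 < a" "0 < b" and jk: "j < length l" "k < length l" "j \<noteq> k" "l ! j \<noteq> 0" "l ! k \<noteq> 0"
    and ni: "\<And>y. M < y \<Longrightarrow> y \<notin> pdf_inflection_points (Q_aug_dist a b l j k)"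
    and h: "0 < h" and B: "continuous_on UNIV B" "\<And>y. 0 \<le> B y" "\<And>y. B y \<le> K" "\<And>y. y \<le> M \<Longrightarrow> B y = 0"
  shows "0 \<le> (\<integral>y. B y - 2 * B (y - h) + B (y - 2 * h) \<partial>Q_aug_dist a b l j k)"
proof -
  obtain f f' where pdf: "is_pdf (Q_aug_dist a b l j k) f" and d: "\<And>y. (f has_real_derivative f' y) (at y)"
    and mono: "\<And>x y. M < x \<Longrightarrow> x \<le> y \<Longrightarrow> f' x \<le> f' y"
    using Q_aug_dist_convex_pdf[OF ab jk ni] by blast
  have nn: "0 \<le> f y" and eq: "Q_aug_dist a b l j k = density lborel (\<lambda>y. ennreal (f y))" for y
    using pdf by (auto simp: is_pdf_def)
  have [measurable]: "f \<in> borel_measurable borel" "B \<in> borel_measurable borel"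
    using d B(1) by (auto intro!: borel_measurable_continuous_onI continuous_at_imp_continuous_on DERIV_isCont)
  interpret prob_space "Q_aug_dist a b l j k"
    using real_distribution_affine[OF real_distribution_gsum_law[of b "(\<lambda>_. a)(j := a + 1, k := a + 1)" "length l" "nth l"], of 1 "- Q_mean a b l"] ab
    unfolding Q_aug_dist_eq_shape[OF ab jk(1-3)] by (simp add: real_distribution_def)
  have int: "integrable lborel (\<lambda>y. f y * B (y - t))" for t
  proof -
    have "integrable (Q_aug_dist a b l j k) (\<lambda>y. B (y - t))"
      by (rule integrable_const_bound[where B=K]) (use B in \<open>auto simp: eq\<close>)
    thus ?thesis unfolding eq by (subst (asm) integrable_density) (auto simp: nn)
  qed
  have int': "integrable lborel (\<lambda>y. f (y + t) * B y)" for t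
    using lborel_integrable_real_affine[OF int[of t], of 1 t] by (simp add: add.commute)
  have shift: "(\<integral>y. f y * B (y - t) \<partial>lborel) = (\<integral>y. f (y + t) * B y \<partial>lborel)" for t
    by (subst lborel_integral_real_affine[of 1 _ t]) (simp_all add: add.commute)
  have "(\<integral>y. B y - 2 * B (y - h) + B (y - 2 * h) \<partial>Q_aug_dist a b l j k)
      = (\<integral>y. f y * B (y - 0) - 2 * (f y * B (y - h)) + f y * B (y - 2 * h) \<partial>lborel)"
    unfolding eq by (subst integral_density) (auto simp: nn algebra_simps)
  also have "\<dots> = (\<integral>y. f y * B (y - 0) \<partial>lborel) - 2 * (\<integral>y. f y * B (y - h) \<partial>lborel) + (\<integral>y. f y * B (y - 2 * h) \<partial>lborel)"
    using int[of 0] int[of h] int[of "2 * h"] by simp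
  also have "\<dots> = (\<integral>y. f (y + 0) * B y - 2 * (f (y + h) * B y) + f (y + 2 * h) * B y \<partial>lborel)"
    unfolding shift using int'[of 0] int'[of h] int'[of "2 * h"] by simp
  also have "\<dots> = (\<integral>y. (f y - 2 * f (y + h) + f (y + 2 * h)) * B y \<partial>lborel)"
    by (simp add: algebra_simps)
  also have "\<dots> \<ge> 0"
  proof (rule integral_nonneg_AE, rule AE_I2)
    fix y
    show "0 \<le> (f y - 2 * f (y + h) + f (y + 2 * h)) * B y"
    proof (cases "M < y")
      case True
      thus ?thesis using second_difference_nonneg[OF d mono True h] B(2) by simp
    qed (use B(4) in simp)
  qed
  finally show ?thesis .
qed

lemma Q_aug_dist_uminus:
  assumes ab: "0 < a" "0 < b" and jk: "j < length l" "k < length l" "j \<noteq> k"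
  shows "Q_aug_dist a b (map uminus l) j k = distr (Q_aug_dist a b l j k) borel uminus"
proof -
  let ?sh = "(\<lambda>_. a)(j := a + 1, k := a + 1)"
  have sh: "0 < ?sh i" for i using ab by simp
  have m: "Q_mean a b (map uminus l) = - Q_mean a b l"
    using ab by (simp add: Q_mean_eq sum_negf)
  have "gsum_law b (length l) ?sh (nth (map uminus l)) = gsum_law b (length l) ?sh (\<lambda>i. - (l ! i))"
    unfolding gsum_law_def by (intro distr_cong) auto
  hence "Q_aug_dist a b (map uminus l) j k =
      distr (distr (gsum_law b (length l) ?sh (nth l)) borel (\<lambda>x. (- 1) * x + 0)) borel (\<lambda>x. 1 * x + - Q_mean a b (map uminus l))"
    using Q_aug_dist_eq_shape[of a b j "map uminus l" k] ab jk
    unfolding gsum_law_uminus[OF ab(2) sh] by (simp only: length_map simp_thms)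
  also have "\<dots> = distr (distr (gsum_law b (length l) ?sh (nth l)) borel (\<lambda>x. 1 * x + - Q_mean a b l)) borel uminus"
    by (subst (1 2) distr_distr) (auto simp: gsum_law_def m o_def intro!: distr_cong)
  finally show ?thesis unfolding Q_aug_dist_eq_shape[OF ab jk] .
qed

lemma Q_abs_uminus: "0 < a \<Longrightarrow> 0 < b \<Longrightarrow> l \<in> Q_abs lam phi a b \<Longrightarrow> map uminus l \<in> Q_abs lam phi a b"
  by (auto simp: Q_abs_def Q_var_eq)

lemma not_inflection_point_above_x_upper:
  assumes "l \<in> Q_abs lam phi a b" "j < length l" "k < length l" "j \<noteq> k" "x_upper lam phi a b < ereal M" "M < y"
  shows "y \<notin> pdf_inflection_points (Q_aug_dist a b l j k)"
proof
  assume "y \<in> pdf_inflection_points (Q_aug_dist a b l j k)"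
  hence "ereal y \<le> x_upper lam phi a b"
    unfolding x_upper_def using assms by (intro Sup_upper imageI UN_I[of l] UN_I[of j] UN_I[of k]) auto
  hence "ereal y < ereal M" using assms(5) by (rule le_less_trans)
  thus False using assms(6) by simp
qed

text \<open>The second alternative is the left tail. \<open>Q_abs\<close> is closed under negation,
  so one reflects; reflection reverses the three nodes of the difference, and the extra shift by
  \<open>2 * h\<close> in \<open>?B\<close> restores their order.\<close>

lemma integral_Q_aug_second_difference_nonneg':
  fixes B :: "real \<Rightarrow> real"
  assumes ab: "0 < a" "0 < b" and l: "l \<in> Q_abs lam phi a b"
    and jk: "j < length l" "k < length l" "j \<noteq> k" "l ! j \<noteq> 0" "l ! k \<noteq> 0"
    and M: "x_upper lam phi a b < ereal M"
    and h: "0 < h" and B: "continuous_on UNIV B" "\<And>y. 0 \<le> B y" "\<And>y. B y \<le> K"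
    and supp: "(\<forall>y. B y \<noteq> 0 \<longrightarrow> M < y) \<or> (\<forall>y. B y \<noteq> 0 \<longrightarrow> y + 2 * h < - M)"
  shows "0 \<le> (\<integral>y. B y - 2 * B (y - h) + B (y - 2 * h) \<partial>Q_aug_dist a b l j k)"
  using supp
proof
  assume "\<forall>y. B y \<noteq> 0 \<longrightarrow> M < y"
  thus ?thesis
    using not_inflection_point_above_x_upper[OF l jk(1-3) M] B
    by (intro integral_Q_aug_second_difference_nonneg[OF ab jk _ h, of M B K]) force+
next
  assume s: "\<forall>y. B y \<noteq> 0 \<longrightarrow> y + 2 * h < - M"
  let ?l = "map uminus l" and ?B = "\<lambda>y. B (- y - 2 * h)"
  have [measurable]: "B \<in> borel_measurable borel" using B(1) by (rule borel_measurable_continuous_onI)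
  have jk': "j < length ?l" "k < length ?l" "j \<noteq> k" "?l ! j \<noteq> 0" "?l ! k \<noteq> 0" using jk by auto
  have sets: "sets (Q_aug_dist a b l j k) = sets borel"
    unfolding Q_aug_dist_eq_shape[OF ab jk(1-3)] by simp
  have "0 \<le> (\<integral>y. ?B y - 2 * ?B (y - h) + ?B (y - 2 * h) \<partial>Q_aug_dist a b ?l j k)"
  proof (rule integral_Q_aug_second_difference_nonneg[OF ab jk' _ h])
    show "y \<notin> pdf_inflection_points (Q_aug_dist a b ?l j k)" if "M < y" for y
      by (rule not_inflection_point_above_x_upper[OF Q_abs_uminus[OF ab l] jk'(1-3) M that])
    show "continuous_on UNIV ?B"
      by (intro continuous_on_compose2[OF B(1)] continuous_intros) auto
    show "0 \<le> ?B y" "?B y \<le> K" for y using B by auto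
    show "?B y = 0" if "y \<le> M" for y using s[rule_format, of "- y - 2 * h"] that by force
  qed
  also have "\<dots> = (\<integral>y. ?B (- y) - 2 * ?B (- y - h) + ?B (- y - 2 * h) \<partial>Q_aug_dist a b l j k)"
    unfolding Q_aug_dist_uminus[OF ab jk(1-3)]
    by (subst integral_distr) (auto simp: measurable_cong_sets[OF sets refl])
  also have "\<dots> = (\<integral>y. B y - 2 * B (y - h) + B (y - 2 * h) \<partial>Q_aug_dist a b l j k)"
    by (simp add: algebra_simps)
  finally show ?thesis .
qed

section \<open>Spline test functions and the derivative along a path\<close>

lemma has_real_derivative_max_power:
  "((\<lambda>y. max y 0 ^ Suc (Suc m)) has_real_derivative real (Suc (Suc m)) * max y 0 ^ Suc m) (at y)"
proof -
  consider "0 < y" | "y < 0" | "y = 0" by linarith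
  thus ?thesis
  proof cases
    case 1
    have "((\<lambda>y. y ^ Suc (Suc m)) has_real_derivative real (Suc (Suc m)) * max y 0 ^ Suc m) (at y)"
      using 1 by (auto intro!: derivative_eq_intros simp: max_def simp del: power_Suc)
    thus ?thesis
      by (rule DERIV_cong_ev[OF refl _ refl, THEN iffD1, rotated])
        (rule eventually_mono[OF eventually_nhds_in_open[of "{0<..}" y]], use 1 in auto)
  next
    case 2
    have "((\<lambda>y. 0) has_real_derivative real (Suc (Suc m)) * max y 0 ^ Suc m) (at y)"
      using 2 by (auto simp: max_def)
    thus ?thesis
      by (rule DERIV_cong_ev[OF refl _ refl, THEN iffD1, rotated])
        (rule eventually_mono[OF eventually_nhds_in_open[of "{..<0}" y]], use 2 in auto)
  next
    case 3
    have "((\<lambda>t::real. max t 0 ^ Suc (Suc m) / t) \<longlongrightarrow> 0) (at 0)"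
    proof (rule Lim_null_comparison[where g = "\<lambda>t. \<bar>t\<bar> ^ Suc m"])
      have "norm (max t 0 ^ Suc (Suc m) / t) \<le> \<bar>t\<bar> ^ Suc m" for t :: real
        by (cases "t \<le> 0") (simp_all add: max_def abs_mult zero_le_mult_iff del: power_Suc, simp)
      thus "\<forall>\<^sub>F t in at 0. norm (max t 0 ^ Suc (Suc m) / t) \<le> \<bar>t::real\<bar> ^ Suc m" by simp
      have "isCont (\<lambda>t::real. \<bar>t\<bar> ^ Suc m) 0" by (intro continuous_intros)
      thus "((\<lambda>t::real. \<bar>t\<bar> ^ Suc m) \<longlongrightarrow> 0) (at 0)" by (simp add: isCont_def)
    qed
    thus ?thesis using 3 by (simp add: has_field_derivative_iff)
  qed
qed

text \<open>The quartic spline \<open>spline_step 0\<close> descends from 1 at 0 to 0 at 4, and \<open>spline_step k\<close> is its \<open>k\<close>-th derivative.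
  Its third derivative is the negative of a second difference of the hat function, which is the shape that
  can be paired with a convex density.\<close>

definition spline_step :: "nat \<Rightarrow> real \<Rightarrow> real" where
  "spline_step k z = (if k = 0 then 1 else 0) - (max z 0 ^ (4 - k) - 4 * max (z - 1) 0 ^ (4 - k)
     + 6 * max (z - 2) 0 ^ (4 - k) - 4 * max (z - 3) 0 ^ (4 - k) + max (z - 4) 0 ^ (4 - k)) / fact (4 - k)"

definition hat :: "real \<Rightarrow> real" where
  "hat z = max z 0 - 2 * max (z - 1) 0 + max (z - 2) 0"

text \<open>The coefficients 1, -4, 6, -4, 1 of the spline are the coefficients 1, -2, 1 convolved
  with themselves: a fourth difference is a second difference of the second difference
  \<open>hat\<close>.\<close>

lemma spline_step_3: "spline_step 3 z = - (hat z - 2 * hat (z - 1) + hat (z - 2))"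
  by (simp add: spline_step_def hat_def algebra_simps)

lemma hat_nonneg: "0 \<le> hat z" and hat_le: "hat z \<le> 1" and hat_supp: "hat z \<noteq> 0 \<Longrightarrow> 0 < z \<and> z < 2"
  by (auto simp: hat_def max_def split: if_splits)

lemma continuous_on_hat: "continuous_on S hat"
  unfolding hat_def by (intro continuous_intros)

lemma spline_step_deriv:
  assumes "k \<le> 2"
  shows "(spline_step k has_real_derivative spline_step (Suc k) z) (at z)"
proof -
  \<comment> \<open>The bound on \<open>k\<close> leaves an exponent of at least 2, for which the
    truncated power is differentiable at its knot; \<open>spline_step 3\<close> is piecewise
    linear.\<close>
  obtain m where m: "4 - k = Suc (Suc m)" "4 - Suc k = Suc m"
    using assms that[of "2 - k"] by linarith
  have d: "((\<lambda>y. max (y - r) 0 ^ Suc (Suc m)) has_real_derivative real (Suc (Suc m)) * max (z - r) 0 ^ Suc m) (at z)" for r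
    using DERIV_shift[THEN iffD1, of _ _ z "- r", OF has_real_derivative_max_power[of m "z + - r"]] by simp
  have "((\<lambda>z. (if k = 0 then 1 else 0) - (max (z - 0) 0 ^ Suc (Suc m) - 4 * max (z - 1) 0 ^ Suc (Suc m)
     + 6 * max (z - 2) 0 ^ Suc (Suc m) - 4 * max (z - 3) 0 ^ Suc (Suc m) + max (z - 4) 0 ^ Suc (Suc m)) / fact (Suc (Suc m)))
    has_real_derivative 0 - (real (Suc (Suc m)) * max (z - 0) 0 ^ Suc m - 4 * (real (Suc (Suc m)) * max (z - 1) 0 ^ Suc m)
     + 6 * (real (Suc (Suc m)) * max (z - 2) 0 ^ Suc m) - 4 * (real (Suc (Suc m)) * max (z - 3) 0 ^ Suc m)
     + real (Suc (Suc m)) * max (z - 4) 0 ^ Suc m) / fact (Suc (Suc m))) (at z)"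
    by (intro DERIV_diff DERIV_add DERIV_cmult DERIV_cdivide DERIV_const d)
  moreover have "0 - (real (Suc (Suc m)) * max (z - 0) 0 ^ Suc m - 4 * (real (Suc (Suc m)) * max (z - 1) 0 ^ Suc m)
     + 6 * (real (Suc (Suc m)) * max (z - 2) 0 ^ Suc m) - 4 * (real (Suc (Suc m)) * max (z - 3) 0 ^ Suc m)
     + real (Suc (Suc m)) * max (z - 4) 0 ^ Suc m) / fact (Suc (Suc m)) = spline_step (Suc k) z"
  proof -
    have "0 - (N * A - 4 * (N * B) + 6 * (N * C) - 4 * (N * D) + N * E) / (N * F) = 0 - (A - 4 * B + 6 * C - 4 * D + E) / F"
      if "N \<noteq> 0" for N A B C D E F :: real
    proof -
      have "N * A - 4 * (N * B) + 6 * (N * C) - 4 * (N * D) + N * E = N * (A - 4 * B + 6 * C - 4 * D + E)"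
        by (simp add: algebra_simps)
      thus ?thesis using that by simp
    qed
    from this[of "real (Suc (Suc m))"] show ?thesis
      unfolding spline_step_def m fact_Suc[of "Suc m"] by simp
  qed
  ultimately show ?thesis unfolding spline_step_def[of k, abs_def] m by simp
qed

lemma continuous_on_spline_step: "continuous_on S (spline_step k)"
  unfolding spline_step_def by (intro continuous_intros) auto

lemma spline_step_le_0: "z \<le> 0 \<Longrightarrow> k \<le> 3 \<Longrightarrow> spline_step k z = (if k = 0 then 1 else 0)"
  by (auto simp: spline_step_def max_def)

text \<open>Beyond the last knot all truncations disappear and the sum is the fourth difference of
  \<open>z ^ (4 - k) / fact (4 - k)\<close>, which is 1 for \<open>k = 0\<close> and 0
  otherwise.\<close>

lemma spline_step_ge_4: "4 \<le> z \<Longrightarrow> k \<le> 3 \<Longrightarrow> spline_step k z = 0"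
proof -
  assume z: "4 \<le> z" and "k \<le> 3"
  then consider "k = 0" | "k = 1" | "k = 2" | "k = 3" by linarith
  thus ?thesis
    using z by cases (simp_all add: spline_step_def max_def fact_numeral power4_eq_xxxx power3_eq_cube power2_eq_square algebra_simps)
qed

lemma spline_step_bounded: "k \<le> 3 \<Longrightarrow> \<exists>B. \<forall>z. \<bar>spline_step k z\<bar> \<le> B"
proof -
  assume k: "k \<le> 3"
  have "bounded (spline_step k ` {0..4})"
    by (intro compact_imp_bounded compact_continuous_image continuous_on_spline_step) simp
  then obtain B where "\<forall>y\<in>spline_step k ` {0..4}. norm y \<le> B"
    unfolding bounded_iff by blast
  hence B: "\<bar>spline_step k z\<bar> \<le> B" if "z \<in> {0..4}" for z
    using that by force
  have "\<bar>spline_step k z\<bar> \<le> max 1 B" for z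
  proof -
    consider "z \<le> 0" | "4 \<le> z" | "z \<in> {0..4}" by fastforce
    thus ?thesis
      using k B[of z] by cases (auto simp: spline_step_le_0 spline_step_ge_4)
  qed
  thus ?thesis by blast
qed

text \<open>Summation by parts as an invariant: a weighted prefix is at most the plain prefix sum
  times the current \<open>h\<close>, and the last prefix sum is 0.\<close>

lemma abel_sum_nonpos:
  fixes d h :: "nat \<Rightarrow> real"
  assumes pre: "\<And>k. k \<le> n \<Longrightarrow> 0 \<le> (\<Sum>i<k. d i)" and tot: "(\<Sum>i<n. d i) = 0"
    and mono: "\<And>i k. i < k \<Longrightarrow> k < n \<Longrightarrow> h i \<le> h k"
  shows "(\<Sum>i<n. d i * h i) \<le> 0"
proof -
  have "(\<Sum>i<Suc k. d i * h i) \<le> (\<Sum>i<Suc k. d i) * h k" if "k < n" for k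
    using that
  proof (induction k)
    case (Suc k)
    have "(\<Sum>i<Suc k. d i) * h k \<le> (\<Sum>i<Suc k. d i) * h (Suc k)"
      using pre[of "Suc k"] mono[of k "Suc k"] Suc.prems by (intro mult_left_mono) auto
    thus ?case using Suc by (simp add: algebra_simps)
  qed simp
  thus ?thesis using tot by (cases n) force+
qed

text \<open>Monotonicity of \<open>h\<close> is available only between nonzero weights. Elsewhere
  \<open>d\<close> vanishes, so \<open>h\<close> may be replaced by its running maximum over the
  good indices, which is monotone throughout.\<close>

lemma abel_sum_nonpos_on:
  fixes d h :: "nat \<Rightarrow> real"
  assumes pre: "\<And>k. k \<le> n \<Longrightarrow> 0 \<le> (\<Sum>i<k. d i)" and tot: "(\<Sum>i<n. d i) = 0"
    and mono: "\<And>i k. i < k \<Longrightarrow> k < n \<Longrightarrow> P i \<Longrightarrow> P k \<Longrightarrow> h i \<le> h k"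
    and zero: "\<And>i. i < n \<Longrightarrow> \<not> P i \<Longrightarrow> d i = 0"
  shows "(\<Sum>i<n. d i * h i) \<le> 0"
proof -
  \<comment> \<open>The overall minimum is a floor: it makes the set nonempty before the first good
    index and never exceeds a value of \<open>h\<close> below \<open>n\<close>.\<close>
  define A where "A k = insert (Min (insert 0 (h ` {..<n}))) (h ` {i. i \<le> k \<and> i < n \<and> P i})" for k
  have fin: "finite (A k)" and ne: "A k \<noteq> {}" for k by (auto simp: A_def)
  have "Max (A k) = h k" if "k < n" "P k" for k
  proof (rule Max_eqI[OF fin])
    show "h k \<in> A k" using that by (auto simp: A_def)
    fix y assume "y \<in> A k"
    moreover have "Min (insert 0 (h ` {..<n})) \<le> h k" using that by (intro Min_le) auto
    moreover have "h i \<le> h k" if "i \<le> k" "P i" for i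
      using that mono[of i k] \<open>k < n\<close> \<open>P k\<close> by (cases "i = k") auto
    ultimately show "y \<le> h k" by (auto simp: A_def)
  qed
  hence "(\<Sum>i<n. d i * h i) = (\<Sum>i<n. d i * Max (A i))"
    using zero by (intro sum.cong) (metis lessThan_iff mult_zero_left)+
  also have "\<dots> \<le> 0"
  proof (rule abel_sum_nonpos[OF pre tot])
    show "Max (A i) \<le> Max (A k)" if "i < k" for i k
      using that by (intro Max_mono fin ne) (auto simp: A_def)
  qed auto
  finally show ?thesis .
qed

abbreviation csum :: "real \<Rightarrow> real \<Rightarrow> nat \<Rightarrow> (nat \<Rightarrow> real) \<Rightarrow> (nat \<Rightarrow> real) \<Rightarrow> real" where
  "csum a b n c x \<equiv> (\<Sum>i<n. c i * x i) - a / b * (\<Sum>i<n. c i)"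

text \<open>The chain rule leaves the factors \<open>x i - a / b\<close>. Size bias treats
  \<open>x i\<close>, and the centring term is exactly what turns the result into a difference
  between shapes \<open>a + 1\<close> and \<open>a\<close>; integration by parts then trades it for
  \<open>H2\<close> and a factor \<open>c t0 i\<close>.\<close>

lemma expectation_path_deriv:
  fixes c c' :: "real \<Rightarrow> nat \<Rightarrow> real"
  assumes ab: "0 < a" "0 < b" and e: "0 < e"
    and c: "\<And>t i. \<bar>t - t0\<bar> < e \<Longrightarrow> i < n \<Longrightarrow> ((\<lambda>t. c t i) has_real_derivative c' t i) (at t)"
    and L: "\<And>t i. \<bar>t - t0\<bar> < e \<Longrightarrow> i < n \<Longrightarrow> \<bar>c' t i\<bar> \<le> L"
    and H: "\<And>y. (H0 has_real_derivative H1 y) (at y)" "\<And>y. (H1 has_real_derivative H2 y) (at y)"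
       "continuous_on UNIV H2"
    and B: "\<And>y. \<bar>H0 y\<bar> \<le> B0" "\<And>y. \<bar>H1 y\<bar> \<le> B1" "\<And>y. \<bar>H2 y\<bar> \<le> B2"
  shows "((\<lambda>t. \<integral>x. H0 (csum a b n (c t) x) \<partial>gamma_prod b n (\<lambda>_. a))
     has_real_derivative (\<Sum>i<n. a / b\<^sup>2 * (c' t0 i * c t0 i) *
       (\<integral>x. H2 (csum a b n (c t0) x) \<partial>gamma_prod b n ((\<lambda>_. a)(i := a + 1))))) (at t0)"
proof -
  let ?P = "gamma_prod b n (\<lambda>_. a)"
  have a: "0 < (\<lambda>_::nat. a) i" for i using ab by simp
  interpret prob_space ?P by (rule prob_space_gamma_prod) (use ab in auto)
  let ?S = "\<lambda>t. csum a b n (c t)"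
  let ?S' = "\<lambda>t x. (\<Sum>i<n. c' t i * (x i - a / b))"
  have [measurable]: "H0 \<in> borel_measurable borel" "H1 \<in> borel_measurable borel" "H2 \<in> borel_measurable borel"
    using H by (auto intro!: borel_measurable_continuous_onI continuous_at_imp_continuous_on DERIV_isCont)
  have dS: "((\<lambda>t. ?S t x) has_real_derivative ?S' t x) (at t)" if "\<bar>t - t0\<bar> < e" for t x
  proof -
    have "((\<lambda>t. ?S t x) has_real_derivative (\<Sum>i<n. c' t i * x i) - a / b * (\<Sum>i<n. c' t i)) (at t)"
      using that by (intro DERIV_diff DERIV_sum DERIV_cmult DERIV_cmult_right c) auto
    moreover have "(\<Sum>i<n. c' t i * x i) - a / b * (\<Sum>i<n. c' t i) = ?S' t x"
      by (simp add: right_diff_distrib sum_subtractf sum_distrib_left mult_ac)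
    ultimately show ?thesis by simp
  qed
  have dF: "((\<lambda>t. H0 (?S t x)) has_real_derivative H1 (?S t x) * ?S' t x) (at t)" if "\<bar>t - t0\<bar> < e" for t x
    by (rule DERIV_chain2[OF H(1) dS[OF that]])
  have B1: "0 \<le> B1" using B(2)[of 0] by linarith
  \<comment> \<open>Dominating function: \<open>H1\<close> is bounded, weight speeds are at most
    \<open>L\<close>, and each coordinate is integrable.\<close>
  let ?w = "\<lambda>x. B1 * (\<Sum>i<n. L * (\<bar>x i\<bar> + a / b))"
  have comp: "integrable ?P (\<lambda>x. x i)" if "i < n" for i
    by (rule gamma_prod_integrable_component[OF ab(2) a that])
  have wint: "integrable ?P ?w"
    by (intro integrable_mult_right Bochner_Integration.integrable_sum Bochner_Integration.integrable_add integrable_abs comp integrable_const) auto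
  have main: "((\<lambda>t. \<integral>x. H0 (?S t x) \<partial>?P) has_real_derivative (\<integral>x. H1 (?S t0 x) * ?S' t0 x \<partial>?P)) (at t0)"
  proof (rule has_field_derivative_integral[where S = "{t0 - e<..<t0 + e}" and w = ?w])
    show "((\<lambda>t. H0 (?S t x)) has_real_derivative H1 (?S t0 x) * ?S' t0 x) (at t0)" for x
      using e by (intro dF) simp
    show "integrable ?P (\<lambda>x. H0 (?S t x))" for t
      by (rule integrable_const_bound[where B=B0]) (use B in auto)
    show "norm (H0 (?S t x) - H0 (?S t0 x)) \<le> ?w x * norm (t - t0)" if "t \<in> {t0 - e<..<t0 + e}" for x t
    proof (rule field_differentiable_bound[of "{t0 - e<..<t0 + e}" _ "\<lambda>t. H1 (?S t x) * ?S' t x"])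
      fix u assume "u \<in> {t0 - e<..<t0 + e}"
      hence u: "\<bar>u - t0\<bar> < e" by (auto simp: abs_less_iff)
      show "((\<lambda>t. H0 (?S t x)) has_real_derivative H1 (?S u x) * ?S' u x) (at u within {t0 - e<..<t0 + e})"
        by (rule has_field_derivative_at_within[OF dF[OF u]])
      have "\<bar>?S' u x\<bar> \<le> (\<Sum>i<n. \<bar>c' u i * (x i - a / b)\<bar>)" by (rule sum_abs)
      also have "\<dots> \<le> (\<Sum>i<n. L * (\<bar>x i\<bar> + a / b))"
      proof (rule sum_mono)
        fix i assume "i \<in> {..<n}"
        hence "\<bar>c' u i\<bar> \<le> L" using L[OF u] by simp
        moreover have "\<bar>x i - a / b\<bar> \<le> \<bar>x i\<bar> + a / b" using ab abs_triangle_ineq4[of "x i" "a / b"] by simp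
        ultimately show "\<bar>c' u i * (x i - a / b)\<bar> \<le> L * (\<bar>x i\<bar> + a / b)"
          unfolding abs_mult by (intro mult_mono) auto
      qed
      finally show "norm (H1 (?S u x) * ?S' u x) \<le> ?w x"
        unfolding real_norm_def abs_mult using B1 by (intro mult_mono B) auto
    qed (use that e in auto)
  qed (use e wint in auto)
  have trm: "(\<integral>x. (x i - a / b) * H1 (?S t0 x) \<partial>?P) = a / b * (c t0 i / b *
      (\<integral>x. H2 (?S t0 x) \<partial>gamma_prod b n ((\<lambda>_. a)(i := a + 1))))"
    and tint: "integrable ?P (\<lambda>x. (x i - a / b) * H1 (?S t0 x))" if i: "i < n" for i
  proof -
    let ?m = "a / b * (\<Sum>i<n. c t0 i)"
    let ?H1 = "\<lambda>y. H1 (y - ?m)" and ?H2 = "\<lambda>y. H2 (y - ?m)"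
    have d: "(?H1 has_real_derivative ?H2 y) (at y)" for y
      using DERIV_shift[THEN iffD1, of _ _ y "- ?m", OF H(2)[of "y + - ?m"]] by simp
    have cont: "continuous_on UNIV ?H2"
      by (intro continuous_on_compose2[OF H(3)] continuous_intros) auto
    have i1: "integrable ?P (\<lambda>x. H1 (?S t0 x))"
      by (rule integrable_const_bound[where B=B1]) (use B in auto)
    have i2: "integrable ?P (\<lambda>x. x i * H1 (?S t0 x))"
      using gamma_prod_size_bias(2)[OF ab(2) a i, of ?H1 B1 "c t0"] B by simp
    have dist: "(x i - a / b) * H1 (?S t0 x) = x i * H1 (?S t0 x) - a / b * H1 (?S t0 x)" for x :: "nat \<Rightarrow> real"
      by (simp add: algebra_simps)
    show "integrable ?P (\<lambda>x. (x i - a / b) * H1 (?S t0 x))" unfolding dist using i1 i2 by simp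
    have "(\<integral>x. (x i - a / b) * H1 (?S t0 x) \<partial>?P) =
        a / b * (\<integral>x. H1 (?S t0 x) \<partial>gamma_prod b n ((\<lambda>_. a)(i := a + 1))) - a / b * (\<integral>x. H1 (?S t0 x) \<partial>?P)"
      unfolding dist using i1 i2 gamma_prod_size_bias(1)[OF ab(2) a i, of ?H1 B1 "c t0"] B by simp
    also have "\<dots> = a / b * ((\<integral>x. H1 (?S t0 x) \<partial>gamma_prod b n ((\<lambda>_. a)(i := a + 1))) - (\<integral>x. H1 (?S t0 x) \<partial>?P))"
      by (simp add: algebra_simps)
    also have "\<dots> = a / b * (c t0 i / b * (\<integral>x. H2 (?S t0 x) \<partial>gamma_prod b n ((\<lambda>_. a)(i := a + 1))))"
      using gamma_prod_shape_diff[OF ab(2) a i d cont, of B1 B2 "c t0"] B by simp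
    finally show "(\<integral>x. (x i - a / b) * H1 (?S t0 x) \<partial>?P) = a / b * (c t0 i / b *
      (\<integral>x. H2 (?S t0 x) \<partial>gamma_prod b n ((\<lambda>_. a)(i := a + 1))))" .
  qed
  have "(\<integral>x. H1 (?S t0 x) * ?S' t0 x \<partial>?P) = (\<integral>x. (\<Sum>i<n. c' t0 i * ((x i - a / b) * H1 (?S t0 x))) \<partial>?P)"
  proof -
    have "K * ?S' t0 x = (\<Sum>i<n. c' t0 i * ((x i - a / b) * K))" for K x
      by (simp add: sum_distrib_left mult_ac)
    thus ?thesis by simp
  qed
  also have "\<dots> = (\<Sum>i<n. c' t0 i * (\<integral>x. (x i - a / b) * H1 (?S t0 x) \<partial>?P))"
    by (subst Bochner_Integration.integral_sum, rule integrable_mult_right, rule tint, simp, simp)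
  also have "\<dots> = (\<Sum>i<n. a / b\<^sup>2 * (c' t0 i * c t0 i) *
       (\<integral>x. H2 (?S t0 x) \<partial>gamma_prod b n ((\<lambda>_. a)(i := a + 1))))"
  proof (rule sum.cong[OF refl])
    fix i assume "i \<in> {..<n}"
    hence i: "i < n" by simp
    show "c' t0 i * (\<integral>x. (x i - a / b) * H1 (?S t0 x) \<partial>?P) = a / b\<^sup>2 * (c' t0 i * c t0 i) *
       (\<integral>x. H2 (?S t0 x) \<partial>gamma_prod b n ((\<lambda>_. a)(i := a + 1)))"
      unfolding trm[OF i] by (simp add: power2_eq_square)
  qed
  finally show ?thesis using main by simp
qed

section \<open>Monotonicity along the path\<close>

lemma gsum_law_cong: "(\<And>i. i < n \<Longrightarrow> c i = c' i) \<Longrightarrow> gsum_law b n sh c = gsum_law b n sh c'"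
  unfolding gsum_law_def by (intro distr_cong refl) auto

lemma integral_gamma_prod_eq_Q_aug:
  fixes H :: "real \<Rightarrow> real"
  assumes ab: "0 < a" "0 < b" and jk: "j < n" "k < n" "j \<noteq> k" and [measurable]: "H \<in> borel_measurable borel"
  shows "(\<integral>x. H (csum a b n c x) \<partial>gamma_prod b n ((\<lambda>_. a)(j := a + 1, k := a + 1)))
    = (\<integral>y. H y \<partial>Q_aug_dist a b (map c [0..<n]) j k)"
proof -
  let ?l = "map c [0..<n]"
  have m: "Q_mean a b ?l = a / b * (\<Sum>i<n. c i)" using ab by (simp add: Q_mean_eq)
  have g: "gsum_law b (length ?l) ((\<lambda>_. a)(j := a + 1, k := a + 1)) (nth ?l) = gsum_law b n ((\<lambda>_. a)(j := a + 1, k := a + 1)) c"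
    by (simp, rule gsum_law_cong) simp
  have "(\<integral>y. H y \<partial>Q_aug_dist a b ?l j k) = (\<integral>y. H (1 * y + - Q_mean a b ?l) \<partial>gsum_law b n ((\<lambda>_. a)(j := a + 1, k := a + 1)) c)"
    using Q_aug_dist_eq_shape[of a b j ?l k] ab jk unfolding g
    by (simp del: mult_1) (subst integral_distr, auto simp: gsum_law_def)
  also have "\<dots> = (\<integral>x. H (csum a b n c x) \<partial>gamma_prod b n ((\<lambda>_. a)(j := a + 1, k := a + 1)))"
    unfolding m gsum_law_def by (subst integral_distr) auto
  finally show ?thesis by simp
qed

text \<open>Signs stay fixed while the squared weights move linearly from \<open>p\<close> to
  \<open>q\<close>. The third derivative of the rescaled spline lives between \<open>x\<close> and
  \<open>x + 4 * h\<close>, so the bound on \<open>4 * h\<close> keeps it beyond \<open>M\<close> in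
  the right tail and before \<open>- M\<close> in the left one.\<close>

lemma expectation_spline_path_antimono:
  fixes sg p q :: "nat \<Rightarrow> real"
  defines "c \<equiv> \<lambda>t i. sg i * sqrt ((1 - t) * p i + t * q i)"
  assumes ab: "0 < a" "0 < b"
    and sg: "\<And>i. sg i = 1 \<or> sg i = - 1" and p: "\<And>i. 0 \<le> p i" and q: "\<And>i. 0 \<le> q i"
    and sorted: "\<And>t i k. 0 \<le> t \<Longrightarrow> t \<le> 1 \<Longrightarrow> i < k \<Longrightarrow> k < n \<Longrightarrow> c t k \<le> c t i"
    and pre: "\<And>k. k \<le> n \<Longrightarrow> 0 \<le> (\<Sum>i<k. q i - p i)" and tot: "(\<Sum>i<n. q i - p i) = 0"
    and Qabs: "\<And>t. 0 \<le> t \<Longrightarrow> t \<le> 1 \<Longrightarrow> map (c t) [0..<n] \<in> Q_abs lam phi a b"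
    and M: "x_upper lam phi a b < ereal M" "M < \<bar>x\<bar>" and h: "0 < h" "4 * h \<le> \<bar>x\<bar> - M"
  defines "J \<equiv> \<lambda>t. \<integral>\<omega>. spline_step 0 ((csum a b n (c t) \<omega> - x) / h) \<partial>gamma_prod b n (\<lambda>_. a)"
  shows "J 1 \<le> J 0"
proof -
  define H where "H k y = spline_step k ((y - x) / h) / h ^ k" for k y
  have H_deriv: "(H k has_real_derivative H (Suc k) y) (at y)" if "k \<le> 2" for k y
  proof -
    have "((\<lambda>y. (y - x) / h) has_real_derivative 1 / h) (at y)"
      by (intro DERIV_cdivide) (auto intro!: derivative_eq_intros)
    from DERIV_cdivide[OF DERIV_chain2[OF spline_step_deriv[OF that] this], of "h ^ k"]
    show ?thesis unfolding H_def by simp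
  qed
  have H_cont: "continuous_on UNIV (H k)" for k
    unfolding H_def by (intro continuous_intros continuous_on_compose2[OF continuous_on_spline_step[of UNIV]]) (use h in auto)
  have H_meas [measurable]: "H k \<in> borel_measurable borel" for k
    by (rule borel_measurable_continuous_onI[OF H_cont])
  have "\<exists>B. \<forall>y. \<bar>H k y\<bar> \<le> B" if "k \<le> 3" for k
  proof -
    obtain B where "\<And>z. \<bar>spline_step k z\<bar> \<le> B" using spline_step_bounded[OF \<open>k \<le> 3\<close>] by blast
    hence "\<bar>H k y\<bar> \<le> B / h ^ k" for y using h by (simp add: H_def divide_right_mono)
    thus ?thesis by blast
  qed
  then obtain Bd where Bd: "\<And>k y. k \<le> 3 \<Longrightarrow> \<bar>H k y\<bar> \<le> Bd k" by metis
  let ?S = "\<lambda>t. csum a b n (c t)"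
  have J: "J = (\<lambda>t. \<integral>\<omega>. H 0 (?S t \<omega>) \<partial>gamma_prod b n (\<lambda>_. a))"
    by (simp add: J_def H_def)
  have a: "0 < (\<lambda>_::nat. a) i" for i using ab by simp
  interpret P: prob_space "gamma_prod b n (\<lambda>_. a)" by (rule prob_space_gamma_prod) (use ab in auto)
  define r where "r t i = (1 - t) * p i + t * q i" for t i
  define c' where "c' t i = sg i * ((q i - p i) / (2 * sqrt (r t i)))" for t i
  have c_r: "c t i = sg i * sqrt (r t i)" for t i by (simp add: c_def r_def)
  \<comment> \<open>Away from the ends of the path a squared weight is bounded below unless both its
    end values are 0; this controls the speeds, which contain the reciprocal of a square
    root.\<close>
  have r_lower: "e * (p i + q i) \<le> r t i" if "e \<le> t" "e \<le> 1 - t" for e t i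
  proof -
    have "e * p i \<le> (1 - t) * p i" "e * q i \<le> t * q i" using that p[of i] q[of i] by (auto intro: mult_right_mono)
    thus ?thesis by (simp add: r_def distrib_left)
  qed
  have c_deriv: "((\<lambda>t. c t i) has_real_derivative c' t i) (at t)" if t: "0 < t" "t < 1" for t i
  proof (cases "p i + q i = 0")
    case True
    hence "p i = 0" "q i = 0" using p[of i] q[of i] by auto
    hence "(\<lambda>t. c t i) = (\<lambda>t. 0)" "c' t i = 0" by (auto simp: c_def c'_def)
    thus ?thesis by simp
  next
    case False
    hence "0 < p i + q i" using p[of i] q[of i] by auto
    moreover have "0 < min t (1 - t)" using t by simp
    ultimately have "0 < min t (1 - t) * (p i + q i)" by (rule mult_pos_pos[rotated])
    also have "\<dots> \<le> r t i" by (rule r_lower) auto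
    finally have r: "0 < r t i" .
    have "((\<lambda>t. r t i) has_real_derivative q i - p i) (at t)"
      unfolding r_def by (auto intro!: derivative_eq_intros)
    from DERIV_cmult[OF DERIV_chain2[OF DERIV_real_sqrt[OF r] this], of "sg i"]
    show ?thesis unfolding c_r c'_def by (simp add: field_simps)
  qed
  \<comment> \<open>Half the speed of the squared weight. If \<open>r t i = 0\<close>, both end
    values are 0 and the identity holds through division by zero being 0.\<close>
  have c'c: "c' t i * c t i = (q i - p i) / 2" if t: "0 < t" "t < 1" for t i
  proof (cases "r t i = 0")
    case True
    have "min t (1 - t) * (p i + q i) \<le> 0" using r_lower[of "min t (1 - t)" t i] True by simp
    hence "p i + q i \<le> 0" using t by (auto simp: mult_le_0_iff)
    hence "p i = 0" "q i = 0" using p[of i] q[of i] by auto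
    thus ?thesis by (simp add: c'_def)
  next
    case False
    moreover have "0 \<le> r t i" using t p[of i] q[of i] by (simp add: r_def)
    moreover have "sg i * sg i = 1" using sg[of i] by auto
    moreover have "c' t i * c t i = (sg i * sg i) * ((q i - p i) / (2 * sqrt (r t i)) * sqrt (r t i))"
      unfolding c'_def c_r by simp
    ultimately show ?thesis by simp
  qed
  have "J 1 \<le> J 0"
  proof (rule DERIV_nonpos_imp_decreasing_open[of 0 1 J])
    show "\<exists>y. (J has_real_derivative y) (at t) \<and> y \<le> 0" if t: "0 < t" "t < 1" for t
    proof -
      \<comment> \<open>Half the distance to the ends: points within \<open>e\<close> of
        \<open>t\<close> still keep distance \<open>e\<close> from 0 and 1, so
        \<open>r_lower\<close> gives the uniform speed bound \<open>L\<close>.\<close>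
      define e where "e = min t (1 - t) / 2"
      have e: "0 < e" using t by (simp add: e_def)
      have et: "e < u" "e < 1 - u" if "\<bar>u - t\<bar> < e" for u
        using that t unfolding e_def by (auto simp: min_def abs_if split: if_splits)
      define L where "L = (\<Sum>i<n. (p i + q i) / (2 * sqrt (e * (p i + q i))))"
      have bnd: "\<bar>c' u i\<bar> \<le> L" if u: "\<bar>u - t\<bar> < e" and i: "i < n" for u i
      proof -
        have nn: "0 \<le> (p i + q i) / (2 * sqrt (e * (p i + q i)))" for i
          using p[of i] q[of i] e by simp
        have sq: "sqrt (e * (p i + q i)) \<le> sqrt (r u i)"
          using et[OF u] by (intro real_sqrt_le_mono r_lower) auto
        have "0 \<le> sqrt (e * (p i + q i))" using p[of i] q[of i] e by simp
        hence "0 \<le> sqrt (r u i)" using sq by (rule order.trans)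
        hence "\<bar>c' u i\<bar> = \<bar>q i - p i\<bar> / (2 * sqrt (r u i))"
          using sg[of i] by (auto simp: c'_def abs_mult abs_divide)
        also have "\<dots> \<le> (p i + q i) / (2 * sqrt (e * (p i + q i)))"
        proof (cases "p i + q i = 0")
          case True
          hence "p i = 0" "q i = 0" using p[of i] q[of i] by auto
          thus ?thesis by simp
        next
          case False
          hence "0 < p i + q i" using p[of i] q[of i] by auto
          thus ?thesis using sq e p[of i] q[of i] by (intro frac_le) auto
        qed
        also have "\<dots> \<le> L" unfolding L_def
          using i nn by (intro member_le_sum) auto
        finally show ?thesis .
      qed
      define hh where "hh i = (\<integral>\<omega>. H 2 (?S t \<omega>) \<partial>gamma_prod b n ((\<lambda>_. a)(i := a + 1)))" for i
      have "(J has_real_derivative (\<Sum>i<n. a / b\<^sup>2 * (c' t i * c t i) * hh i)) (at t)"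
        unfolding J hh_def
      proof (rule expectation_path_deriv[OF ab e _ bnd, where ?B0.0="Bd 0" and ?B1.0="Bd 1" and ?B2.0="Bd 2"])
        show "((\<lambda>t. c t i) has_real_derivative c' u i) (at u)" if "\<bar>u - t\<bar> < e" for u i
          using et[OF that] e by (intro c_deriv) auto
        show "(H 0 has_real_derivative H 1 y) (at y)" "(H 1 has_real_derivative H 2 y) (at y)" for y
          using H_deriv[of 0 y] H_deriv[of 1 y] by (simp_all add: numeral_2_eq_2)
        show "\<bar>H 0 y\<bar> \<le> Bd 0" "\<bar>H 1 y\<bar> \<le> Bd 1" "\<bar>H 2 y\<bar> \<le> Bd 2" for y by (auto intro!: Bd)
      qed (auto intro: H_cont)
      moreover have "(\<Sum>i<n. a / b\<^sup>2 * (c' t i * c t i) * hh i) \<le> 0"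
      proof -
        have mono: "hh i \<le> hh k" if ik: "i < k" "k < n" "c t i \<noteq> 0" "c t k \<noteq> 0" for i k
        proof -
          let ?m = "a / b * (\<Sum>i<n. c t i)" and ?l = "map (c t) [0..<n]"
          let ?sh = "(\<lambda>_. a)(i := a + 1, k := a + 1)"
          let ?H2 = "\<lambda>y. H 2 (y - ?m)" and ?H3 = "\<lambda>y. H 3 (y - ?m)"
          define X where "X = (\<integral>\<omega>. H 3 (?S t \<omega>) \<partial>gamma_prod b n ?sh)"
          \<comment> \<open>Both shapes raised. Lowering one of them again gives \<open>hh i\<close>
            or \<open>hh k\<close>, each at the cost of a multiple of the same \<open>X\<close>;
            subtracting eliminates \<open>E\<close>.\<close>
          define E where "E = (\<integral>\<omega>. H 2 (?S t \<omega>) \<partial>gamma_prod b n ?sh)"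
          have d: "(?H2 has_real_derivative ?H3 y) (at y)" for y
            using DERIV_shift[THEN iffD1, of _ _ y "- ?m", OF H_deriv[of 2 "y + - ?m"]] by (simp add: numeral_3_eq_3 numeral_2_eq_2)
          have ct: "continuous_on UNIV ?H3"
            by (intro continuous_on_compose2[OF H_cont] continuous_intros) auto
          have sh1: "0 < ((\<lambda>_. a)(j := a + 1)) i" for i j :: nat using ab by simp
          have tw: "(\<lambda>_. a)(k := a + 1, i := a + 1) = ?sh" using ik by (intro fun_upd_twist) auto
          have "E - hh i = c t k / b * X"
            using gamma_prod_shape_diff[where sh="(\<lambda>_. a)(i := a + 1)" and i=k and c="c t" and B="Bd 2" and B'="Bd 3",
                OF ab(2) sh1 ik(2) d ct] Bd[of 2] Bd[of 3] ik
            by (simp add: E_def X_def hh_def)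
          moreover have "E - hh k = c t i / b * X"
            using gamma_prod_shape_diff[where sh="(\<lambda>_. a)(k := a + 1)" and i=i and c="c t" and B="Bd 2" and B'="Bd 3",
                OF ab(2) sh1 _ d ct, of n] Bd[of 2] Bd[of 3] ik
            by (simp add: E_def X_def hh_def tw)
          ultimately have diff: "hh i - hh k = (c t i - c t k) / b * X"
            by (simp add: diff_divide_distrib left_diff_distrib)
          have "X \<le> 0"
          proof -
            let ?B = "\<lambda>y. hat ((y - x) / h)"
            \<comment> \<open>A unit step of the spline variable is a step \<open>h\<close> in
              \<open>y\<close>.\<close>
            have "H 3 y = (- 1 / h ^ 3) * (?B y - 2 * ?B (y - h) + ?B (y - 2 * h))" for y
            proof -
              have "(y - h - x) / h = (y - x) / h - 1" "(y - 2 * h - x) / h = (y - x) / h - 2"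
                using h by (simp_all add: field_simps)
              thus ?thesis unfolding H_def spline_step_3 by (simp only: minus_divide_left times_divide_eq_left mult_minus_left mult_1_left)
            qed
            hence "X = (- 1 / h ^ 3) * (\<integral>y. ?B y - 2 * ?B (y - h) + ?B (y - 2 * h) \<partial>Q_aug_dist a b ?l i k)"
              unfolding X_def using integral_gamma_prod_eq_Q_aug[OF ab, of i n k "H 3" "c t"] ik by simp
            moreover have "0 \<le> (\<integral>y. ?B y - 2 * ?B (y - h) + ?B (y - 2 * h) \<partial>Q_aug_dist a b ?l i k)"
            proof (rule integral_Q_aug_second_difference_nonneg'[OF ab Qabs, of t i k M h ?B 1])
              show "continuous_on UNIV ?B"
                by (intro continuous_on_compose2[OF continuous_on_hat[of UNIV]] continuous_intros) (use h in auto)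
              have supp: "x < y \<and> y < x + 2 * h" if "?B y \<noteq> 0" for y
                using hat_supp[OF that] h by (auto simp: field_simps)
              show "(\<forall>y. ?B y \<noteq> 0 \<longrightarrow> M < y) \<or> (\<forall>y. ?B y \<noteq> 0 \<longrightarrow> y + 2 * h < - M)"
              proof (cases "0 \<le> x")
                case True
                thus ?thesis using supp M(2) by force
              next
                case False
                have "y + 2 * h < - M" if "?B y \<noteq> 0" for y using supp[OF that] h False by simp
                thus ?thesis by blast
              qed
            qed (use t ik h M in \<open>auto simp: hat_nonneg hat_le\<close>)
            ultimately show ?thesis using h by (simp add: divide_le_0_iff)
          qed
          moreover have "0 \<le> (c t i - c t k) / b" using sorted[of t i k] t ik ab by simp
          ultimately have "(c t i - c t k) / b * X \<le> 0" by (rule mult_nonneg_nonpos[rotated])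
          thus ?thesis using diff by simp
        qed
        have "(\<Sum>i<n. (q i - p i) * hh i) \<le> 0"
        proof (rule abel_sum_nonpos_on[OF pre tot, where P = "\<lambda>i. c t i \<noteq> 0"])
          show "hh i \<le> hh k" if "i < k" "k < n" "c t i \<noteq> 0" "c t k \<noteq> 0" for i k by (rule mono[OF that])
          \<comment> \<open>A zero weight has vanishing \<open>c' t i * c t i\<close>, which is half
            the increment of its square.\<close>
          show "q i - p i = 0" if "\<not> c t i \<noteq> 0" for i using c'c[OF t, of i] that by simp
        qed
        hence "a / b\<^sup>2 / 2 * (\<Sum>i<n. (q i - p i) * hh i) \<le> 0"
          using ab by (intro mult_nonneg_nonpos) auto
        thus ?thesis unfolding c'c[OF t] by (simp add: sum_distrib_left mult_ac)
      qed
      ultimately show ?thesis by blast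
    qed
    \<comment> \<open>The derivative was bounded only inside the interval; dominated convergence
      supplies the ends.\<close>
    have "isCont J t" for t
      unfolding continuous_at_sequentially
    proof (intro allI impI)
      fix T assume T: "T \<longlonglongrightarrow> t"
      show "(J \<circ> T) \<longlonglongrightarrow> J t"
        unfolding J o_def
      proof (rule integral_dominated_convergence[where w = "\<lambda>_. Bd 0"])
        have "(\<lambda>n. c (T n) i) \<longlonglongrightarrow> c t i" for i
          unfolding c_def by (intro tendsto_intros T)
        hence "(\<lambda>n. ?S (T n) \<omega>) \<longlonglongrightarrow> ?S t \<omega>" for \<omega> by (intro tendsto_intros)
        moreover have "isCont (H 0) y" for y using H_cont by (simp add: continuous_on_eq_continuous_at)
        ultimately show "AE \<omega> in gamma_prod b n (\<lambda>_. a). (\<lambda>n. H 0 (?S (T n) \<omega>)) \<longlonglongrightarrow> H 0 (?S t \<omega>)"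
          by (intro AE_I2 isCont_tendsto_compose[of _ "H 0"])
        show "AE \<omega> in gamma_prod b n (\<lambda>_. a). norm (H 0 (?S (T m) \<omega>)) \<le> Bd 0" for m
          using Bd[of 0] by simp
      qed (auto)
    qed
    thus "continuous_on {0..1} J" by (intro continuous_at_imp_continuous_on) auto
  qed simp
  thus ?thesis .
qed

text \<open>The spline is exactly 1 up to \<open>x\<close> and 0 from \<open>x\<close> plus four
  widths on, so it converges at every point to the indicator of the closed half line,
  \<open>x\<close> included; no continuity of the law enters.\<close>

lemma spline_step_tendsto_cdf:
  assumes ab: "0 < a" "0 < b" and M: "0 < d"
  shows "(\<lambda>m. \<integral>\<omega>. spline_step 0 ((csum a b n c \<omega> - x) / (d / (real m + 1))) \<partial>gamma_prod b n (\<lambda>_. a))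
    \<longlonglongrightarrow> measure (Q_dist a b (map c [0..<n])) {y. y - Q_mean a b (map c [0..<n]) \<le> x}"
proof -
  let ?l = "map c [0..<n]" and ?P = "gamma_prod b n (\<lambda>_. a)"
  let ?S = "csum a b n c"
  interpret prob_space ?P by (rule prob_space_gamma_prod) (use ab in auto)
  obtain B where B: "\<And>z. \<bar>spline_step 0 z\<bar> \<le> B" using spline_step_bounded[of 0] by auto
  have [measurable]: "spline_step 0 \<in> borel_measurable borel"
    by (rule borel_measurable_continuous_onI[OF continuous_on_spline_step])
  have lim: "(\<lambda>m. spline_step 0 ((y - x) / (d / (real m + 1)))) \<longlonglongrightarrow> indicator {..x} y" for y
  proof (cases "y \<le> x")
    case True
    hence "spline_step 0 ((y - x) / (d / (real m + 1))) = 1" for m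
    proof -
      have "(y - x) / (d / (real m + 1)) \<le> 0"
        by (rule divide_nonpos_pos) (use True M in auto)
      thus ?thesis by (simp add: spline_step_le_0)
    qed
    thus ?thesis using True by simp
  next
    case False
    have "filterlim (\<lambda>m. (y - x) / (d / (real m + 1))) at_top sequentially"
      using False M by real_asymp
    hence "eventually (\<lambda>m. 4 \<le> (y - x) / (d / (real m + 1))) sequentially"
      by (simp add: filterlim_at_top)
    hence "eventually (\<lambda>m. spline_step 0 ((y - x) / (d / (real m + 1))) = 0) sequentially"
      by (rule eventually_mono) (simp add: spline_step_ge_4)
    thus ?thesis using False by (simp add: tendsto_eventually)
  qed
  have "(\<lambda>m. \<integral>\<omega>. spline_step 0 ((?S \<omega> - x) / (d / (real m + 1))) \<partial>?P) \<longlonglongrightarrow> (\<integral>\<omega>. indicator {..x} (?S \<omega>) \<partial>?P)"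
    by (rule integral_dominated_convergence[where w = "\<lambda>_. B"]) (use B lim in auto)
  also have "(\<integral>\<omega>. indicator {..x} (?S \<omega>) \<partial>?P) = (\<integral>\<omega>. indicat_real {y. y - a / b * (\<Sum>i<n. c i) \<le> x} (\<Sum>i<n. c i * \<omega> i) \<partial>?P)"
    by (intro Bochner_Integration.integral_cong) (auto simp: indicator_def)
  also have "\<dots> = (\<integral>y. indicat_real {y. y - a / b * (\<Sum>i<n. c i) \<le> x} y \<partial>gsum_law b n (\<lambda>_. a) c)"
    unfolding gsum_law_def by (subst integral_distr) auto
  also have "gsum_law b n (\<lambda>_. a) c = Q_dist a b ?l"
    unfolding Q_dist_eq_gsum_law by (simp, rule gsum_law_cong) simp
  also have "(\<integral>y. indicat_real {y. y - a / b * (\<Sum>i<n. c i) \<le> x} y \<partial>Q_dist a b ?l) =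
      measure (Q_dist a b ?l) {y. y - Q_mean a b ?l \<le> x}"
    using real_distribution.space_eq_univ[OF real_distribution_Q_dist[OF ab, of ?l]] ab by (simp add: Q_mean_eq)
  finally show ?thesis .
qed

section \<open>Arranging the weights by sign and size\<close>

lemma mset_sort_dec [simp]: "mset (sort_dec v) = mset v"
  by (simp add: sort_dec_def)

lemma length_sort_dec [simp]: "length (sort_dec v) = length v"
  by (simp add: sort_dec_def)

lemma set_sort_dec [simp]: "set (sort_dec v) = set v"
  by (simp add: sort_dec_def)

lemma sort_dec_nth_mono: "i \<le> k \<Longrightarrow> k < length v \<Longrightarrow> sort_dec v ! k \<le> sort_dec v ! i"
  by (simp add: sort_dec_def rev_nth sorted_nth_mono)

lemma length_pad_to: "length v \<le> N \<Longrightarrow> length (pad_to N v) = N"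
  by (simp add: pad_to_def)

lemma prod_list_map_sort_dec_pad_to:
  fixes f :: "real \<Rightarrow> 'b::comm_monoid_mult"
  assumes "f 0 = 1"
  shows "prod_list (map f (sort_dec (pad_to N v))) = prod_list (map f v)"
proof -
  have "prod_list (map f (sort_dec (pad_to N v))) = prod_mset (image_mset f (mset (sort_dec (pad_to N v))))"
    by (metis mset_map prod_mset_prod_list)
  also have "\<dots> = prod_list (map f (pad_to N v))"
    by (simp flip: mset_map prod_mset_prod_list)
  also have "\<dots> = prod_list (map f v)"
    by (simp add: pad_to_def assms)
  finally show ?thesis .
qed

text \<open>Decreasing order, with the positive parts in the first and the negative parts in the last \<open>N\<close>
  positions; the zero weights this introduces do not affect the law.\<close>

definition signed_arrangement :: "nat \<Rightarrow> real list \<Rightarrow> real list" where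
  "signed_arrangement N l = map sqrt (sort_dec (pad_to N (pos_sq l))) @
     rev (map (\<lambda>v. - sqrt v) (sort_dec (pad_to N (neg_sq l))))"

lemma char_Q_dist:
  "0 < a \<Longrightarrow> 0 < b \<Longrightarrow> char (Q_dist a b l) s = prod_list (map (\<lambda>t. char (gamma_M a b) (t * s)) l)"
  by (simp add: Q_dist_eq_gsum_law char_gsum_law prod.list_conv_set_nth atLeast0LessThan)

text \<open>Each weight is replaced by its positive and its negative part, at least one of which is
  0 and contributes a characteristic function equal to 1; sorting only permutes the factors.\<close>

lemma Q_dist_signed_arrangement:
  assumes ab: "0 < a" "0 < b"
  shows "Q_dist a b (signed_arrangement N l) = Q_dist a b l"
proof (rule Levy_uniqueness)
  show "char (Q_dist a b (signed_arrangement N l)) = char (Q_dist a b l)"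
  proof
    fix s
    define f where "f t = char (gamma_M a b) (t * s)" for t
    have f0: "f 0 = 1" using ab by (simp add: f_def char_zero_gamma_M)
    have "prod_list (map f (signed_arrangement N l)) =
        prod_list (map (\<lambda>v. f (sqrt v)) (sort_dec (pad_to N (pos_sq l)))) *
        prod_list (map (\<lambda>v. f (- sqrt v)) (sort_dec (pad_to N (neg_sq l))))"
      by (simp add: signed_arrangement_def rev_map[symmetric] o_def prod_list.rev)
    also have "\<dots> = prod_list (map (\<lambda>v. f (sqrt v)) (pos_sq l)) * prod_list (map (\<lambda>v. f (- sqrt v)) (neg_sq l))"
      by (simp add: prod_list_map_sort_dec_pad_to f0)
    also have "\<dots> = prod_list (map (\<lambda>t. f (sqrt ((max t 0)\<^sup>2)) * f (- sqrt ((min t 0)\<^sup>2))) l)"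
      by (induction l) (simp_all add: pos_sq_def neg_sq_def o_def mult_ac del: real_sqrt_abs)
    also have "(\<lambda>t. f (sqrt ((max t 0)\<^sup>2)) * f (- sqrt ((min t 0)\<^sup>2))) = f"
      by (rule ext) (auto simp: f0 max_def min_def)
    finally show "char (Q_dist a b (signed_arrangement N l)) s = char (Q_dist a b l) s"
      unfolding char_Q_dist[OF ab] f_def .
  qed
qed (use ab in \<open>auto intro: real_distribution_Q_dist\<close>)

lemma sum_list_take: "k \<le> length xs \<Longrightarrow> sum_list (take k xs) = (\<Sum>i<k. xs ! i)"
  by (simp add: sum_list_sum_nth atLeast0LessThan min_def)

theorem theorem4:
  fixes a b lam phi x :: real and la mu :: "real list"
  assumes "a > 0" and "b > 0" and "lam > 0" and "phi / sqrt a \<ge> lam"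
    and "la \<in> Q_abs lam phi a b" and "mu \<in> Q_abs lam phi a b"
    and "F_le mu la"
    and "ereal \<bar>x\<bar> > x_upper lam phi a b"
  shows "measure (Q_dist a b mu) {y. y - Q_mean a b mu \<le> x}
           \<ge> measure (Q_dist a b la) {y. y - Q_mean a b la \<le> x}"
proof -
  note ab = assms(1,2)
  define N where "N = max (length mu) (length la)"
  define A where "A l = sort_dec (pad_to N (pos_sq l))" for l
  define B where "B l = sort_dec (pad_to N (neg_sq l))" for l
  \<comment> \<open>The second block is reversed so that the most negative weight comes last. The
    default 0 beyond \<open>2 * N\<close> makes nonnegativity hold for every index.\<close>
  define sq where "sq l i = (if i < N then A l ! i else if i < 2 * N then B l ! (2 * N - 1 - i) else 0)" for l i
  define sg :: "nat \<Rightarrow> real" where "sg i = (if i < N then 1 else - 1)" for i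
  define c where "c = (\<lambda>t i. sg i * sqrt ((1 - t) * sq mu i + t * sq la i))"
  have len: "length mu \<le> N" "length la \<le> N" by (auto simp: N_def)
  have N: "0 < N" using assms(5) by (cases la) (auto simp: N_def Q_abs_def)
  have lenA: "length (A l) = N" "length (B l) = N" if "length l \<le> N" for l
    using that by (simp_all add: A_def B_def length_pad_to pos_sq_def neg_sq_def)
  have arr: "signed_arrangement N l = map (\<lambda>i. sg i * sqrt (sq l i)) [0..<2 * N]" if "length l \<le> N" for l
  proof (rule nth_equalityI)
    fix i assume "i < length (signed_arrangement N l)"
    thus "signed_arrangement N l ! i = map (\<lambda>i. sg i * sqrt (sq l i)) [0..<2 * N] ! i"
      using lenA[OF that]
      by (auto simp: signed_arrangement_def nth_append rev_nth sg_def sq_def A_def[symmetric] B_def[symmetric]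
          intro!: arg_cong[where f="nth (B l)"])
  qed (use lenA[OF that] in \<open>simp add: signed_arrangement_def A_def B_def\<close>)
  \<comment> \<open>This bound survives convex combinations of squares, which keeps the path inside
    \<open>Q_abs\<close>.\<close>
  have entries: "0 \<le> v \<and> v \<le> (b * lam)\<^sup>2" if "v \<in> set (A l) \<union> set (B l)" "l \<in> Q_abs lam phi a b" for v l
  proof -
    have "\<bar>t\<bar> \<le> b * lam" if "t \<in> set l" for t
      using \<open>l \<in> Q_abs lam phi a b\<close> that ab by (auto simp: Q_abs_def in_set_conv_nth field_simps)
    hence "(max t 0)\<^sup>2 \<le> (b * lam)\<^sup>2" "(min t 0)\<^sup>2 \<le> (b * lam)\<^sup>2" if "t \<in> set l" for t
      using that ab assms(3) by (fastforce intro!: abs_le_square_iff[THEN iffD1] simp: max_def min_def)+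
    thus ?thesis using that(1) by (auto simp: A_def B_def pad_to_def pos_sq_def neg_sq_def)
  qed
  have sq_in: "sq l i \<in> set (A l) \<union> set (B l)" if "i < 2 * N" "length l \<le> N" for l i
    using that lenA[OF that(2)] by (auto simp: sq_def)
  have c0: "c 0 = (\<lambda>i. sg i * sqrt (sq mu i))" and c1: "c 1 = (\<lambda>i. sg i * sqrt (sq la i))"
    by (simp_all add: c_def)
  have law: "Q_dist a b (map (c 0) [0..<2 * N]) = Q_dist a b mu" "Q_dist a b (map (c 1) [0..<2 * N]) = Q_dist a b la"
    using Q_dist_signed_arrangement[OF ab] arr len unfolding c0 c1 by metis+
  have mean: "Q_mean a b (map (c 0) [0..<2 * N]) = Q_mean a b mu" "Q_mean a b (map (c 1) [0..<2 * N]) = Q_mean a b la"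
    by (simp_all add: Q_mean_def law)
  have nn: "0 \<le> sq mu i" "0 \<le> sq la i" for i
    using entries[OF sq_in[of i mu]] entries[OF sq_in[of i la]] len assms(5,6)
    by (cases "i < 2 * N"; simp add: sq_def)+
  \<comment> \<open>Rearranging leaves the law and hence the variance unchanged, so the totals can
    be read off from \<open>Q_abs\<close>.\<close>
  have sumsq: "a / b\<^sup>2 * (\<Sum>i<2 * N. sq mu i) = phi\<^sup>2" "a / b\<^sup>2 * (\<Sum>i<2 * N. sq la i) = phi\<^sup>2"
  proof -
    have "Q_var a b (map (c 0) [0..<2 * N]) = phi\<^sup>2" "Q_var a b (map (c 1) [0..<2 * N]) = phi\<^sup>2"
      unfolding Q_var_def mean law using assms(5,6) by (simp_all add: Q_abs_def Q_var_def)
    moreover have "(c 0 i)\<^sup>2 = sq mu i" "(c 1 i)\<^sup>2 = sq la i" if "i < 2 * N" for i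
      unfolding c0 c1 using nn[of i] by (auto simp: sg_def power_mult_distrib)
    ultimately show "a / b\<^sup>2 * (\<Sum>i<2 * N. sq mu i) = phi\<^sup>2" "a / b\<^sup>2 * (\<Sum>i<2 * N. sq la i) = phi\<^sup>2"
      using ab by (simp_all add: Q_var_eq)
  qed
  have tot: "(\<Sum>i<2 * N. sq la i - sq mu i) = 0"
  proof -
    have "a / b\<^sup>2 \<noteq> 0" using ab by simp
    moreover have "a / b\<^sup>2 * (\<Sum>i<2 * N. sq la i) = a / b\<^sup>2 * (\<Sum>i<2 * N. sq mu i)" using sumsq by simp
    ultimately have "(\<Sum>i<2 * N. sq la i) = (\<Sum>i<2 * N. sq mu i)" by (metis mult_cancel_left)
    thus ?thesis by (simp add: sum_subtractf)
  qed
  have maj: "(\<Sum>i<k. A mu ! i) \<le> (\<Sum>i<k. A la ! i)" "(\<Sum>i<k. B la ! i) \<le> (\<Sum>i<k. B mu ! i)" if "k \<le> N" for k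
  proof -
    have "length (pos_sq l) = length l" "length (neg_sq l) = length l" for l by (simp_all add: pos_sq_def neg_sq_def)
    hence "sum_list (take k (A mu)) \<le> sum_list (take k (A la))" "sum_list (take k (B la)) \<le> sum_list (take k (B mu))"
      using assms(7) that by (auto simp: F_le_def weak_submaj_def Let_def A_def B_def N_def max.commute)
    thus "(\<Sum>i<k. A mu ! i) \<le> (\<Sum>i<k. A la ! i)" "(\<Sum>i<k. B la ! i) \<le> (\<Sum>i<k. B mu ! i)"
      using that lenA len by (simp_all add: sum_list_take)
  qed
  have pre: "0 \<le> (\<Sum>i<k. sq la i - sq mu i)" if k: "k \<le> 2 * N" for k
  proof (cases "k \<le> N")
    case True
    have "(\<Sum>i<k. sq la i - sq mu i) = (\<Sum>i<k. A la ! i) - (\<Sum>i<k. A mu ! i)"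
      using True unfolding sum_subtractf[symmetric] by (intro sum.cong) (auto simp: sq_def)
    thus ?thesis using maj(1)[OF True] by simp
  next
    case False
    \<comment> \<open>Past the positive block the prefix sum is minus the remaining tail, because
      the total is 0. Read backwards, that tail is a prefix of the sorted negative parts, where the
      majorization goes the other way.\<close>
    have "(\<Sum>i<2 * N. sq la i - sq mu i) = (\<Sum>i<k. sq la i - sq mu i) + (\<Sum>i\<in>{k..<2 * N}. sq la i - sq mu i)"
      using k by (simp add: sum.atLeastLessThan_concat[of 0 k "2 * N", symmetric] flip: atLeast0LessThan)
    moreover have "(\<Sum>i\<in>{k..<2 * N}. sq la i - sq mu i) = (\<Sum>j<2 * N - k. B la ! j - B mu ! j)"
      by (rule sum.reindex_bij_witness[where i = "\<lambda>j. 2 * N - 1 - j" and j = "\<lambda>i. 2 * N - 1 - i"])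
        (use False k in \<open>auto simp: sq_def\<close>)
    moreover have "(\<Sum>j<2 * N - k. B la ! j - B mu ! j) \<le> 0"
      using maj(2)[of "2 * N - k"] False by (simp add: sum_subtractf)
    ultimately show ?thesis using tot by simp
  qed
  have sq_mono: "sq l k \<le> sq l i" if "i < k" "k < N" "length l \<le> N" for l i k
    using that lenA[OF that(3)] unfolding sq_def A_def by (auto intro!: sort_dec_nth_mono)
  have sq_mono': "sq l i \<le> sq l k" if "N \<le> i" "i < k" "k < 2 * N" "length l \<le> N" for l i k
    using that lenA[OF that(4)] unfolding sq_def B_def by (auto intro!: sort_dec_nth_mono)
  have sorted: "c t k \<le> c t i" if t: "0 \<le> t" "t \<le> 1" and ik: "i < k" "k < 2 * N" for t i k
  proof -
    consider "k < N" | "i < N" "N \<le> k" | "N \<le> i" by linarith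
    thus ?thesis
    proof cases
      case 1
      have "(1 - t) * sq mu k + t * sq la k \<le> (1 - t) * sq mu i + t * sq la i"
        using 1 t ik sq_mono len by (intro add_mono mult_left_mono) auto
      thus ?thesis using 1 ik by (simp add: c_def sg_def)
    next
      case 2
      have "0 \<le> (1 - t) * sq mu k + t * sq la k" "0 \<le> (1 - t) * sq mu i + t * sq la i"
        using nn t ik by auto
      hence "0 \<le> sqrt ((1 - t) * sq mu k + t * sq la k)" "0 \<le> sqrt ((1 - t) * sq mu i + t * sq la i)" by simp_all
      hence "- sqrt ((1 - t) * sq mu k + t * sq la k) \<le> sqrt ((1 - t) * sq mu i + t * sq la i)" by linarith
      thus ?thesis using 2 by (simp add: c_def sg_def)
    next
      case 3
      have "(1 - t) * sq mu i + t * sq la i \<le> (1 - t) * sq mu k + t * sq la k"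
        using 3 t ik sq_mono' len by (intro add_mono mult_left_mono) auto
      thus ?thesis using 3 ik by (simp add: c_def sg_def)
    qed
  qed
  have c_sq: "(c t i)\<^sup>2 = (1 - t) * sq mu i + t * sq la i" if "0 \<le> t" "t \<le> 1" "i < 2 * N" for t i
    using that nn by (auto simp: c_def sg_def power_mult_distrib)
  have Qabs: "map (c t) [0..<2 * N] \<in> Q_abs lam phi a b" if t: "0 \<le> t" "t \<le> 1" for t
  proof -
    have "\<bar>c t i\<bar> / b \<le> lam" if i: "i < 2 * N" for i
    proof -
      have "(c t i)\<^sup>2 \<le> (1 - t) * (b * lam)\<^sup>2 + t * (b * lam)\<^sup>2"
        unfolding c_sq[OF t i] using t entries[OF sq_in[OF i]] len assms(5,6)
        by (intro add_mono mult_left_mono) auto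
      hence "(c t i)\<^sup>2 \<le> (b * lam)\<^sup>2" by (simp add: algebra_simps)
      hence "\<bar>c t i\<bar> \<le> \<bar>b * lam\<bar>" by (simp add: abs_le_square_iff)
      thus ?thesis using ab assms(3) by (simp add: field_simps)
    qed
    moreover have "Q_var a b (map (c t) [0..<2 * N]) = phi\<^sup>2"
    proof -
      have "Q_var a b (map (c t) [0..<2 * N]) = a / b\<^sup>2 * (\<Sum>i<2 * N. (1 - t) * sq mu i + t * sq la i)"
        using ab c_sq[OF t] by (simp add: Q_var_eq)
      also have "\<dots> = (1 - t) * (a / b\<^sup>2 * (\<Sum>i<2 * N. sq mu i)) + t * (a / b\<^sup>2 * (\<Sum>i<2 * N. sq la i))"
        by (simp add: sum.distrib sum_distrib_left distrib_left mult_ac)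
      also have "\<dots> = phi\<^sup>2" unfolding sumsq by (simp add: algebra_simps)
      finally show ?thesis .
    qed
    ultimately show ?thesis using N by (simp add: Q_abs_def)
  qed
  obtain M where M: "x_upper lam phi a b < ereal M" "M < \<bar>x\<bar>"
    using ereal_dense2[OF assms(8)] by (metis less_ereal.simps(1))
  \<comment> \<open>The spline of width parameter \<open>d / (real m + 1)\<close> descends over four
    such widths, so this choice fits every one of them into the gap between \<open>M\<close> and
    \<open>\<bar>x\<bar>\<close>.\<close>
  define d where "d = (\<bar>x\<bar> - M) / 4"
  have d: "0 < d" using M by (simp add: d_def)
  have *: "(\<integral>\<omega>. spline_step 0 ((csum a b (2 * N) (c 1) \<omega> - x) / (d / (real m + 1))) \<partial>gamma_prod b (2 * N) (\<lambda>_. a))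
     \<le> (\<integral>\<omega>. spline_step 0 ((csum a b (2 * N) (c 0) \<omega> - x) / (d / (real m + 1))) \<partial>gamma_prod b (2 * N) (\<lambda>_. a))" for m
    unfolding c_def
  proof (rule expectation_spline_path_antimono[OF ab _ _ _ _ _ _ _ M])
    show "sg i = 1 \<or> sg i = - 1" for i by (simp add: sg_def)
    show "0 < d / (real m + 1)" using d by simp
    have "d / (real m + 1) \<le> d / 1" using d by (intro divide_left_mono) auto
    hence "4 * (d / (real m + 1)) \<le> 4 * d" by linarith
    also have "4 * d = \<bar>x\<bar> - M" by (simp add: d_def)
    finally show "4 * (d / (real m + 1)) \<le> \<bar>x\<bar> - M" .
  qed (fact nn sorted[unfolded c_def] pre tot Qabs[unfolded c_def])+
  have "measure (Q_dist a b (map (c 1) [0..<2 * N])) {y. y - Q_mean a b (map (c 1) [0..<2 * N]) \<le> x}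
      \<le> measure (Q_dist a b (map (c 0) [0..<2 * N])) {y. y - Q_mean a b (map (c 0) [0..<2 * N]) \<le> x}"
    by (rule LIMSEQ_le[OF spline_step_tendsto_cdf[OF ab d] spline_step_tendsto_cdf[OF ab d]]) (use * in blast)
  thus ?thesis unfolding law mean .
qed

end
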